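(* The $D$-functions $\mathcal{D}^{\,j}_{m',m}$ of the Jordanian quantum group $SL_h(2)$ satisfy, for every spin $j$, the orthogonality-like relations $$\sum_{m_1,m_2}(-1)^{k_1-m_1}\,(F^{j,j})^{m_1,-m_1}_{m_1,m_2}\,\mathcal{D}^{\,j}_{k_1,m_1}\mathcal{D}^{\,j}_{k_2,m_2}=(F^{j,j})^{k_1,-k_1}_{k_1,k_2}\qquad\text{for all }k_1,k_2\in\{-j,\dots,j\},$$ $$\sum_{k_1,k_2}(-1)^{m_1-k_1}\,((F^{-1})^{j,j})^{k_1,k_2}_{k_1,-k_1}\,\mathcal{D}^{\,j}_{k_1,m_1}\mathcal{D}^{\,j}_{k_2,m_2}=((F^{-1})^{j,j})^{m_1,m_2}_{m_1,-m_1}\qquad\text{for all }m_1,m_2\in\{-j,\dots,j\},$$ with summation indices running over $\{-j,\dots,j\}$. For $h=0$ these relations reduce to the orthogonality relations of the $SL(2)$ $D$-functions.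
   Context: $SL_h(2)$: the Hopf algebra generated by $x,y,u,v$ with relations $[v,x]=hv^2$, $[u,x]=h(D-x^2)$, $[v,y]=hv^2$, $[u,y]=h(D-y^2)$, $[x,y]=h(xv-yv)$, $[v,u]=h(xv+vy)$, where $D=xy-uv-hxv$ is central, together with $D=1$. Its coproduct and counit are those of the matrix $\begin{pmatrix} x & u \\ v & y \end{pmatrix}$. $h$ is the deformation parameter, and expressions such as logarithms are understood as power series in $h$. Dual algebra $\mathcal{U}_h(sl(2))$: generated by $J_0,J_\pm$ with $[J_0,J_\pm]=\pm2J_\pm$, $[J_+,J_-]=J_0$, and coproduct $\Delta=\mathcal{F}\Delta_0\mathcal{F}^{-1}$, where $\Delta_0(X)=X\otimes1+1\otimes X$ for $X\in sl(2)$, $\mathcal{F}=\exp(-\frac12J_0\otimes\sigma)$, $\sigma=-\ln(1-2hJ_+)$. Its spin-$j$ representation ($j\in\{0,\frac12,1,\dots\}$) has orthonormal basis $|jm\rangle$, $m=-j,\dots,j$, with $J_0|jm\rangle=2m|jm\rangle$, $J_\pm|jm\rangle=\sqrt{(j\mp m)(j\pm m+1)}\,|j\,m\pm1\rangle$. $D$-functions: $\mathcal{D}^{\,j}_{m',m}=\sum_\alpha x^\alpha\langle jm'|X_\alpha|jm\rangle\in SL_h(2)$, where $\{x^\alpha\}$ and $\{X_\alpha\}$ are dual bases of $SL_h(2)$ and $\mathcal{U}_h(sl(2))$ (product of one dual to coproduct of the other); i.e. $\mathcal{D}^{\,j}_{m',m}$ is the matrix coefficient $X\mapsto\langle jm'|X|jm\rangle$.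 In particular, for spin $\frac12$, with rows and columns ordered $\frac12,-\frac12$, $\left(\mathcal{D}^{\,1/2}_{m',m}\right)=\begin{pmatrix} x & u \\ v & y \end{pmatrix}$. Matrix elements of the twist: $(F^{j_1,j_2})^{s_1,s_2}_{m_1,m_2}=\langle j_1m_1|\otimes\langle j_2m_2|\;\mathcal{F}\;|j_1s_1\rangle\otimes|j_2s_2\rangle$ and $((F^{-1})^{j_1,j_2})^{s_1,s_2}_{m_1,m_2}=\langle j_1m_1|\otimes\langle j_2m_2|\;\mathcal{F}^{-1}\;|j_1s_1\rangle\otimes|j_2s_2\rangle$. *)

theory Defs
  imports
    "HOL-Analysis.Determinants"
    "HOL-Library.Poly_Mapping"
    "HOL-Library.Product_Plus"
    "HOL-Computational_Algebra.Polynomial"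
    "HOL-Computational_Algebra.Formal_Power_Series"
begin

section \<open>Algebras given by generators and relations\<close>

text \<open>
  The free monoid on a set of generators.  Its operation is concatenation, but it is written
  additively, because the convolution product of \<open>'a \<Rightarrow>\<^sub>0 'b\<close> is taken over an additive monoid of
  keys.  Hence \<open>'g gword \<Rightarrow>\<^sub>0 'k\<close> is the free associative unital algebra over \<open>'k\<close>, and
  \<open>('g gword \<times> 'g gword) \<Rightarrow>\<^sub>0 'k\<close> is the tensor product of two copies of it.
\<close>

datatype 'g gword = GWord (letters: "'g list")

instantiation gword :: (type) monoid_add
begin
definition zero_gword :: "'a gword" where "0 = GWord []"
definition plus_gword :: "'a gword \<Rightarrow> 'a gword \<Rightarrow> 'a gword"
  where "v + w = GWord (letters v @ letters w)"
instance by standard (auto simp: zero_gword_def plus_gword_def)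
end

lemma letters_zero [simp]: "letters 0 = []"
  by (simp add: zero_gword_def)

lemma letters_plus [simp]: "letters (v + w) = letters v @ letters w"
  by (simp add: plus_gword_def)

definition scal :: "'k::ring_1 \<Rightarrow> ('m::monoid_add \<Rightarrow>\<^sub>0 'k)"
  where "scal c = Poly_Mapping.single 0 c"

definition gen :: "'g \<Rightarrow> ('g gword \<Rightarrow>\<^sub>0 'k::ring_1)"
  where "gen g = Poly_Mapping.single (GWord [g]) 1"

definition commutator :: "'a::ring \<Rightarrow> 'a \<Rightarrow> 'a"
  where "commutator a b = a * b - b * a"

text \<open>Linear extension of \<open>\<omega>\<close> along the scalar map \<open>\<iota>\<close>.\<close>

definition lin_ext :: "('k::zero \<Rightarrow> 'b::ring_1) \<Rightarrow> ('m \<Rightarrow> 'b) \<Rightarrow> ('m \<Rightarrow>\<^sub>0 'k) \<Rightarrow> 'b"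
  where "lin_ext \<iota> \<omega> p = (\<Sum>w\<in>Poly_Mapping.keys p. \<iota> (Poly_Mapping.lookup p w) * \<omega> w)"

lemma lin_ext_superset:
  assumes "finite S" "Poly_Mapping.keys p \<subseteq> S" "\<iota> 0 = 0"
  shows "lin_ext \<iota> \<omega> p = (\<Sum>w\<in>S. \<iota> (Poly_Mapping.lookup p w) * \<omega> w)"
  unfolding lin_ext_def
  by (rule sum.mono_neutral_left) (use assms in \<open>auto simp: in_keys_iff\<close>)

lemma lin_ext_add:
  fixes p q :: "'m \<Rightarrow>\<^sub>0 'k::ring_1"
  assumes "\<iota> 0 = 0" "\<And>a b. \<iota> (a + b) = \<iota> a + \<iota> b"
  shows "lin_ext \<iota> \<omega> (p + q) = lin_ext \<iota> \<omega> p + lin_ext \<iota> \<omega> q"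
proof -
  let ?S = "Poly_Mapping.keys p \<union> Poly_Mapping.keys q"
  have "Poly_Mapping.keys (p + q) \<subseteq> ?S" by (rule Poly_Mapping.keys_add)
  then show ?thesis
    using lin_ext_superset[of ?S "p + q" \<iota> \<omega>] lin_ext_superset[of ?S p \<iota> \<omega>]
      lin_ext_superset[of ?S q \<iota> \<omega>] assms
    by (simp add: lookup_add distrib_right sum.distrib)
qed

lemma lin_ext_single:
  assumes "\<iota> 0 = 0"
  shows "lin_ext \<iota> \<omega> (Poly_Mapping.single w c) = \<iota> c * \<omega> w"
  using lin_ext_superset[of "{w}" "Poly_Mapping.single w c" \<iota> \<omega>] assms by simp

lemma lin_ext_mult:
  fixes p q :: "'m::monoid_add \<Rightarrow>\<^sub>0 'k::ring_1"
  assumes z: "\<iota> 0 = 0" and a: "\<And>a b. \<iota> (a + b) = \<iota> a + \<iota> b"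
    and m: "\<And>a b. \<iota> (a * b) = \<iota> a * \<iota> b"
    and c: "\<And>a w. \<iota> a * \<omega> w = \<omega> w * \<iota> a"
    and x: "\<And>v w. \<omega> (v + w) = \<omega> v * \<omega> w"
  shows "lin_ext \<iota> \<omega> (p * q) = lin_ext \<iota> \<omega> p * lin_ext \<iota> \<omega> q"
proof -
  note add = lin_ext_add[of \<iota> \<omega>, OF z a] and sng = lin_ext_single[of \<iota> \<omega>, OF z]
  have zero: "lin_ext \<iota> \<omega> 0 = 0" by (simp add: lin_ext_def)
  have upd: "Poly_Mapping.update k b f = f + Poly_Mapping.single k b"
    if "k \<notin> Poly_Mapping.keys f" for k and b :: 'k and f :: "'m \<Rightarrow>\<^sub>0 'k"
    using that by (intro poly_mapping_eqI)
      (auto simp: lookup_add lookup_single lookup_update in_keys_iff when_def)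
  have 1: "lin_ext \<iota> \<omega> (Poly_Mapping.single v s * q)
      = lin_ext \<iota> \<omega> (Poly_Mapping.single v s) * lin_ext \<iota> \<omega> q" for v s
  proof (induction q rule: update_induct)
    case const show ?case by (simp add: zero)
  next
    case (update f k b)
    have "\<iota> (s * b) * \<omega> (v + k) = (\<iota> s * \<omega> v) * (\<iota> b * \<omega> k)"
      by (metis c m x mult.assoc)
    then show ?case
      using update by (simp add: upd distrib_left add mult_single sng)
  qed
  show ?thesis
  proof (induction p rule: update_induct)
    case const show ?case by (simp add: zero)
  next
    case (update f k b)
    then show ?case by (simp add: upd distrib_right add 1)
  qed
qed

inductive_set two_sided_ideal :: "'a::ring_1 set \<Rightarrow> 'a set" for R :: "'a set"
  where
    zero: "0 \<in> two_sided_ideal R"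
  | gener: "r \<in> R \<Longrightarrow> a * r * b \<in> two_sided_ideal R"
  | add: "p \<in> two_sided_ideal R \<Longrightarrow> q \<in> two_sided_ideal R \<Longrightarrow> p + q \<in> two_sided_ideal R"

definition ideal_cong :: "'a::ring_1 set \<Rightarrow> 'a \<Rightarrow> 'a \<Rightarrow> bool"
  where "ideal_cong R p q \<longleftrightarrow> p - q \<in> two_sided_ideal R"

lemma two_sided_ideal_mult:
  assumes "p \<in> two_sided_ideal R"
  shows "c * p * d \<in> two_sided_ideal R"
  using assms
proof induction
  case (gener r a b)
  then show ?case
    using two_sided_ideal.gener[of r R "c * a" "b * d"] by (simp add: mult.assoc)
qed (auto simp: distrib_left distrib_right intro: two_sided_ideal.intros)

lemma two_sided_ideal_uminus: "p \<in> two_sided_ideal R \<Longrightarrow> - p \<in> two_sided_ideal R"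
  using two_sided_ideal_mult[of p R "- 1" 1] by simp

lemma ideal_cong_refl: "ideal_cong R p p"
  by (simp add: ideal_cong_def two_sided_ideal.zero)

lemma ideal_cong_add:
  "ideal_cong R p p' \<Longrightarrow> ideal_cong R q q' \<Longrightarrow> ideal_cong R (p + q) (p' + q')"
  using two_sided_ideal.add[of "p - p'" R "q - q'"] by (simp add: ideal_cong_def algebra_simps)

lemma ideal_cong_uminus: "ideal_cong R p p' \<Longrightarrow> ideal_cong R (- p) (- p')"
  using two_sided_ideal_uminus[of "p - p'" R] by (simp add: ideal_cong_def)

lemma ideal_cong_diff:
  "ideal_cong R p p' \<Longrightarrow> ideal_cong R q q' \<Longrightarrow> ideal_cong R (p - q) (p' - q')"
  using ideal_cong_add[of R p p' "- q" "- q'"] ideal_cong_uminus[of R q q'] by simp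

lemma ideal_cong_mult:
  assumes "ideal_cong R p p'" "ideal_cong R q q'"
  shows "ideal_cong R (p * q) (p' * q')"
proof -
  have "p * q - p' * q' = 1 * (p - p') * q + p' * (q - q') * 1"
    by (simp add: algebra_simps)
  then show ?thesis
    unfolding ideal_cong_def
    using two_sided_ideal.add[OF two_sided_ideal_mult[of "p - p'" R 1 q]
        two_sided_ideal_mult[of "q - q'" R p' 1]] assms
    by (simp add: ideal_cong_def)
qed

lemma ideal_cong_equivp: "equivp (ideal_cong R)"
proof (rule equivpI)
  show "reflp (ideal_cong R)" by (simp add: reflpI ideal_cong_refl)
  show "symp (ideal_cong R)"
  proof (rule sympI)
    fix p q assume "ideal_cong R p q"
    then show "ideal_cong R q p"
      using two_sided_ideal_uminus[of "p - q" R] by (simp add: ideal_cong_def)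
  qed
  show "transp (ideal_cong R)"
  proof (rule transpI)
    fix p q s assume "ideal_cong R p q" "ideal_cong R q s"
    then have "(p - q) + (q - s) \<in> two_sided_ideal R"
      unfolding ideal_cong_def by (rule two_sided_ideal.add)
    then show "ideal_cong R p s" by (simp add: ideal_cong_def)
  qed
qed

lemma ideal_cong_hom:
  fixes f :: "'a::ring_1 \<Rightarrow> 'b::ring_1"
  assumes "ideal_cong R p q" and a: "\<And>p q. f (p + q) = f p + f q"
    and m: "\<And>p q. f (p * q) = f p * f q" and r: "\<And>r. r \<in> R \<Longrightarrow> f r = 0"
  shows "f p = f q"
proof -
  have z: "f 0 = 0" using a[of 0 0] by simp
  have "f d = 0" if "d \<in> two_sided_ideal R" for d
    using that by induction (auto simp: a m r z)
  then have "f (p - q) = 0" using assms(1) by (simp add: ideal_cong_def)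
  moreover have "f p = f (p - q) + f q" using a[of "p - q" q] by simp
  ultimately show ?thesis by simp
qed

section \<open>Power series in the deformation parameter\<close>

text \<open>
  The deformation parameter is the variable of \<open>complex fps\<close>.  For a (possibly noncommutative)
  complex algebra \<open>A\<close>, the type \<open>A fps\<close> is \<open>A[[h]]\<close> with central \<open>h\<close>.
\<close>

definition map_fps :: "('a \<Rightarrow> 'b) \<Rightarrow> 'a fps \<Rightarrow> 'b fps"
  where "map_fps f X = Abs_fps (\<lambda>n. f (fps_nth X n))"

text \<open>
  Exponential and logarithm of series without constant term; \<open>\<kappa>\<close> embeds the complex scalars into the
  coefficient algebra.  The coefficient of \<open>h ^ n\<close> in the \<open>k\<close>-th power vanishes for \<open>k > n\<close>, so these
  are the usual infinite series.
\<close>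

definition h_exp :: "(complex \<Rightarrow> 'a::ring_1) \<Rightarrow> 'a fps \<Rightarrow> 'a fps"
  where "h_exp \<kappa> A = Abs_fps (\<lambda>n. \<Sum>k\<le>n. \<kappa> (1 / fact k) * fps_nth (A ^ k) n)"

definition h_ln_one_minus :: "(complex \<Rightarrow> 'a::ring_1) \<Rightarrow> 'a fps \<Rightarrow> 'a fps"
  where "h_ln_one_minus \<kappa> A = Abs_fps (\<lambda>n. - (\<Sum>k=1..n. \<kappa> (1 / of_nat k) * fps_nth (A ^ k) n))"

section \<open>The enveloping algebra of sl(2) and its tensor square\<close>

datatype sl2_gen = Gzero | Gplus | Gminus

type_synonym free_sl2 = "sl2_gen gword \<Rightarrow>\<^sub>0 complex"
type_synonym free_sl2_2 = "(sl2_gen gword \<times> sl2_gen gword) \<Rightarrow>\<^sub>0 complex"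

definition usl_relators :: "free_sl2 set"
  where "usl_relators =
    {commutator (gen Gzero) (gen Gplus) - 2 * gen Gplus,
     commutator (gen Gzero) (gen Gminus) + 2 * gen Gminus,
     commutator (gen Gplus) (gen Gminus) - gen Gzero}"

quotient_type usl = free_sl2 / "ideal_cong usl_relators"
  morphisms rep_usl abs_usl
  by (rule ideal_cong_equivp)

lemma usl_one_neq_zero: "\<not> ideal_cong usl_relators 0 1"
proof
  let ?f = "lin_ext (\<lambda>c. c) (\<lambda>w. if letters w = [] then 1 else 0 :: complex) :: free_sl2 \<Rightarrow> complex"
  have add: "?f (p + q) = ?f p + ?f q" for p q by (rule lin_ext_add) auto
  have mult: "?f (p * q) = ?f p * ?f q" for p q by (rule lin_ext_mult) auto
  have g: "?f (gen g) = 0" for g by (simp add: gen_def lin_ext_single)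
  have diff: "?f (p - q) = ?f p - ?f q" for p q using add[of "p - q" q] by simp
  assume "ideal_cong usl_relators 0 1"
  then have "?f 0 = ?f 1"
    by (rule ideal_cong_hom)
      (auto simp: usl_relators_def commutator_def add mult g diff simp del: mult_numeral_left)
  moreover have "?f 0 = 0" by (simp add: lin_ext_def)
  moreover have "?f 1 = 1"
    using lin_ext_single[of "\<lambda>c. c" "\<lambda>w. if letters w = [] then 1 else 0 :: complex"
        "0 :: sl2_gen gword" 1] by simp
  ultimately show False by simp
qed

instantiation usl :: ring_1
begin
lift_definition zero_usl :: usl is 0 .
lift_definition one_usl :: usl is 1 .
lift_definition plus_usl :: "usl \<Rightarrow> usl \<Rightarrow> usl" is "(+)" by (rule ideal_cong_add)
lift_definition minus_usl :: "usl \<Rightarrow> usl \<Rightarrow> usl" is "(-)" by (rule ideal_cong_diff)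
lift_definition uminus_usl :: "usl \<Rightarrow> usl" is uminus by (rule ideal_cong_uminus)
lift_definition times_usl :: "usl \<Rightarrow> usl \<Rightarrow> usl" is "(*)" by (rule ideal_cong_mult)
instance
proof
  fix a b c :: usl
  show "a + b + c = a + (b + c)" by transfer (simp add: add.assoc ideal_cong_refl)
  show "a + b = b + a" by transfer (simp add: add.commute ideal_cong_refl)
  show "0 + a = a" by transfer (simp add: ideal_cong_refl)
  show "- a + a = 0" by transfer (simp add: ideal_cong_refl)
  show "a - b = a + - b" by transfer (simp add: ideal_cong_refl)
  show "a * b * c = a * (b * c)" by transfer (simp add: mult.assoc ideal_cong_refl)
  show "1 * a = a" by transfer (simp add: ideal_cong_refl)
  show "a * 1 = a" by transfer (simp add: ideal_cong_refl)
  show "(a + b) * c = a * c + b * c" by transfer (simp add: distrib_right ideal_cong_refl)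
  show "a * (b + c) = a * b + a * c" by transfer (simp add: distrib_left ideal_cong_refl)
  show "(0 :: usl) \<noteq> 1" by transfer (rule usl_one_neq_zero)
qed
end

definition usl_gen :: "sl2_gen \<Rightarrow> usl" where "usl_gen g = abs_usl (gen g)"
definition usl_scal :: "complex \<Rightarrow> usl" where "usl_scal c = abs_usl (scal c)"

abbreviation J_zero :: usl where "J_zero \<equiv> usl_gen Gzero"
abbreviation J_plus :: usl where "J_plus \<equiv> usl_gen Gplus"
abbreviation J_minus :: usl where "J_minus \<equiv> usl_gen Gminus"

text \<open>
  With \<open>U = T / I\<close>, the algebra \<open>U \<otimes> U\<close> is \<open>T \<otimes> T\<close> modulo \<open>I \<otimes> T + T \<otimes> I\<close>, which is the ideal
  generated by all \<open>r \<otimes> 1\<close> and \<open>1 \<otimes> r\<close> for relators \<open>r\<close>.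
\<close>

definition free_left :: "free_sl2 \<Rightarrow> free_sl2_2"
  where "free_left = lin_ext scal (\<lambda>w. Poly_Mapping.single (w, 0) 1)"

definition free_right :: "free_sl2 \<Rightarrow> free_sl2_2"
  where "free_right = lin_ext scal (\<lambda>w. Poly_Mapping.single (0, w) 1)"

quotient_type usl2 = free_sl2_2 / "ideal_cong (free_left ` usl_relators \<union> free_right ` usl_relators)"
  morphisms rep_usl2 abs_usl2
  by (rule ideal_cong_equivp)

lemma scal_0: "scal 0 = 0"
  by (simp add: scal_def)

lemma scal_add: "scal (a + b) = scal a + scal b"
  by (simp add: scal_def single_add)

lemma scal_mult: "scal (a * b) = scal a * scal b"
  by (simp add: scal_def mult_single)

lemma scal_1: "scal 1 = 1"
  by (simp add: scal_def)

lemma free_left_add: "free_left (p + q) = free_left p + free_left q"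
  unfolding free_left_def by (rule lin_ext_add) (simp_all add: scal_0 scal_add)

lemma free_right_add: "free_right (p + q) = free_right p + free_right q"
  unfolding free_right_def by (rule lin_ext_add) (simp_all add: scal_0 scal_add)

lemma free_left_mult: "free_left (p * q) = free_left p * free_left q"
  unfolding free_left_def
  by (rule lin_ext_mult)
    (simp_all add: scal_0 scal_add scal_mult, simp_all add: scal_def mult_single zero_prod_def)

lemma free_right_mult: "free_right (p * q) = free_right p * free_right q"
  unfolding free_right_def
  by (rule lin_ext_mult)
    (simp_all add: scal_0 scal_add scal_mult, simp_all add: scal_def mult_single zero_prod_def)

lemma free_left_gen: "free_left (gen g) = Poly_Mapping.single (GWord [g], 0) 1"
  by (simp add: free_left_def gen_def lin_ext_single scal_0 scal_1)

lemma free_right_gen: "free_right (gen g) = Poly_Mapping.single (0, GWord [g]) 1"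
  by (simp add: free_right_def gen_def lin_ext_single scal_0 scal_1)

lemma usl2_one_neq_zero:
  "\<not> ideal_cong (free_left ` usl_relators \<union> free_right ` usl_relators) 0 1"
proof
  define \<omega> :: "sl2_gen gword \<times> sl2_gen gword \<Rightarrow> complex"
    where "\<omega> = (\<lambda>w. if letters (fst w) = [] \<and> letters (snd w) = [] then 1 else 0)"
  let ?f = "lin_ext (\<lambda>c. c) \<omega> :: free_sl2_2 \<Rightarrow> complex"
  have add: "?f (p + q) = ?f p + ?f q" for p q by (rule lin_ext_add) auto
  have mult: "?f (p * q) = ?f p * ?f q" for p q by (rule lin_ext_mult) (auto simp: \<omega>_def)
  have diff: "?f (p - q) = ?f p - ?f q" for p q using add[of "p - q" q] by simp
  have l: "?f (free_left (gen g)) = 0" and r: "?f (free_right (gen g)) = 0" for g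
    by (simp_all add: free_left_gen free_right_gen lin_ext_single \<omega>_def)
  have ld: "free_left (p - q) = free_left p - free_left q" for p q
    using free_left_add[of "p - q" q] by simp
  have rd: "free_right (p - q) = free_right p - free_right q" for p q
    using free_right_add[of "p - q" q] by simp
  assume "ideal_cong (free_left ` usl_relators \<union> free_right ` usl_relators) 0 1"
  then have "?f 0 = ?f 1"
    by (rule ideal_cong_hom)
      (auto simp: usl_relators_def commutator_def add mult diff l r ld rd
        free_left_add free_right_add free_left_mult free_right_mult simp del: mult_numeral_left)
  moreover have "?f 0 = 0" by (simp add: lin_ext_def)
  moreover have "?f 1 = 1"
    using lin_ext_single[of "\<lambda>c. c" \<omega> 0 1] by (simp add: \<omega>_def)
  ultimately show False by simp
qed

instantiation usl2 :: ring_1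
begin
lift_definition zero_usl2 :: usl2 is 0 .
lift_definition one_usl2 :: usl2 is 1 .
lift_definition plus_usl2 :: "usl2 \<Rightarrow> usl2 \<Rightarrow> usl2" is "(+)" by (rule ideal_cong_add)
lift_definition minus_usl2 :: "usl2 \<Rightarrow> usl2 \<Rightarrow> usl2" is "(-)" by (rule ideal_cong_diff)
lift_definition uminus_usl2 :: "usl2 \<Rightarrow> usl2" is uminus by (rule ideal_cong_uminus)
lift_definition times_usl2 :: "usl2 \<Rightarrow> usl2 \<Rightarrow> usl2" is "(*)" by (rule ideal_cong_mult)
instance
proof
  fix a b c :: usl2
  show "a + b + c = a + (b + c)" by transfer (simp add: add.assoc ideal_cong_refl)
  show "a + b = b + a" by transfer (simp add: add.commute ideal_cong_refl)
  show "0 + a = a" by transfer (simp add: ideal_cong_refl)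
  show "- a + a = 0" by transfer (simp add: ideal_cong_refl)
  show "a - b = a + - b" by transfer (simp add: ideal_cong_refl)
  show "a * b * c = a * (b * c)" by transfer (simp add: mult.assoc ideal_cong_refl)
  show "1 * a = a" by transfer (simp add: ideal_cong_refl)
  show "a * 1 = a" by transfer (simp add: ideal_cong_refl)
  show "(a + b) * c = a * c + b * c" by transfer (simp add: distrib_right ideal_cong_refl)
  show "a * (b + c) = a * b + a * c" by transfer (simp add: distrib_left ideal_cong_refl)
  show "(0 :: usl2) \<noteq> 1" by transfer (rule usl2_one_neq_zero)
qed
end

lemma ideal_cong_hom_ideal:
  fixes f :: "'a::ring_1 \<Rightarrow> 'b::ring_1"
  assumes "ideal_cong R p q" and a: "\<And>p q. f (p + q) = f p + f q"
    and m: "\<And>p q. f (p * q) = f p * f q" and r: "\<And>r. r \<in> R \<Longrightarrow> f r \<in> S"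
  shows "ideal_cong S (f p) (f q)"
proof -
  have z: "f 0 = 0" using a[of 0 0] by simp
  have "f d \<in> two_sided_ideal S" if "d \<in> two_sided_ideal R" for d
    using that by induction (auto simp: a m r z intro: two_sided_ideal.intros)
  moreover have "f (p - q) = f p - f q" using a[of "p - q" q] by simp
  ultimately show ?thesis using assms(1) by (metis ideal_cong_def)
qed

text \<open>\<open>X \<mapsto> X \<otimes> 1\<close> and \<open>X \<mapsto> 1 \<otimes> X\<close>, so that \<open>X \<otimes> Y = tens_left X * tens_right Y\<close>.\<close>

lift_definition tens_left :: "usl \<Rightarrow> usl2" is free_left
  by (rule ideal_cong_hom_ideal) (auto simp: free_left_add free_left_mult)

lift_definition tens_right :: "usl \<Rightarrow> usl2" is free_right
  by (rule ideal_cong_hom_ideal) (auto simp: free_right_add free_right_mult)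

definition usl2_scal :: "complex \<Rightarrow> usl2" where "usl2_scal c = abs_usl2 (scal c)"

text \<open>Elementary properties needed for the well-definedness of the undeformed coproduct.\<close>

lemma usl_relations:
  "commutator J_zero J_plus = 2 * J_plus"
  "commutator J_zero J_minus = - (2 * J_minus)"
  "commutator J_plus J_minus = J_zero"
proof -
  have rel: "abs_usl r = 0" if "r \<in> usl_relators" for r
    using two_sided_ideal.gener[OF that, of 1 1]
    by (simp add: zero_usl.abs_eq usl.abs_eq_iff ideal_cong_def)
  have two: "(2 :: usl) = abs_usl 2"
    by (metis one_add_one one_usl.abs_eq plus_usl.abs_eq)
  note s = times_usl.abs_eq minus_usl.abs_eq plus_usl.abs_eq usl_gen_def two commutator_def
  have "commutator J_zero J_plus - 2 * J_plus = 0"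
    using rel[of "commutator (gen Gzero) (gen Gplus) - 2 * gen Gplus"]
    by (simp add: s usl_relators_def)
  moreover have "commutator J_zero J_minus + 2 * J_minus = 0"
    using rel[of "commutator (gen Gzero) (gen Gminus) + 2 * gen Gminus"]
    by (simp add: s usl_relators_def)
  moreover have "commutator J_plus J_minus - J_zero = 0"
    using rel[of "commutator (gen Gplus) (gen Gminus) - gen Gzero"]
    by (simp add: s usl_relators_def)
  ultimately show "commutator J_zero J_plus = 2 * J_plus"
    "commutator J_zero J_minus = - (2 * J_minus)" "commutator J_plus J_minus = J_zero"
    by (simp_all add: eq_neg_iff_add_eq_0)
qed

lemma tens_left_add: "tens_left (p + q) = tens_left p + tens_left q"
  by transfer (simp add: free_left_add ideal_cong_refl)

lemma tens_left_mult: "tens_left (p * q) = tens_left p * tens_left q"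
  by transfer (simp add: free_left_mult ideal_cong_refl)

lemma tens_right_add: "tens_right (p + q) = tens_right p + tens_right q"
  by transfer (simp add: free_right_add ideal_cong_refl)

lemma tens_right_mult: "tens_right (p * q) = tens_right p * tens_right q"
  by transfer (simp add: free_right_mult ideal_cong_refl)

lemma tens_gen_commute:
  "tens_left (usl_gen g) * tens_right (usl_gen g') = tens_right (usl_gen g') * tens_left (usl_gen g)"
  by (simp add: usl_gen_def tens_left.abs_eq tens_right.abs_eq times_usl2.abs_eq
      free_left_gen free_right_gen mult_single zero_prod_def)

lemma usl2_scal_hom:
  "usl2_scal 0 = 0" "usl2_scal 1 = 1"
  "usl2_scal (a + b) = usl2_scal a + usl2_scal b"
  "usl2_scal (a * b) = usl2_scal a * usl2_scal b"
  by (simp_all add: usl2_scal_def scal_0 scal_1 scal_add scal_mult zero_usl2.abs_eq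
      one_usl2.abs_eq plus_usl2.abs_eq times_usl2.abs_eq)

lemma usl2_scal_central: "usl2_scal a * z = z * usl2_scal a"
proof -
  have "scal a * p = p * scal a" for p :: free_sl2_2
  proof (induction p rule: update_induct)
    case const show ?case by simp
  next
    case (update f k b)
    have "Poly_Mapping.update k b f = f + Poly_Mapping.single k b"
      using update(1) by (intro poly_mapping_eqI)
        (auto simp: lookup_add lookup_single lookup_update in_keys_iff when_def)
    then show ?case
      using update by (simp add: distrib_left distrib_right scal_def mult_single mult.commute)
  qed
  then show ?thesis
    unfolding usl2_scal_def
    by (metis times_usl2.abs_eq Quotient3_abs_rep[OF Quotient3_usl2])
qed

section \<open>The twisted coproduct\<close>

definition free_coprod0 :: "free_sl2 \<Rightarrow> usl2"
  where "free_coprod0 = lin_ext usl2_scal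
    (\<lambda>w. prod_list (map (\<lambda>g. tens_left (usl_gen g) + tens_right (usl_gen g)) (letters w)))"

lemma free_coprod0_add: "free_coprod0 (p + q) = free_coprod0 p + free_coprod0 q"
  unfolding free_coprod0_def by (rule lin_ext_add) (simp_all add: usl2_scal_hom)

lemma free_coprod0_mult: "free_coprod0 (p * q) = free_coprod0 p * free_coprod0 q"
  unfolding free_coprod0_def
  by (rule lin_ext_mult)
    (auto simp: usl2_scal_hom(1,3) intro: usl2_scal_hom(4) usl2_scal_central)

lemma free_coprod0_gen: "free_coprod0 (gen g) = tens_left (usl_gen g) + tens_right (usl_gen g)"
  by (simp add: free_coprod0_def gen_def lin_ext_single usl2_scal_hom)

lemma free_coprod0_relator:
  assumes "r \<in> usl_relators"
  shows "free_coprod0 r = 0"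
proof -
  have d: "free_coprod0 (p - q) = free_coprod0 p - free_coprod0 q" for p q
    using free_coprod0_add[of "p - q" q] by simp
  have two: "2 * p = p + p" for p :: "'r::ring_1"
    using distrib_right[of 1 1 p] by simp
  have ld: "tens_left (p - q) = tens_left p - tens_left q" for p q
    using tens_left_add[of "p - q" q] by simp
  have rd: "tens_right (p - q) = tens_right p - tens_right q" for p q
    using tens_right_add[of "p - q" q] by simp
  have L: "tens_left (commutator a b) = commutator (tens_left a) (tens_left b)" for a b
    by (simp add: commutator_def ld tens_left_mult)
  have R: "tens_right (commutator a b) = commutator (tens_right a) (tens_right b)" for a b
    by (simp add: commutator_def rd tens_right_mult)
  have c: "free_coprod0 (commutator (gen g) (gen g'))
      = tens_left (commutator (usl_gen g) (usl_gen g'))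
        + tens_right (commutator (usl_gen g) (usl_gen g'))" for g g'
    unfolding L R
    by (simp add: commutator_def d free_coprod0_mult free_coprod0_gen algebra_simps tens_gen_commute)
  have nl: "tens_left (- p) = - tens_left p" for p
    using ld[of 0 p] ld[of 0 0] by simp
  have nr: "tens_right (- p) = - tens_right p" for p
    using rd[of 0 p] rd[of 0 0] by simp
  show ?thesis
    using assms
    by (auto simp: usl_relators_def d c free_coprod0_add usl_relations two tens_left_add
        tens_right_add free_coprod0_gen nl nr ld rd)
qed

lift_definition coprod0 :: "usl \<Rightarrow> usl2" is free_coprod0
  by (rule ideal_cong_hom) (auto simp: free_coprod0_add free_coprod0_mult free_coprod0_relator)

definition sigma :: "usl fps"
  where "sigma = - h_ln_one_minus usl_scal (fps_X * fps_const (2 * J_plus))"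

definition twist :: "usl2 fps"
  where "twist = h_exp usl2_scal
    (- (fps_const (usl2_scal (1 / 2)) * (fps_const (tens_left J_zero) * map_fps tens_right sigma)))"

definition twist_inv :: "usl2 fps"
  where "twist_inv = (THE G. twist * G = 1 \<and> G * twist = 1)"

definition coprod :: "usl fps \<Rightarrow> usl2 fps"
  where "coprod X = twist * map_fps coprod0 X * twist_inv"

text \<open>The counit of the deformed algebra is the undeformed one.\<close>

definition counit :: "usl fps \<Rightarrow> complex fps"
  where "counit = map_fps (\<lambda>X. Poly_Mapping.lookup (rep_usl X) 0)"

section \<open>Spin representations\<close>

definition spin :: "real \<Rightarrow> bool"
  where "spin j \<longleftrightarrow> (\<exists>n::nat. 2 * j = real n)"

definition weights :: "real \<Rightarrow> real set"
  where "weights j = {m. \<exists>i::nat. m = - j + real i \<and> m \<le> j}"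

fun gen_elt :: "real \<Rightarrow> sl2_gen \<Rightarrow> real \<Rightarrow> real \<Rightarrow> real"
  where
    "gen_elt j Gzero m' m = (if m' = m then 2 * m else 0)"
  | "gen_elt j Gplus m' m = (if m' = m + 1 then sqrt ((j - m) * (j + m + 1)) else 0)"
  | "gen_elt j Gminus m' m = (if m' = m - 1 then sqrt ((j + m) * (j - m + 1)) else 0)"

fun word_elt :: "real \<Rightarrow> sl2_gen list \<Rightarrow> real \<Rightarrow> real \<Rightarrow> real"
  where
    "word_elt j [] m' m = (if m' = m then 1 else 0)"
  | "word_elt j (g # w) m' m = (\<Sum>s\<in>weights j. gen_elt j g m' s * word_elt j w s m)"

text \<open>
  The matrix element of \<open>X\<close> in the spin \<open>j\<close> representation between the basis vectors of weights \<open>m'\<close>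
  (bra) and \<open>m\<close> (ket), for \<open>m'\<close> and \<open>m\<close> in \<open>weights j\<close>.  The value does not depend on the chosen
  representative of \<open>X\<close>, since the generators act by the defining relations.
\<close>

definition spin_elt0 :: "real \<Rightarrow> real \<Rightarrow> real \<Rightarrow> usl \<Rightarrow> complex"
  where "spin_elt0 j m' m X
    = lin_ext (\<lambda>c. c) (\<lambda>w. complex_of_real (word_elt j (letters w) m' m)) (rep_usl X)"

definition spin_elt :: "real \<Rightarrow> real \<Rightarrow> real \<Rightarrow> usl fps \<Rightarrow> complex fps"
  where "spin_elt j m' m = map_fps (spin_elt0 j m' m)"

text \<open>
  For functionals \<open>\<phi>\<close> and \<open>\<psi>\<close> on \<open>U[[h]]\<close> that are linear over \<open>complex fps\<close>, the linear functional
  \<open>\<phi> \<otimes> \<psi>\<close> on \<open>(U \<otimes> U)[[h]]\<close>: first on constants (again independently of the representative), then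
  by \<open>h\<close>-linear extension, i.e. as the series of the \<open>h ^ i * (\<phi> \<otimes> \<psi>) (Z_i)\<close>.
\<close>

definition tens_fun0 ::
    "(usl fps \<Rightarrow> complex fps) \<Rightarrow> (usl fps \<Rightarrow> complex fps) \<Rightarrow> usl2 \<Rightarrow> complex fps"
  where "tens_fun0 \<phi> \<psi> z = lin_ext fps_const
    (\<lambda>(v, w). \<phi> (fps_const (abs_usl (Poly_Mapping.single v 1)))
            * \<psi> (fps_const (abs_usl (Poly_Mapping.single w 1)))) (rep_usl2 z)"

definition tens_fun ::
    "(usl fps \<Rightarrow> complex fps) \<Rightarrow> (usl fps \<Rightarrow> complex fps) \<Rightarrow> usl2 fps \<Rightarrow> complex fps"
  where "tens_fun \<phi> \<psi> Z
    = Abs_fps (\<lambda>n. \<Sum>i\<le>n. fps_nth (tens_fun0 \<phi> \<psi> (fps_nth Z i)) (n - i))"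

text \<open>\<open>twist_elt j1 j2 s1 s2 m1 m2\<close> has the ket labels \<open>s1 s2\<close> (upper) before the bra labels \<open>m1 m2\<close>.\<close>

definition twist_elt :: "real \<Rightarrow> real \<Rightarrow> real \<Rightarrow> real \<Rightarrow> real \<Rightarrow> real \<Rightarrow> complex fps"
  where "twist_elt j1 j2 s1 s2 m1 m2 = tens_fun (spin_elt j1 m1 s1) (spin_elt j2 m2 s2) twist"

definition twist_inv_elt :: "real \<Rightarrow> real \<Rightarrow> real \<Rightarrow> real \<Rightarrow> real \<Rightarrow> real \<Rightarrow> complex fps"
  where "twist_inv_elt j1 j2 s1 s2 m1 m2
    = tens_fun (spin_elt j1 m1 s1) (spin_elt j2 m2 s2) twist_inv"

section \<open>The Jordanian quantum group\<close>

datatype slh_gen = Gx | Gu | Gv | Gy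

type_synonym free_slh = "slh_gen gword \<Rightarrow>\<^sub>0 complex fps"

text \<open>Centrality of \<open>D\<close> is implied by the relation \<open>D = 1\<close>.\<close>

definition slh_relators :: "free_slh set"
  where "slh_relators =
    (let x = gen Gx; u = gen Gu; v = gen Gv; y = gen Gy; h = scal fps_X;
         D = x * y - u * v - h * x * v
     in {commutator v x - h * v ^ 2,
         commutator u x - h * (D - x ^ 2),
         commutator v y - h * v ^ 2,
         commutator u y - h * (D - y ^ 2),
         commutator x y - h * (x * v - y * v),
         commutator v u - h * (x * v + v * y),
         D - 1})"

text \<open>
  The relations are polynomial in \<open>h\<close>, so no \<open>h\<close>-adic completion of the quantum group is taken.
  On the dual side, where the twist is an infinite series, the algebra is \<open>U[[h]]\<close>.
\<close>

quotient_type slh = free_slh / "ideal_cong slh_relators"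
  morphisms rep_slh abs_slh
  by (rule ideal_cong_equivp)

text \<open>
  Specialisation at \<open>h = 0\<close>, followed by evaluation at a matrix of determinant 1: the generators
  become the coordinate functions of the matrix with rows \<open>(x, u)\<close> and \<open>(v, y)\<close>.
\<close>

typedef SL2C = "{A :: complex^2^2. det A = 1}"
  morphisms mat_of_SL2C SL2C_of_mat
  by (rule exI[of _ "mat 1"]) simp

fun coord :: "slh_gen \<Rightarrow> SL2C \<Rightarrow> complex"
  where
    "coord Gx g = mat_of_SL2C g $ 1 $ 1"
  | "coord Gu g = mat_of_SL2C g $ 1 $ 2"
  | "coord Gv g = mat_of_SL2C g $ 2 $ 1"
  | "coord Gy g = mat_of_SL2C g $ 2 $ 2"

definition free_at_h0 :: "free_slh \<Rightarrow> SL2C \<Rightarrow> complex"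
  where "free_at_h0 p g
    = lin_ext (\<lambda>c. fps_nth c 0) (\<lambda>w. prod_list (map (\<lambda>a. coord a g) (letters w))) p"

lemma coord_det: "coord Gx g * coord Gy g - coord Gu g * coord Gv g = 1"
  using mat_of_SL2C[of g] by (simp add: det_2)

lemma free_at_h0_add: "free_at_h0 (p + q) g = free_at_h0 p g + free_at_h0 q g"
  unfolding free_at_h0_def by (rule lin_ext_add) simp_all

lemma free_at_h0_mult: "free_at_h0 (p * q) g = free_at_h0 p g * free_at_h0 q g"
  unfolding free_at_h0_def by (rule lin_ext_mult) (simp_all add: mult.commute)

lemma free_at_h0_scal: "free_at_h0 (scal c) g = fps_nth c 0"
  by (simp add: free_at_h0_def scal_def lin_ext_single)

lemma free_at_h0_gen: "free_at_h0 (gen a) g = coord a g"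
  by (simp add: free_at_h0_def gen_def lin_ext_single)

lemma free_at_h0_relator:
  assumes "r \<in> slh_relators"
  shows "free_at_h0 r g = 0"
proof -
  have d: "free_at_h0 (p - q) g = free_at_h0 p g - free_at_h0 q g" for p q
    using free_at_h0_add[of "p - q" q g] by simp
  have one: "free_at_h0 1 g = 1" using free_at_h0_scal[of 1 g] by (simp add: scal_1)
  show ?thesis
    using assms coord_det[of g]
    by (auto simp: slh_relators_def Let_def commutator_def d one free_at_h0_mult
        free_at_h0_scal free_at_h0_gen mult.commute simp del: coord.simps)
qed

lemma free_at_h0_cong: "ideal_cong slh_relators p q \<Longrightarrow> free_at_h0 p g = free_at_h0 q g"
  by (rule ideal_cong_hom[of slh_relators p q "\<lambda>p. free_at_h0 p g"])
    (auto simp: free_at_h0_add free_at_h0_mult free_at_h0_relator)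

lemma slh_one_neq_zero: "\<not> ideal_cong slh_relators 0 1"
proof
  assume "ideal_cong slh_relators 0 1"
  then have "free_at_h0 0 g = free_at_h0 1 g" for g by (rule free_at_h0_cong)
  then show False
    using free_at_h0_scal[of 1] free_at_h0_scal[of 0] by (simp add: scal_1 scal_0)
qed

instantiation slh :: ring_1
begin
lift_definition zero_slh :: slh is 0 .
lift_definition one_slh :: slh is 1 .
lift_definition plus_slh :: "slh \<Rightarrow> slh \<Rightarrow> slh" is "(+)" by (rule ideal_cong_add)
lift_definition minus_slh :: "slh \<Rightarrow> slh \<Rightarrow> slh" is "(-)" by (rule ideal_cong_diff)
lift_definition uminus_slh :: "slh \<Rightarrow> slh" is uminus by (rule ideal_cong_uminus)
lift_definition times_slh :: "slh \<Rightarrow> slh \<Rightarrow> slh" is "(*)" by (rule ideal_cong_mult)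
instance
proof
  fix a b c :: slh
  show "a + b + c = a + (b + c)" by transfer (simp add: add.assoc ideal_cong_refl)
  show "a + b = b + a" by transfer (simp add: add.commute ideal_cong_refl)
  show "0 + a = a" by transfer (simp add: ideal_cong_refl)
  show "- a + a = 0" by transfer (simp add: ideal_cong_refl)
  show "a - b = a + - b" by transfer (simp add: ideal_cong_refl)
  show "a * b * c = a * (b * c)" by transfer (simp add: mult.assoc ideal_cong_refl)
  show "1 * a = a" by transfer (simp add: ideal_cong_refl)
  show "a * 1 = a" by transfer (simp add: ideal_cong_refl)
  show "(a + b) * c = a * c + b * c" by transfer (simp add: distrib_right ideal_cong_refl)
  show "a * (b + c) = a * b + a * c" by transfer (simp add: distrib_left ideal_cong_refl)
  show "(0 :: slh) \<noteq> 1" by transfer (rule slh_one_neq_zero)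
qed
end

definition slh_scal :: "complex fps \<Rightarrow> slh" where "slh_scal c = abs_slh (scal c)"

lift_definition at_h0 :: "slh \<Rightarrow> SL2C \<Rightarrow> complex" is free_at_h0
  by (rule ext) (rule free_at_h0_cong)

text \<open>
  The duality between the two Hopf algebras.  On generators it is given by the spin 1/2
  representation, and products are dual to the twisted coproduct: \<open>\<langle>a b, X\<rangle> = \<langle>a \<otimes> b, coprod X\<rangle>\<close>
  and \<open>\<langle>1, X\<rangle> = counit X\<close>.  These rules determine the pairing; as \<open>slh_relators\<close> are the
  relations satisfied in the dual of the twisted Hopf algebra, it does not depend on representatives.
  Conversely, \<open>\<langle>a, X Y\<rangle> = \<langle>\<Delta> a, X \<otimes> Y\<rangle>\<close> holds for the matrix coproduct of the quantum group,
  because the generators are paired through a matrix representation.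
\<close>

fun gen_pairing :: "slh_gen \<Rightarrow> usl fps \<Rightarrow> complex fps"
  where
    "gen_pairing Gx = spin_elt (1/2) (1/2) (1/2)"
  | "gen_pairing Gu = spin_elt (1/2) (1/2) (- 1/2)"
  | "gen_pairing Gv = spin_elt (1/2) (- 1/2) (1/2)"
  | "gen_pairing Gy = spin_elt (1/2) (- 1/2) (- 1/2)"

fun word_pairing :: "slh_gen list \<Rightarrow> usl fps \<Rightarrow> complex fps"
  where
    "word_pairing [] X = counit X"
  | "word_pairing (a # w) X = tens_fun (gen_pairing a) (word_pairing w) (coprod X)"

definition pairing :: "slh \<Rightarrow> usl fps \<Rightarrow> complex fps"
  where "pairing a X = lin_ext (\<lambda>c. c) (\<lambda>w. word_pairing (letters w) X) (rep_slh a)"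

text \<open>The \<open>D\<close>-function is the element of the quantum group representing a matrix coefficient.\<close>

definition D_fun :: "real \<Rightarrow> real \<Rightarrow> real \<Rightarrow> slh"
  where "D_fun j m' m = (THE a. \<forall>X. pairing a X = spin_elt j m' m X)"

section \<open>The classical D-functions\<close>

text \<open>
  The classical \<open>D\<close>-functions are the matrix elements of the spin \<open>j\<close> representation of \<open>SL(2)\<close> on
  homogeneous polynomials of degree \<open>2 j\<close> in \<open>\<xi>, \<eta>\<close>, in the orthonormal basis
  \<open>|j m\<rangle> = \<xi> ^ (j + m) \<eta> ^ (j - m) / sqrt ((j + m)! (j - m)!)\<close>, on which \<open>J_0, J_+, J_-\<close> act as
  \<open>\<xi> \<partial>_\<xi> - \<eta> \<partial>_\<eta>\<close>, \<open>\<xi> \<partial>_\<eta>\<close>, \<open>\<eta> \<partial>_\<xi>\<close>.  The group element with rows \<open>(x, u)\<close> and \<open>(v, y)\<close> acts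
  by \<open>\<xi> \<mapsto> x \<xi> + v \<eta>\<close>, \<open>\<eta> \<mapsto> u \<xi> + y \<eta>\<close>; below, polynomials are dehomogenised by \<open>\<xi> = 1\<close>.
\<close>

definition nat_floor :: "real \<Rightarrow> nat"
  where "nat_floor r = nat \<lfloor>r\<rfloor>"

definition classical_D_fun :: "real \<Rightarrow> real \<Rightarrow> real \<Rightarrow> SL2C \<Rightarrow> complex"
  where "classical_D_fun j m' m g =
    complex_of_real (sqrt (fact (nat_floor (j + m')) * fact (nat_floor (j - m'))
                         / (fact (nat_floor (j + m)) * fact (nat_floor (j - m)))))
    * poly.coeff ([:coord Gx g, coord Gv g:] ^ nat_floor (j + m)
                * [:coord Gu g, coord Gy g:] ^ nat_floor (j - m)) (nat_floor (j - m'))"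

text \<open>\<open>(-1) ^ z\<close> for a real number \<open>z\<close> that is an integer.\<close>

definition sign_pow :: "real \<Rightarrow> complex"
  where "sign_pow z = (- 1) powi \<lfloor>z\<rfloor>"

end

theory Submission
  imports Defs
begin

text \<open>
  The idea is to replace the quantum group by a deformed product on ordinary functions.  A functional
  on the enveloping algebra \<open>U\<close> is determined by its values on words in \<open>J_0, J_+, J_-\<close>.  Functions on
  words form a commutative ring under the shuffle product, which is dual to the undeformed coproduct,
  and left and right multiplication in \<open>U\<close> act on this ring by derivations.

  The twist is \<open>(1 - 2 h J_+) powr (J_0 / 2)\<close> with \<open>J_0\<close> in the first and \<open>J_+\<close> in the second tensor factor.
  Hence, for a functional \<open>\<phi>\<close> on which \<open>J_0\<close> acts by \<open>2 s\<close> from the left and by \<open>2 t\<close> from the right, the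
  product dual to the twisted coproduct is
  \<open>\<phi> \<star> \<psi> = \<phi> * (1 - 2 h J_+) powr s * \<psi> * (1 - 2 h J_+) powr (- t)\<close>, where the two powers act on \<open>\<psi>\<close> from
  the left and from the right and the remaining product is the shuffle product
  (\<open>star_weights\<close>, resting on \<open>twist_nth\<close> and \<open>fnl2_coprod\<close>).  Taylor's formula for the derivation
  \<open>J_+\<close> makes \<open>\<star>\<close> associative on matrix coefficients (\<open>star_assoc\<close>), and the coordinate functions
  \<open>x, u, v, y\<close> of the spin 1/2 representation satisfy the relations of the quantum group.  So the quantum
  group acquires a homomorphism \<open>slh_fun\<close> into functionals, and \<open>\<langle>a, X\<rangle>\<close> is the value of \<open>slh_fun a\<close> at \<open>X\<close>
  (\<open>pairing_fnl\<close>).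

  This homomorphism is injective (\<open>slh_fun_eq_0\<close>): the monomials \<open>x ^ a u ^ b v ^ c\<close> and
  \<open>y ^ a u ^ b v ^ c\<close> span the quantum group, at \<open>h = 0\<close> they become linearly independent functions on the
  group, and a relation between them can be divided by \<open>h\<close> as long as it vanishes modulo \<open>h\<close>.  Its image
  contains all polynomials in the coordinate functions, because a classical product
  by a coordinate is a \<open>\<star>\<close>-product preceded by the inverse powers (\<open>classical_poly_lift\<close>); the matrix
  coefficients are such polynomials (\<open>mat_coeff_gen_poly\<close>).  Therefore each \<open>D\<close>-function exists, is unique,
  and specialises to the classical one.

  The orthogonality relations are now identities between functionals.  At \<open>h = 0\<close> they say that the
  sum of the vectors \<open>(-1) ^ (j - m) |j m\<rangle> \<otimes> |j -m\<rangle>\<close> and the dual bilinear form are invariant.  For general \<open>h\<close>, the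
  twist matrix contributes a third power of \<open>1 - 2 h J_+\<close>, which cancels one of the two powers in \<open>\<star>\<close>;
  the remaining one comes out of the invariant sum as the twist matrix on the right-hand side
  (\<open>orthogonality_right\<close>, \<open>orthogonality_left\<close>).  Reducing them modulo \<open>h\<close> gives the classical relations.
\<close>

section \<open>Functions on words under the shuffle product\<close>

text \<open>
  The full dual of the free algebra on the generators of sl(2).  The coefficients are kept general:
  power series in \<open>h\<close> for the quantum group, complex numbers for its classical limit.
\<close>
typedef 'a wfun = "UNIV :: (sl2_gen list \<Rightarrow> 'a) set"
  morphisms val Wfun
  by simp

setup_lifting type_definition_wfun

lemma wfun_eqI: "(\<And>w. val \<phi> w = val \<psi> w) \<Longrightarrow> \<phi> = \<psi>"
  by transfer auto

lemma val_Wfun [simp]: "val (Wfun f) w = f w"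
  by (simp add: Wfun_inverse)

text \<open>
  The recursion is Leibniz' rule for removing the first letter, because the coproduct of a word starting
  with the primitive letter \<open>a\<close> is \<open>a \<otimes> 1 + 1 \<otimes> a\<close> times the coproduct of the rest.
\<close>
primrec shuffle_prod :: "sl2_gen list \<Rightarrow> (sl2_gen list \<Rightarrow> 'a::comm_ring_1) \<Rightarrow> (sl2_gen list \<Rightarrow> 'a) \<Rightarrow> 'a"
  where
    "shuffle_prod [] f g = f [] * g []"
  | "shuffle_prod (a # w) f g
      = shuffle_prod w (\<lambda>v. f (a # v)) g + shuffle_prod w f (\<lambda>v. g (a # v))"

lemma shuffle_prod_add_left:
  "shuffle_prod w (\<lambda>v. f v + f' v) g = shuffle_prod w f g + shuffle_prod w f' g"
  by (induction w arbitrary: f f' g) (simp_all add: algebra_simps)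

lemma shuffle_prod_commute: "shuffle_prod w f g = shuffle_prod w g f"
  by (induction w arbitrary: f g) (simp_all add: algebra_simps)

lemma shuffle_prod_assoc:
  "shuffle_prod w (\<lambda>v. shuffle_prod v f g) k = shuffle_prod w f (\<lambda>v. shuffle_prod v g k)"
proof (induction w arbitrary: f g k)
  case (Cons a w)
  have "shuffle_prod w f (\<lambda>v. p v + q v) = shuffle_prod w f p + shuffle_prod w f q" for p q
    by (metis shuffle_prod_commute shuffle_prod_add_left)
  then show ?case
    by (simp add: shuffle_prod_add_left Cons.IH algebra_simps)
qed (simp add: algebra_simps)

lemma shuffle_prod_zero: "shuffle_prod w (\<lambda>_. 0) g = 0"
  by (induction w arbitrary: g) simp_all

lemma shuffle_prod_const:
  "shuffle_prod w (\<lambda>v. if v = [] then c else 0) g = c * g w"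
  by (induction w arbitrary: g) (simp_all add: shuffle_prod_zero)

instantiation wfun :: (comm_ring_1) comm_ring_1
begin
lift_definition zero_wfun :: "'a wfun" is "\<lambda>w. 0" .
lift_definition one_wfun :: "'a wfun" is "\<lambda>w. if w = [] then 1 else 0" .
lift_definition plus_wfun :: "'a wfun \<Rightarrow> 'a wfun \<Rightarrow> 'a wfun" is "\<lambda>f g w. f w + g w" .
lift_definition minus_wfun :: "'a wfun \<Rightarrow> 'a wfun \<Rightarrow> 'a wfun" is "\<lambda>f g w. f w - g w" .
lift_definition uminus_wfun :: "'a wfun \<Rightarrow> 'a wfun" is "\<lambda>f w. - f w" .
lift_definition times_wfun :: "'a wfun \<Rightarrow> 'a wfun \<Rightarrow> 'a wfun" is "\<lambda>f g w. shuffle_prod w f g" .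
instance
proof
  fix a b c :: "'a wfun"
  show "a + b + c = a + (b + c)" by transfer (simp add: add.assoc)
  show "a + b = b + a" by transfer (simp add: add.commute)
  show "0 + a = a" by transfer simp
  show "- a + a = 0" by transfer simp
  show "a - b = a + - b" by transfer simp
  show "a * b * c = a * (b * c)" by transfer (simp add: shuffle_prod_assoc)
  show "a * b = b * a" by transfer (simp add: shuffle_prod_commute)
  show "1 * a = a" by transfer (simp add: shuffle_prod_const)
  show "(a + b) * c = a * c + b * c" by transfer (simp add: shuffle_prod_add_left)
  show "(0 :: 'a wfun) \<noteq> 1" by transfer (metis zero_neq_one)
qed
end

lemma val_arith [simp]:
  "val 0 w = 0" "val (\<phi> + \<psi>) w = val \<phi> w + val \<psi> w" "val (\<phi> - \<psi>) w = val \<phi> w - val \<psi> w"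
  "val (- \<phi>) w = - val \<phi> w"
  by (transfer, simp)+

lemma val_one: "val 1 w = (if w = [] then 1 else 0)"
  by transfer simp

lemma val_times: "val (\<phi> * \<psi>) w = shuffle_prod w (val \<phi>) (val \<psi>)"
  by transfer simp

lemma val_sum [simp]: "val (\<Sum>i\<in>I. \<phi> i) w = (\<Sum>i\<in>I. val (\<phi> i) w)"
  by (induction I rule: infinite_finite_induct) auto

lemma val_times_Nil [simp]: "val (\<phi> * \<psi>) [] = val \<phi> [] * val \<psi> []"
  by (simp add: val_times)

definition wconst :: "'a::comm_ring_1 \<Rightarrow> 'a wfun"
  where "wconst c = Wfun (\<lambda>w. if w = [] then c else 0)"

lemma val_wconst_times [simp]: "val (wconst c * \<phi>) w = c * val \<phi> w"
  by (simp add: wconst_def val_times shuffle_prod_const Wfun_inverse)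

lemma val_wconst: "val (wconst c) w = (if w = [] then c else 0)"
  by (simp add: wconst_def)

lemma wconst_hom:
  "wconst 0 = 0" "wconst 1 = 1" "wconst (a + b) = wconst a + wconst b"
  "wconst (a * b) = wconst a * wconst b" "wconst (- a) = - wconst a"
  "wconst (a - b) = wconst a - wconst b"
  by (rule wfun_eqI; simp add: val_wconst val_one)+

text \<open>
  The transposes of left and right multiplication by a generator.  Because the generators are
  primitive for the undeformed coproduct, both are derivations of the shuffle product.
\<close>

definition lder :: "sl2_gen \<Rightarrow> 'a wfun \<Rightarrow> 'a wfun"
  where "lder g \<phi> = Wfun (\<lambda>w. val \<phi> (g # w))"

definition rder :: "sl2_gen \<Rightarrow> 'a wfun \<Rightarrow> 'a wfun"
  where "rder g \<phi> = Wfun (\<lambda>w. val \<phi> (w @ [g]))"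

definition wrev :: "'a wfun \<Rightarrow> 'a wfun"
  where "wrev \<phi> = Wfun (\<lambda>w. val \<phi> (rev w))"

lemma val_lder [simp]: "val (lder g \<phi>) w = val \<phi> (g # w)"
  by (simp add: lder_def)

lemma val_rder [simp]: "val (rder g \<phi>) w = val \<phi> (w @ [g])"
  by (simp add: rder_def)

lemma val_wrev [simp]: "val (wrev \<phi>) w = val \<phi> (rev w)"
  by (simp add: wrev_def)

lemma lder_linear [simp]:
  "lder g 0 = 0" "lder g (\<phi> + \<psi>) = lder g \<phi> + lder g \<psi>" "lder g (\<phi> - \<psi>) = lder g \<phi> - lder g \<psi>"
  "lder g (- \<phi>) = - lder g \<phi>" "lder g (wconst c * \<phi>) = wconst c * lder g \<phi>" "lder g (wconst c) = 0"
  "lder g 1 = 0"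
  by (rule wfun_eqI; simp add: val_wconst val_one)+

lemma rder_linear [simp]:
  "rder g 0 = 0" "rder g (\<phi> + \<psi>) = rder g \<phi> + rder g \<psi>" "rder g (\<phi> - \<psi>) = rder g \<phi> - rder g \<psi>"
  "rder g (- \<phi>) = - rder g \<phi>" "rder g (wconst c * \<phi>) = wconst c * rder g \<phi>" "rder g (wconst c) = 0"
  "rder g 1 = 0"
  by (rule wfun_eqI; simp add: val_wconst val_one)+

lemma lder_sum [simp]: "lder g (\<Sum>i\<in>I. \<phi> i) = (\<Sum>i\<in>I. lder g (\<phi> i))"
  by (induction I rule: infinite_finite_induct) auto

lemma rder_sum [simp]: "rder g (\<Sum>i\<in>I. \<phi> i) = (\<Sum>i\<in>I. rder g (\<phi> i))"
  by (induction I rule: infinite_finite_induct) auto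

lemma lder_mult: "lder g (\<phi> * \<psi>) = lder g \<phi> * \<psi> + \<phi> * lder g \<psi>"
proof -
  have "(\<lambda>w. val \<theta> (g # w)) = val (lder g \<theta>)" for \<theta> :: "'a wfun" by (rule ext) simp
  then show ?thesis by (intro wfun_eqI) (simp add: val_times)
qed

lemma lder_rder_commute: "lder g (rder g' \<phi>) = rder g' (lder g \<phi>)"
  by (rule wfun_eqI) simp

lemma rder_mult: "rder g (\<phi> * \<psi>) = rder g \<phi> * \<psi> + \<phi> * rder g \<psi>"
proof (rule wfun_eqI)
  show "val (rder g (\<phi> * \<psi>)) w = val (rder g \<phi> * \<psi> + \<phi> * rder g \<psi>) w" for w
  proof (induction w arbitrary: \<phi> \<psi>)
    case Nil
    then show ?case by (simp add: val_times)
  next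
    case (Cons a w)
    have step: "val \<theta> (a # w) = val (lder a \<theta>) w" for \<theta> :: "'a wfun" by simp
    show ?case
      unfolding step lder_rder_commute lder_mult lder_linear rder_linear val_arith Cons.IH
      by (simp add: algebra_simps)
  qed
qed

lemma wrev_lder: "wrev (lder g \<phi>) = rder g (wrev \<phi>)"
  by (rule wfun_eqI) simp

lemma wrev_rder: "wrev (rder g \<phi>) = lder g (wrev \<phi>)"
  by (rule wfun_eqI) simp

lemma wrev_wrev [simp]: "wrev (wrev \<phi>) = \<phi>"
  by (rule wfun_eqI) simp

text \<open>Reading words backwards exchanges the two actions, so one side suffices for most proofs.\<close>

lemma wrev_mult: "wrev (\<phi> * \<psi>) = wrev \<phi> * wrev \<psi>"
proof (rule wfun_eqI)
  show "val (wrev (\<phi> * \<psi>)) w = val (wrev \<phi> * wrev \<psi>) w" for w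
  proof (induction w arbitrary: \<phi> \<psi>)
    case Nil
    then show ?case by (simp add: val_times)
  next
    case (Cons a w)
    have step: "val \<theta> (a # w) = val (lder a \<theta>) w" for \<theta> :: "'a wfun" by simp
    show ?case
      unfolding step lder_mult wrev_rder[symmetric] rder_mult val_arith Cons.IH[symmetric]
      by simp
  qed
qed

lemma wrev_linear [simp]:
  "wrev (\<phi> + \<psi>) = wrev \<phi> + wrev \<psi>" "wrev 0 = 0" "wrev (wconst c) = wconst c"
  by (rule wfun_eqI; simp add: val_wconst)+

lemma wrev_sum: "wrev (\<Sum>i\<in>I. \<phi> i) = (\<Sum>i\<in>I. wrev (\<phi> i))"
  by (induction I rule: infinite_finite_induct) auto

lemma val_lder_funpow: "val ((lder g ^^ k) \<phi>) w = val \<phi> (replicate k g @ w)"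
proof (induction k arbitrary: w)
  case (Suc k)
  then show ?case by (simp add: replicate_app_Cons_same)
qed simp

lemma lder_funpow_linear:
  "(lder g ^^ k) 0 = 0" "(lder g ^^ k) (\<phi> + \<psi>) = (lder g ^^ k) \<phi> + (lder g ^^ k) \<psi>"
  "(lder g ^^ k) (wconst c * \<phi>) = wconst c * (lder g ^^ k) \<phi>"
  by (rule wfun_eqI; simp add: val_lder_funpow)+

lemma rder_funpow_wrev: "(rder g ^^ k) \<phi> = wrev ((lder g ^^ k) (wrev \<phi>))"
proof (induction k)
  case (Suc k)
  then show ?case by (simp add: wrev_lder)
qed simp

lemma val_rder_funpow: "val ((rder g ^^ k) \<phi>) w = val \<phi> (w @ replicate k g)"
  by (simp add: rder_funpow_wrev val_lder_funpow)

lemma lder_rder_funpow_commute: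
  "(lder g ^^ k) ((rder g' ^^ l) \<phi>) = (rder g' ^^ l) ((lder g ^^ k) \<phi>)"
  by (rule wfun_eqI) (simp add: val_lder_funpow val_rder_funpow)

lemma lder_funpow_mult:
  "(lder g ^^ n) (\<phi> * \<psi>)
    = (\<Sum>i\<le>n. of_nat (n choose i) * ((lder g ^^ i) \<phi> * (lder g ^^ (n - i)) \<psi>))"
proof (induction n)
  case (Suc n)
  let ?a = "\<lambda>i. (lder g ^^ i) \<phi>" and ?b = "\<lambda>i. (lder g ^^ i) \<psi>"
  have nat: "lder g (of_nat m) = (0 :: 'a wfun)" for m
    by (induction m) simp_all
  have "(lder g ^^ Suc n) (\<phi> * \<psi>)
      = (\<Sum>i\<le>n. of_nat (n choose i) * (?a (Suc i) * ?b (n - i)))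
        + (\<Sum>i\<le>n. of_nat (n choose i) * (?a i * ?b (Suc n - i)))"
    by (simp add: Suc.IH nat lder_mult distrib_left sum.distrib Suc_diff_le)
  also have "(\<Sum>i\<le>n. of_nat (n choose i) * (?a i * ?b (Suc n - i)))
      = (\<Sum>i\<le>Suc n. of_nat (n choose i) * (?a i * ?b (Suc n - i)))"
    by (simp add: binomial_eq_0)
  also have "\<dots> = ?a 0 * ?b (Suc n)
      + (\<Sum>i\<le>n. of_nat (n choose Suc i) * (?a (Suc i) * ?b (n - i)))"
    by (subst sum.atMost_Suc_shift) simp
  also have "(\<Sum>i\<le>n. of_nat (n choose i) * (?a (Suc i) * ?b (n - i)))
        + (?a 0 * ?b (Suc n) + (\<Sum>i\<le>n. of_nat (n choose Suc i) * (?a (Suc i) * ?b (n - i))))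
      = (\<Sum>i\<le>Suc n. of_nat (Suc n choose i) * (?a i * ?b (Suc n - i)))"
    by (subst sum.atMost_Suc_shift) (simp add: sum.distrib[symmetric] algebra_simps)
  finally show ?case .
qed simp

lemma lder_funpow_mult_eq_0:
  assumes "(lder g ^^ m) \<phi> = 0" "(lder g ^^ n) \<psi> = 0"
  shows "(lder g ^^ (m + n)) (\<phi> * \<psi>) = 0"
proof -
  have "(lder g ^^ i) \<phi> * (lder g ^^ (m + n - i)) \<psi> = 0" for i
  proof (cases "m \<le> i")
    case True
    then have "(lder g ^^ i) \<phi> = (lder g ^^ (i - m)) ((lder g ^^ m) \<phi>)"
      by (simp add: funpow_add[THEN fun_cong, unfolded o_apply, symmetric])
    then show ?thesis by (simp add: assms lder_funpow_linear)
  next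
    case False
    then have "(lder g ^^ (m + n - i)) \<psi> = (lder g ^^ (m - i)) ((lder g ^^ n) \<psi>)"
      by (simp add: funpow_add[THEN fun_cong, unfolded o_apply, symmetric])
    then show ?thesis by (simp add: assms lder_funpow_linear)
  qed
  then show ?thesis by (simp add: lder_funpow_mult)
qed

lemma rder_funpow_mult_eq_0:
  assumes "(rder g ^^ m) \<phi> = 0" "(rder g ^^ n) \<psi> = 0"
  shows "(rder g ^^ (m + n)) (\<phi> * \<psi>) = 0"
  using lder_funpow_mult_eq_0[of m g "wrev \<phi>" n "wrev \<psi>"] assms
  by (metis rder_funpow_wrev wrev_linear(2) wrev_mult wrev_wrev)

section \<open>Sums of powers of the deformation parameter\<close>

lemma fps_const_sum: "fps_const (\<Sum>i\<in>I. f i) = (\<Sum>i\<in>I. fps_const (f i))"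
  for f :: "'i \<Rightarrow> 'a::comm_ring_1"
  by (induction I rule: infinite_finite_induct) (simp_all flip: fps_const_add)

text \<open>\<open>hsum f\<close> is the \<open>h\<close>-adically convergent sum of all \<open>h ^ i * f i\<close>.\<close>

definition hsum :: "(nat \<Rightarrow> complex fps) \<Rightarrow> complex fps"
  where "hsum f = Abs_fps (\<lambda>n. \<Sum>i\<le>n. fps_nth (f i) (n - i))"

lemma hsum_nth: "fps_nth (hsum f) n = (\<Sum>i\<le>n. fps_nth (f i) (n - i))"
  by (simp add: hsum_def)

lemma hsum_nth_partial_sum:
  assumes "n \<le> N"
  shows "fps_nth (hsum f) n = fps_nth (\<Sum>i\<le>N. fps_X ^ i * f i) n"
proof -
  have "fps_nth (\<Sum>i\<le>N. fps_X ^ i * f i) n = (\<Sum>i\<le>N. if n < i then 0 else fps_nth (f i) (n - i))"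
    by (simp add: fps_sum_nth fps_X_power_mult_nth)
  also have "\<dots> = (\<Sum>i\<le>n. fps_nth (f i) (n - i))"
    using assms by (intro sum.mono_neutral_cong_right) auto
  finally show ?thesis by (simp add: hsum_nth)
qed

lemma hsum_add: "hsum (\<lambda>i. f i + g i) = hsum f + hsum g"
  by (rule fps_ext) (simp add: hsum_nth sum.distrib)

lemma hsum_diff: "hsum (\<lambda>i. f i - g i) = hsum f - hsum g"
  by (rule fps_ext) (simp add: hsum_nth sum_subtractf)

lemma hsum_zero: "hsum (\<lambda>i. 0) = 0"
  by (rule fps_ext) (simp add: hsum_nth)

lemma hsum_sum: "hsum (\<lambda>i. \<Sum>s\<in>S. f s i) = (\<Sum>s\<in>S. hsum (f s))"
  by (induction S rule: infinite_finite_induct) (simp_all add: hsum_add hsum_zero)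

lemma fps_mult_nth_cong:
  fixes a b c :: "complex fps"
  assumes "\<And>k. k \<le> n \<Longrightarrow> fps_nth b k = fps_nth c k"
  shows "fps_nth (a * b) n = fps_nth (a * c) n"
  by (simp add: fps_mult_nth assms)

lemma hsum_mult_left: "hsum (\<lambda>i. c * f i) = c * hsum f"
proof (rule fps_ext)
  fix n
  have "fps_nth (hsum (\<lambda>i. c * f i)) n = fps_nth (c * (\<Sum>i\<le>n. fps_X ^ i * f i)) n"
    by (simp add: hsum_nth_partial_sum[of n n] sum_distrib_left mult.left_commute)
  also have "\<dots> = fps_nth (c * hsum f) n"
    by (rule fps_mult_nth_cong) (simp add: hsum_nth_partial_sum[of _ n])
  finally show "fps_nth (hsum (\<lambda>i. c * f i)) n = fps_nth (c * hsum f) n" .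
qed

lemma hsum_mult_right: "hsum (\<lambda>i. f i * c) = hsum f * c"
  using hsum_mult_left[of c f] by (simp add: mult.commute)

lemma hsum_finite:
  assumes "\<And>i. i \<ge> N \<Longrightarrow> f i = 0"
  shows "hsum f = (\<Sum>i<N. fps_X ^ i * f i)"
proof (rule fps_ext)
  fix n
  have "fps_nth (hsum f) n = fps_nth (\<Sum>i\<le>max n N. fps_X ^ i * f i) n"
    by (rule hsum_nth_partial_sum) simp
  also have "(\<Sum>i\<le>max n N. fps_X ^ i * f i) = (\<Sum>i<N. fps_X ^ i * f i)"
    using assms by (intro sum.mono_neutral_right) auto
  finally show "fps_nth (hsum f) n = fps_nth (\<Sum>i<N. fps_X ^ i * f i) n" .
qed

lemma hsum_single: "hsum (\<lambda>i. if i = 0 then a else 0) = a"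
  by (subst hsum_finite[of 1]) simp_all

lemma hsum_const: "hsum (\<lambda>i. fps_const (fps_nth F i)) = F"
proof (rule fps_ext)
  fix n
  have "(\<Sum>i\<le>n. fps_nth (fps_const (fps_nth F i)) (n - i)) = (\<Sum>i\<le>n. if i = n then fps_nth F i else 0)"
    by (rule sum.cong) auto
  then show "fps_nth (hsum (\<lambda>i. fps_const (fps_nth F i))) n = fps_nth F n"
    by (simp add: hsum_nth)
qed

text \<open>Only finitely many terms contribute to each power of \<open>h\<close>, so double sums can be rearranged.\<close>

lemma hsum_diagonal: "hsum (\<lambda>n. \<Sum>i\<le>n. G i (n - i)) = hsum (\<lambda>i. hsum (G i))"
proof (rule fps_ext)
  fix n
  have "fps_nth (hsum (\<lambda>n. \<Sum>i\<le>n. G i (n - i))) n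
      = (\<Sum>m\<le>n. \<Sum>i\<le>m. fps_nth (G i (m - i)) (n - m))"
    by (simp add: hsum_nth fps_sum_nth)
  also have "\<dots> = (\<Sum>m\<le>n. \<Sum>i\<le>m. fps_nth (G i (m - i)) (n - i - (m - i)))"
    by (intro sum.cong) auto
  also have "\<dots> = (\<Sum>(i, l)\<in>{(i, l). i + l \<le> n}. fps_nth (G i l) (n - i - l))"
    by (rule sum.triangle_reindex_eq[symmetric])
  also have "\<dots> = (\<Sum>i\<le>n. \<Sum>l\<le>n - i. fps_nth (G i l) (n - i - l))"
    by (subst sum.Sigma) (auto intro!: sum.cong)
  also have "\<dots> = fps_nth (hsum (\<lambda>i. hsum (G i))) n"
    by (simp add: hsum_nth)
  finally show "fps_nth (hsum (\<lambda>n. \<Sum>i\<le>n. G i (n - i))) n = fps_nth (hsum (\<lambda>i. hsum (G i))) n" .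
qed

lemma hsum_diagonal': "hsum (\<lambda>n. \<Sum>i\<le>n. G i (n - i)) = hsum (\<lambda>l. hsum (\<lambda>i. G i l))"
proof -
  have "(\<Sum>i\<le>n. G i (n - i)) = (\<Sum>i\<le>n. G (n - i) i)" for n
    by (rule sum.reindex_bij_witness[of _ "\<lambda>i. n - i" "\<lambda>i. n - i"]) auto
  then have "(\<lambda>n. \<Sum>i\<le>n. G i (n - i)) = (\<lambda>n. \<Sum>i\<le>n. G (n - i) i)" by (rule ext)
  then show ?thesis by (rule ssubst) (rule hsum_diagonal[of "\<lambda>l i. G i l"])
qed

section \<open>Powers of 1 - 2 h J+ acting on functionals\<close>

text \<open>
  A power series \<open>F\<close> acts on functionals through multiplication of the argument by \<open>F (h J_+)\<close> from the
  left or from the right.  Each \<open>J_+\<close> comes with a factor \<open>h\<close>, so the sum converges \<open>h\<close>-adically.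
\<close>

definition lact :: "complex fps \<Rightarrow> complex fps wfun \<Rightarrow> complex fps wfun"
  where "lact F \<phi>
    = Wfun (\<lambda>w. hsum (\<lambda>k. fps_const (fps_nth F k) * val \<phi> (replicate k Gplus @ w)))"

definition ract :: "complex fps \<Rightarrow> complex fps wfun \<Rightarrow> complex fps wfun"
  where "ract F \<phi>
    = Wfun (\<lambda>w. hsum (\<lambda>k. fps_const (fps_nth F k) * val \<phi> (w @ replicate k Gplus)))"

lemma val_lact:
  "val (lact F \<phi>) w = hsum (\<lambda>k. fps_const (fps_nth F k) * val \<phi> (replicate k Gplus @ w))"
  by (simp add: lact_def)

lemma val_ract:
  "val (ract F \<phi>) w = hsum (\<lambda>k. fps_const (fps_nth F k) * val \<phi> (w @ replicate k Gplus))"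
  by (simp add: ract_def)

lemma ract_wrev: "ract F \<phi> = wrev (lact F (wrev \<phi>))"
  by (rule wfun_eqI) (simp add: val_lact val_ract)

lemma lact_linear:
  "lact F 0 = 0" "lact F (\<phi> + \<psi>) = lact F \<phi> + lact F \<psi>" "lact F (\<phi> - \<psi>) = lact F \<phi> - lact F \<psi>"
  "lact F (wconst c * \<phi>) = wconst c * lact F \<phi>"
  by (rule wfun_eqI;
      simp add: val_lact hsum_zero distrib_left right_diff_distrib hsum_add hsum_diff
        mult.left_commute[of _ c] hsum_mult_left)+

lemma ract_linear:
  "ract F 0 = 0" "ract F (\<phi> + \<psi>) = ract F \<phi> + ract F \<psi>" "ract F (\<phi> - \<psi>) = ract F \<phi> - ract F \<psi>"
  "ract F (wconst c * \<phi>) = wconst c * ract F \<phi>"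
  by (rule wfun_eqI;
      simp add: val_ract hsum_zero distrib_left right_diff_distrib hsum_add hsum_diff
        mult.left_commute[of _ c] hsum_mult_left)+

lemma lact_sum: "lact F (\<Sum>i\<in>I. \<phi> i) = (\<Sum>i\<in>I. lact F (\<phi> i))"
  by (induction I rule: infinite_finite_induct) (auto simp: lact_linear)

lemma ract_sum: "ract F (\<Sum>i\<in>I. \<phi> i) = (\<Sum>i\<in>I. ract F (\<phi> i))"
  by (induction I rule: infinite_finite_induct) (auto simp: ract_linear)

lemma lact_mult: "lact (F * G) \<phi> = lact F (lact G \<phi>)"
proof (rule wfun_eqI)
  fix w
  let ?g = "\<lambda>i l. fps_const (fps_nth F i) * (fps_const (fps_nth G l) * val \<phi> (replicate (i + l) Gplus @ w))"
  have rep: "replicate l Gplus @ replicate i Gplus @ w = replicate (i + l) Gplus @ w" for i l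
    by (metis add.commute append.assoc replicate_add)
  have "val (lact (F * G) \<phi>) w = hsum (\<lambda>n. \<Sum>i\<le>n. ?g i (n - i))"
    by (simp add: val_lact fps_mult_nth fps_const_sum sum_distrib_right atLeast0AtMost mult.assoc flip: fps_const_mult)
  also have "\<dots> = hsum (\<lambda>i. hsum (?g i))" by (rule hsum_diagonal)
  also have "\<dots> = val (lact F (lact G \<phi>)) w"
    by (simp add: val_lact hsum_mult_left rep)
  finally show "val (lact (F * G) \<phi>) w = val (lact F (lact G \<phi>)) w" .
qed

lemma ract_mult: "ract (F * G) \<phi> = ract F (ract G \<phi>)"
  by (simp add: ract_wrev lact_mult)

lemma lact_one: "lact 1 \<phi> = \<phi>"
  by (rule wfun_eqI) (simp add: val_lact hsum_finite[of 1])

lemma lact_ract_commute: "lact F (ract G \<phi>) = ract G (lact F \<phi>)"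
proof (rule wfun_eqI)
  fix w
  let ?g = "\<lambda>i l. fps_const (fps_nth F i) * (fps_const (fps_nth G l)
    * val \<phi> (replicate i Gplus @ w @ replicate l Gplus))"
  have "val (lact F (ract G \<phi>)) w = hsum (\<lambda>i. hsum (?g i))"
    by (simp add: val_lact val_ract hsum_mult_left)
  also have "\<dots> = hsum (\<lambda>l. hsum (\<lambda>i. ?g i l))"
    by (rule trans[OF hsum_diagonal[symmetric] hsum_diagonal'])
  also have "\<dots> = val (ract G (lact F \<phi>)) w"
    by (simp add: val_lact val_ract hsum_mult_left[symmetric] mult_ac)
  finally show "val (lact F (ract G \<phi>)) w = val (ract G (lact F \<phi>)) w" .
qed

text \<open>The series \<open>(1 - 2 z) powr a\<close>.\<close>

definition bin_series :: "complex \<Rightarrow> complex fps"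
  where "bin_series a = Abs_fps (\<lambda>k. (a gchoose k) * (- 2) ^ k)"

lemma bin_series_nth [simp]: "fps_nth (bin_series a) k = (a gchoose k) * (- 2) ^ k"
  by (simp add: bin_series_def)

lemma bin_series_add: "bin_series (a + b) = bin_series a * bin_series b"
proof (rule fps_ext)
  fix n
  have "(- 2 :: complex) ^ n = (- 2) ^ i * (- 2) ^ (n - i)" if "i \<le> n" for i
    using that by (simp flip: power_add)
  then show "fps_nth (bin_series (a + b)) n = fps_nth (bin_series a * bin_series b) n"
    by (auto simp: fps_mult_nth gbinomial_Vandermonde[symmetric] sum_distrib_right
        atLeast0AtMost intro!: sum.cong)
qed

lemma bin_series_0: "bin_series 0 = 1"
  by (rule fps_ext) (simp add: gbinomial_0_left)

abbreviation lpow :: "complex \<Rightarrow> complex fps wfun \<Rightarrow> complex fps wfun"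
  where "lpow a \<equiv> lact (bin_series a)"

abbreviation rpow :: "complex \<Rightarrow> complex fps wfun \<Rightarrow> complex fps wfun"
  where "rpow a \<equiv> ract (bin_series a)"

lemma lpow_add: "lpow a (lpow b \<phi>) = lpow (a + b) \<phi>"
  by (simp add: bin_series_add lact_mult)

lemma rpow_add: "rpow a (rpow b \<phi>) = rpow (a + b) \<phi>"
  by (simp add: bin_series_add ract_mult)

lemma lpow_0 [simp]: "lpow 0 \<phi> = \<phi>"
  by (simp add: bin_series_0 lact_one)

lemma rpow_0 [simp]: "rpow 0 \<phi> = \<phi>"
  by (simp add: ract_wrev)

text \<open>
  On functionals on which \<open>J_+\<close> acts nilpotently the sums are finite, and can be formed inside the ring.
\<close>
lemma lact_finite:
  assumes "(lder Gplus ^^ N) \<phi> = 0"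
  shows "lact F \<phi> = (\<Sum>i<N. wconst (fps_const (fps_nth F i) * fps_X ^ i) * (lder Gplus ^^ i) \<phi>)"
proof (rule wfun_eqI)
  fix w
  have "val \<phi> (replicate i Gplus @ w) = 0" if "i \<ge> N" for i
  proof -
    have "(lder Gplus ^^ i) \<phi> = (lder Gplus ^^ (i - N)) ((lder Gplus ^^ N) \<phi>)"
      using that by (simp add: funpow_add[THEN fun_cong, unfolded o_apply, symmetric])
    then show ?thesis by (simp add: assms lder_funpow_linear flip: val_lder_funpow)
  qed
  then have "val (lact F \<phi>) w
      = (\<Sum>i<N. fps_X ^ i * (fps_const (fps_nth F i) * val \<phi> (replicate i Gplus @ w)))"
    unfolding val_lact by (subst hsum_finite[of N]) auto
  then show "val (lact F \<phi>) w
      = val (\<Sum>i<N. wconst (fps_const (fps_nth F i) * fps_X ^ i) * (lder Gplus ^^ i) \<phi>) w"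
    by (simp only: val_sum val_wconst_times val_lder_funpow, simp only: mult_ac)
qed

lemma ract_finite:
  assumes "(rder Gplus ^^ N) \<phi> = 0"
  shows "ract F \<phi> = (\<Sum>i<N. wconst (fps_const (fps_nth F i) * fps_X ^ i) * (rder Gplus ^^ i) \<phi>)"
proof -
  have "(lder Gplus ^^ N) (wrev \<phi>) = 0"
    using assms by (metis rder_funpow_wrev wrev_linear(2) wrev_wrev)
  from lact_finite[OF this] show ?thesis
    by (simp add: ract_wrev wrev_sum wrev_mult rder_funpow_wrev)
qed

text \<open>
  The shuffle product involves only finitely many values at each word, so it commutes with \<open>h\<close>-adic sums.
\<close>
lemma val_times_hsum:
  "val (\<phi> * Wfun (\<lambda>w. hsum (\<lambda>l. val (f l) w))) w = hsum (\<lambda>l. val (\<phi> * f l) w)"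
proof (induction w arbitrary: \<phi> f)
  case Nil
  then show ?case by (simp add: val_times hsum_mult_left)
next
  case (Cons a w)
  have step: "val \<theta> (a # w) = val (lder a \<theta>) w" for \<theta> :: "complex fps wfun" by simp
  have "lder a (Wfun (\<lambda>w. hsum (\<lambda>l. val (f l) w))) = Wfun (\<lambda>w. hsum (\<lambda>l. val (lder a (f l)) w))"
    by (rule wfun_eqI) simp
  then show ?case
    unfolding step lder_mult by (simp only: val_arith Cons.IH hsum_add)
qed

text \<open>
  Taylor's formula for the derivation \<open>N = - 2 h J_+\<close>: the \<open>i\<close>-th derivative of the function
  \<open>(1 + z) powr a\<close> of \<open>z = N\<close> is a multiple of \<open>(1 + z) powr (a - i)\<close>.  It is this shift of the exponent, matched by the shift of
  weights under \<open>J_+\<close>, that makes the twisted product associative.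
\<close>

lemma lpow_mult:
  assumes "(lder Gplus ^^ N) \<phi> = 0"
  shows "lpow a (\<phi> * \<psi>) = (\<Sum>i<N. wconst (fps_const (fps_nth (bin_series a) i) * fps_X ^ i)
    * ((lder Gplus ^^ i) \<phi> * lpow (a - of_nat i) \<psi>))"
proof (rule wfun_eqI)
  fix w
  let ?b = "\<lambda>a i. fps_const (fps_nth (bin_series a) i)"
  let ?d = "\<lambda>i. lder Gplus ^^ i"
  let ?G = "\<lambda>i l. ?b a i * (?b (a - of_nat i) l * val (?d i \<phi> * ?d l \<psi>) w)"
  have nat: "val (of_nat m * \<theta>) w = of_nat m * val \<theta> w" for m and \<theta> :: "complex fps wfun"
    by (induction m) (simp_all add: algebra_simps)
  have coeff: "fps_const (fps_nth (bin_series a) n) * of_nat (n choose i)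
      = ?b a i * ?b (a - of_nat i) (n - i)" if "i \<le> n" for i n
  proof -
    have "(a gchoose n) * of_nat (n choose i) = (a gchoose i) * (a - of_nat i gchoose (n - i))"
      using gbinomial_trinomial_revision[OF that, of a] by (simp add: binomial_gbinomial)
    moreover have "(- 2 :: complex) ^ n = (- 2) ^ i * (- 2) ^ (n - i)"
      using that by (simp flip: power_add)
    ultimately have "fps_nth (bin_series a) n * of_nat (n choose i)
        = fps_nth (bin_series a) i * fps_nth (bin_series (a - of_nat i)) (n - i)"
      by (simp add: algebra_simps)
    then show ?thesis
      by (metis fps_const_mult fps_of_nat)
  qed
  have "?b a n * val (?d n (\<phi> * \<psi>)) w = (\<Sum>i\<le>n. ?G i (n - i))" for n
  proof -
    have "?b a n * val (?d n (\<phi> * \<psi>)) w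
        = (\<Sum>i\<le>n. (?b a n * of_nat (n choose i)) * val (?d i \<phi> * ?d (n - i) \<psi>) w)"
      by (simp add: lder_funpow_mult nat sum_distrib_left mult.assoc del: bin_series_nth)
    also have "\<dots> = (\<Sum>i\<le>n. ?G i (n - i))"
      by (intro sum.cong refl) (simp add: coeff mult.assoc del: bin_series_nth)
    finally show ?thesis .
  qed
  then have "val (lpow a (\<phi> * \<psi>)) w = hsum (\<lambda>n. \<Sum>i\<le>n. ?G i (n - i))"
    by (simp add: val_lact val_lder_funpow[symmetric] del: bin_series_nth)
  also have "\<dots> = hsum (\<lambda>i. hsum (?G i))" by (rule hsum_diagonal)
  also have "\<dots> = hsum (\<lambda>i. ?b a i * val (?d i \<phi> * lpow (a - of_nat i) \<psi>) w)"
  proof (rule arg_cong[of _ _ hsum], rule ext)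
    fix i
    have "lpow (a - of_nat i) \<psi>
        = Wfun (\<lambda>w. hsum (\<lambda>l. val (wconst (?b (a - of_nat i) l) * ?d l \<psi>) w))"
      by (simp add: lact_def val_lder_funpow)
    then have "val (?d i \<phi> * lpow (a - of_nat i) \<psi>) w
        = hsum (\<lambda>l. val (?d i \<phi> * (wconst (?b (a - of_nat i) l) * ?d l \<psi>)) w)"
      by (simp only: val_times_hsum)
    then show "hsum (?G i) = ?b a i * val (?d i \<phi> * lpow (a - of_nat i) \<psi>) w"
      by (simp only: mult.left_commute[of "?d i \<phi>" "wconst _"] val_wconst_times hsum_mult_left)
  qed
  also have "\<dots>
      = (\<Sum>i<N. fps_X ^ i * (?b a i * val (?d i \<phi> * lpow (a - of_nat i) \<psi>) w))"
  proof (rule hsum_finite)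
    fix i assume "i \<ge> N"
    then have "?d i \<phi> = ?d (i - N) (?d N \<phi>)"
      by (simp add: funpow_add[THEN fun_cong, unfolded o_apply, symmetric])
    then show "?b a i * val (?d i \<phi> * lpow (a - of_nat i) \<psi>) w = 0"
      by (simp add: assms lder_funpow_linear)
  qed
  also have "\<dots> = val (\<Sum>i<N. wconst (?b a i * fps_X ^ i) * (?d i \<phi> * lpow (a - of_nat i) \<psi>)) w"
    by (simp only: val_sum val_wconst_times, simp only: mult_ac)
  finally show "val (lpow a (\<phi> * \<psi>)) w
      = val (\<Sum>i<N. wconst (?b a i * fps_X ^ i) * (?d i \<phi> * lpow (a - of_nat i) \<psi>)) w" .
qed

lemma rpow_mult:
  assumes "(rder Gplus ^^ N) \<phi> = 0"
  shows "rpow a (\<phi> * \<psi>) = (\<Sum>i<N. wconst (fps_const (fps_nth (bin_series a) i) * fps_X ^ i)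
    * ((rder Gplus ^^ i) \<phi> * rpow (a - of_nat i) \<psi>))"
proof -
  have "(lder Gplus ^^ N) (wrev \<phi>) = 0"
    using assms by (metis rder_funpow_wrev wrev_linear(2) wrev_wrev)
  from lpow_mult[OF this, of a "wrev \<psi>"] show ?thesis
    by (simp add: ract_wrev wrev_sum wrev_mult rder_funpow_wrev del: bin_series_nth)
qed

section \<open>Functionals on the enveloping algebra and its tensor square\<close>

lemma poly_mapping_single_induct [case_names zero single add]:
  fixes p :: "'m \<Rightarrow>\<^sub>0 'b::ab_group_add"
  assumes "P 0" "\<And>k c. P (Poly_Mapping.single k c)" "\<And>p q. P p \<Longrightarrow> P q \<Longrightarrow> P (p + q)"
  shows "P p"
proof (induction p rule: update_induct)
  case (update f k b)
  have "Poly_Mapping.update k b f = f + Poly_Mapping.single k b"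
    using update(1) by (intro poly_mapping_eqI)
      (auto simp: lookup_add lookup_single lookup_update in_keys_iff when_def)
  then show ?case using assms update by simp
qed (rule assms)

abbreviation lin :: "('m \<Rightarrow> complex fps) \<Rightarrow> ('m \<Rightarrow>\<^sub>0 complex) \<Rightarrow> complex fps"
  where "lin \<equiv> lin_ext fps_const"

lemma lin_simps:
  "lin \<omega> 0 = 0" "lin \<omega> (p + q) = lin \<omega> p + lin \<omega> q"
  "lin \<omega> (Poly_Mapping.single w c) = fps_const c * \<omega> w"
proof -
  show "lin \<omega> 0 = 0" by (simp add: lin_ext_def)
  show "lin \<omega> (p + q) = lin \<omega> p + lin \<omega> q" by (rule lin_ext_add) simp_all
  show "lin \<omega> (Poly_Mapping.single w c) = fps_const c * \<omega> w" by (rule lin_ext_single) simp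
qed

lemma lin_diff: "lin \<omega> (p - q) = lin \<omega> p - lin \<omega> q"
  using lin_simps(2)[of \<omega> "p - q" q] by simp

lemma lin_single_times:
  "lin \<omega> (Poly_Mapping.single v c * q) = fps_const c * lin (\<lambda>w. \<omega> (v + w)) q"
  by (induction q rule: poly_mapping_single_induct)
    (simp_all add: lin_simps mult_single distrib_left flip: fps_const_mult)

lemma lin_times_single:
  "lin \<omega> (q * Poly_Mapping.single v c) = fps_const c * lin (\<lambda>w. \<omega> (w + v)) q"
  by (induction q rule: poly_mapping_single_induct)
    (simp_all add: lin_simps mult_single distrib_left distrib_right mult_ac flip: fps_const_mult)

text \<open>
  The ideal is spanned by the relators multiplied by words on both sides, and such multiplications are
  absorbed by translating the functional.
\<close>

lemma lin_two_sided_ideal: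
  fixes R :: "('m::monoid_add \<Rightarrow>\<^sub>0 complex) set"
  assumes l: "\<And>\<omega> v. \<omega> \<in> P \<Longrightarrow> (\<lambda>w. \<omega> (v + w)) \<in> P"
    and r: "\<And>\<omega> v. \<omega> \<in> P \<Longrightarrow> (\<lambda>w. \<omega> (w + v)) \<in> P"
    and k: "\<And>\<omega> r. \<omega> \<in> P \<Longrightarrow> r \<in> R \<Longrightarrow> lin \<omega> r = 0"
    and p: "p \<in> two_sided_ideal R" and \<omega>: "\<omega> \<in> P"
  shows "lin \<omega> p = 0"
  using p
proof induction
  case (gener q a b)
  have 1: "lin \<omega> (q * b) = 0" if "\<omega> \<in> P" for \<omega>
    by (induction b rule: poly_mapping_single_induct)
      (simp_all add: lin_simps lin_times_single distrib_left k[OF r[OF that] gener])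
  have "lin \<omega> (a * (q * b)) = 0"
    by (induction a rule: poly_mapping_single_induct)
      (simp_all add: lin_simps lin_single_times distrib_right 1[OF l[OF \<omega>]])
  then show ?case by (simp add: mult.assoc)
qed (simp_all add: lin_simps)

text \<open>The rows \<open>(a, b, c, g)\<close> encode the relations \<open>[a, b] = c * g\<close> of sl(2).\<close>

definition sl2_brackets :: "(sl2_gen \<times> sl2_gen \<times> complex \<times> sl2_gen) set"
  where "sl2_brackets
    = {(Gzero, Gplus, 2, Gplus), (Gzero, Gminus, - 2, Gminus), (Gplus, Gminus, 1, Gzero)}"

text \<open>The condition for a functional on the free algebra to descend to the enveloping algebra.\<close>
definition respects_sl2 :: "complex fps wfun \<Rightarrow> bool"
  where "respects_sl2 \<phi> \<longleftrightarrow> (\<forall>(a, b, c, g)\<in>sl2_brackets. \<forall>v w.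
    val \<phi> (v @ a # b # w) = val \<phi> (v @ b # a # w) + fps_const c * val \<phi> (v @ g # w))"

lemma respects_sl2D:
  "respects_sl2 \<phi> \<Longrightarrow> (a, b, c, g) \<in> sl2_brackets \<Longrightarrow>
    val \<phi> (v @ a # b # w) = val \<phi> (v @ b # a # w) + fps_const c * val \<phi> (v @ g # w)"
  unfolding respects_sl2_def by blast

lemma respects_sl2I:
  "(\<And>a b c g v w. (a, b, c, g) \<in> sl2_brackets \<Longrightarrow>
    val \<phi> (v @ a # b # w) = val \<phi> (v @ b # a # w) + fps_const c * val \<phi> (v @ g # w))
    \<Longrightarrow> respects_sl2 \<phi>"
  unfolding respects_sl2_def by blast

lemma respects_sl2_translate:
  assumes "respects_sl2 \<phi>"
  shows "respects_sl2 (Wfun (\<lambda>w. val \<phi> (u @ w)))" "respects_sl2 (Wfun (\<lambda>w. val \<phi> (w @ u)))"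
proof -
  show "respects_sl2 (Wfun (\<lambda>w. val \<phi> (u @ w)))"
    using respects_sl2D[OF assms, where v = "u @ v" for v] by (intro respects_sl2I) simp
  show "respects_sl2 (Wfun (\<lambda>w. val \<phi> (w @ u)))"
    using respects_sl2D[OF assms, where w = "w @ u" for w] by (intro respects_sl2I) simp
qed

lemma respects_sl2_lder: "respects_sl2 \<phi> \<Longrightarrow> respects_sl2 (lder g \<phi>)"
  using respects_sl2_translate(1)[of \<phi> "[g]"] by (simp add: lder_def)

lemma respects_sl2_rder: "respects_sl2 \<phi> \<Longrightarrow> respects_sl2 (rder g \<phi>)"
  using respects_sl2_translate(2)[of \<phi> "[g]"] by (simp add: rder_def)

lemma respects_sl2_lder_funpow: "respects_sl2 \<phi> \<Longrightarrow> respects_sl2 ((lder g ^^ k) \<phi>)"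
  by (induction k) (simp_all add: respects_sl2_lder)

lemma respects_sl2_rder_funpow: "respects_sl2 \<phi> \<Longrightarrow> respects_sl2 ((rder g ^^ k) \<phi>)"
  by (induction k) (simp_all add: respects_sl2_rder)

lemma respects_sl2_linear:
  "respects_sl2 0" "respects_sl2 1" "respects_sl2 (wconst c)"
  "respects_sl2 \<phi> \<Longrightarrow> respects_sl2 \<psi> \<Longrightarrow> respects_sl2 (\<phi> + \<psi>)"
  "respects_sl2 \<phi> \<Longrightarrow> respects_sl2 (wconst c * \<phi>)"
proof -
  show w: "respects_sl2 (wconst c)" for c by (rule respects_sl2I) (simp add: val_wconst)
  show "respects_sl2 0" "respects_sl2 1" using w[of 0] w[of 1] by (simp_all add: wconst_hom)
  show "respects_sl2 (\<phi> + \<psi>)" if "respects_sl2 \<phi>" "respects_sl2 \<psi>"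
    by (rule respects_sl2I) (simp add: respects_sl2D[OF that(1)] respects_sl2D[OF that(2)] distrib_left)
  show "respects_sl2 (wconst c * \<phi>)" if "respects_sl2 \<phi>"
    by (rule respects_sl2I) (simp add: respects_sl2D[OF that] distrib_left mult.left_commute)
qed

text \<open>
  Commutators of derivations are derivations, so relations between the left actions that hold on the
  factors hold on the product; the prefix \<open>v\<close> is distributed over the factors by induction.
\<close>
lemma respects_sl2_mult:
  assumes "respects_sl2 \<phi>" "respects_sl2 \<psi>"
  shows "respects_sl2 (\<phi> * \<psi>)"
proof (rule respects_sl2I)
  fix a b g :: sl2_gen and c :: complex and v w :: "sl2_gen list"
  assume br: "(a, b, c, g) \<in> sl2_brackets"
  show "val (\<phi> * \<psi>) (v @ a # b # w)
      = val (\<phi> * \<psi>) (v @ b # a # w) + fps_const c * val (\<phi> * \<psi>) (v @ g # w)"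
    using assms
  proof (induction v arbitrary: \<phi> \<psi>)
    case Nil
    have comm: "lder b (lder a \<theta>) = lder a (lder b \<theta>) + wconst (fps_const c) * lder g \<theta>"
      if "respects_sl2 \<theta>" for \<theta>
      by (rule wfun_eqI) (simp add: respects_sl2D[OF that br, of "[]", simplified])
    have "lder b (lder a (\<phi> * \<psi>))
        = lder a (lder b (\<phi> * \<psi>)) + wconst (fps_const c) * lder g (\<phi> * \<psi>)"
      by (simp add: lder_mult comm Nil algebra_simps)
    then have "val (lder b (lder a (\<phi> * \<psi>))) w
        = val (lder a (lder b (\<phi> * \<psi>)) + wconst (fps_const c) * lder g (\<phi> * \<psi>)) w"
      by (rule arg_cong)
    then show ?case by simp
  next
    case (Cons d v)
    have step: "val \<theta> (d # u) = val (lder d \<theta>) u" for \<theta> :: "complex fps wfun" and u by simp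
    show ?case
      unfolding append_Cons step lder_mult val_arith
        Cons.IH[OF respects_sl2_lder[OF Cons.prems(1)] Cons.prems(2)]
        Cons.IH[OF Cons.prems(1) respects_sl2_lder[OF Cons.prems(2)]]
      by (simp add: algebra_simps)
  qed
qed

lemma respects_sl2_lact:
  assumes "respects_sl2 \<phi>"
  shows "respects_sl2 (lact F \<phi>)"
proof (rule respects_sl2I)
  fix a b c g v w
  assume br: "(a, b, c, g) \<in> sl2_brackets"
  show "val (lact F \<phi>) (v @ a # b # w)
      = val (lact F \<phi>) (v @ b # a # w) + fps_const c * val (lact F \<phi>) (v @ g # w)"
    unfolding val_lact append_assoc[symmetric]
    by (simp only: respects_sl2D[OF assms br] hsum_mult_left[symmetric] hsum_add[symmetric]
        distrib_left mult.left_commute[of _ "fps_const c"])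
qed

lemma respects_sl2_ract:
  assumes "respects_sl2 \<phi>"
  shows "respects_sl2 (ract F \<phi>)"
proof (rule respects_sl2I)
  fix a b c g v w
  assume br: "(a, b, c, g) \<in> sl2_brackets"
  show "val (ract F \<phi>) (v @ a # b # w)
      = val (ract F \<phi>) (v @ b # a # w) + fps_const c * val (ract F \<phi>) (v @ g # w)"
    unfolding val_ract append_assoc append_Cons
    by (simp only: respects_sl2D[OF assms br] hsum_mult_left[symmetric] hsum_add[symmetric]
        distrib_left mult.left_commute[of _ "fps_const c"])
qed

definition on_word :: "complex fps wfun \<Rightarrow> sl2_gen gword \<Rightarrow> complex fps"
  where "on_word \<phi> w = val \<phi> (letters w)"

lemma gen_times_gen: "gen a * gen b = Poly_Mapping.single (GWord [a, b]) 1"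
  by (simp add: gen_def mult_single plus_gword_def)

lemma lin_relator:
  assumes "respects_sl2 \<phi>" "r \<in> usl_relators"
  shows "lin (on_word \<phi>) r = 0"
proof -
  have one: "lin \<omega> (gen g) = \<omega> (GWord [g])" for \<omega> and g :: sl2_gen
    by (simp add: gen_def lin_simps)
  have two: "2 * gen g = Poly_Mapping.single (GWord [g]) (2 :: complex)" for g
    by (simp add: gen_def mult_2 flip: single_add)
  show ?thesis
    using assms(2) respects_sl2D[OF assms(1), where v = "[]" and w = "[]"]
    by (auto simp: usl_relators_def commutator_def gen_times_gen two one lin_diff lin_simps(2,3)
        on_word_def sl2_brackets_def simp del: mult_numeral_left fps_const_neg simp flip: fps_const_neg)
qed

text \<open>
  Evaluation at a chosen representative, which is harmless for functionals respecting the relations.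
\<close>
definition usl_eval :: "complex fps wfun \<Rightarrow> usl \<Rightarrow> complex fps"
  where "usl_eval \<phi> u = lin (on_word \<phi>) (rep_usl u)"

lemma rep_abs_usl: "ideal_cong usl_relators (rep_usl (abs_usl p)) p"
  using Quotient3_rep_abs[OF Quotient3_usl, of p] by (simp add: ideal_cong_refl)

lemma usl_eval_abs:
  assumes "respects_sl2 \<phi>"
  shows "usl_eval \<phi> (abs_usl p) = lin (on_word \<phi>) p"
proof -
  have "lin (on_word \<phi>) (rep_usl (abs_usl p) - p) = 0"
  proof (rule lin_two_sided_ideal[of "on_word ` {\<phi>. respects_sl2 \<phi>}" usl_relators])
    fix \<omega> and v :: "sl2_gen gword" assume "\<omega> \<in> on_word ` {\<phi>. respects_sl2 \<phi>}"
    then obtain \<psi> where \<psi>: "\<omega> = on_word \<psi>" "respects_sl2 \<psi>" by auto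
    have "(\<lambda>w. \<omega> (v + w)) = on_word (Wfun (\<lambda>w. val \<psi> (letters v @ w)))"
      "(\<lambda>w. \<omega> (w + v)) = on_word (Wfun (\<lambda>w. val \<psi> (w @ letters v)))"
      by (auto simp: \<psi>(1) on_word_def)
    then show "(\<lambda>w. \<omega> (v + w)) \<in> on_word ` {\<phi>. respects_sl2 \<phi>}"
      "(\<lambda>w. \<omega> (w + v)) \<in> on_word ` {\<phi>. respects_sl2 \<phi>}"
      using respects_sl2_translate[OF \<psi>(2)] by auto
  qed (use rep_abs_usl[of p] assms in \<open>auto simp: lin_relator ideal_cong_def\<close>)
  then show ?thesis by (simp add: usl_eval_def lin_diff)
qed

definition on_words :: "complex fps wfun \<Rightarrow> complex fps wfun \<Rightarrow> sl2_gen gword \<times> sl2_gen gword \<Rightarrow> complex fps"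
  where "on_words \<phi> \<psi> = (\<lambda>(v, w). val \<phi> (letters v) * val \<psi> (letters w))"

definition usl2_eval :: "complex fps wfun \<Rightarrow> complex fps wfun \<Rightarrow> usl2 \<Rightarrow> complex fps"
  where "usl2_eval \<phi> \<psi> z = lin (on_words \<phi> \<psi>) (rep_usl2 z)"

lemma rep_abs_usl2:
  "ideal_cong (free_left ` usl_relators \<union> free_right ` usl_relators) (rep_usl2 (abs_usl2 p)) p"
  using Quotient3_rep_abs[OF Quotient3_usl2, of p] by (simp add: ideal_cong_refl)

lemma free_left_single: "free_left (Poly_Mapping.single v c) = Poly_Mapping.single (v, 0) c"
  by (simp add: free_left_def lin_ext_single scal_0) (simp add: scal_def mult_single zero_prod_def)

lemma free_right_single: "free_right (Poly_Mapping.single v c) = Poly_Mapping.single (0, v) c"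
  by (simp add: free_right_def lin_ext_single scal_0) (simp add: scal_def mult_single zero_prod_def)

lemma lin_on_words_free:
  "lin (on_words \<phi> \<psi>) (free_left p) = lin (on_word \<phi>) p * val \<psi> []"
  "lin (on_words \<phi> \<psi>) (free_right p) = val \<phi> [] * lin (on_word \<psi>) p"
proof -
  have z: "free_left 0 = 0" "free_right 0 = 0"
    using free_left_add[of 0 0] free_right_add[of 0 0] by simp_all
  show "lin (on_words \<phi> \<psi>) (free_left p) = lin (on_word \<phi>) p * val \<psi> []"
    by (induction p rule: poly_mapping_single_induct)
      (simp_all add: z lin_simps free_left_add free_left_single distrib_right on_words_def on_word_def)
  show "lin (on_words \<phi> \<psi>) (free_right p) = val \<phi> [] * lin (on_word \<psi>) p"
    by (induction p rule: poly_mapping_single_induct)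
      (simp_all add: z lin_simps free_right_add free_right_single distrib_left on_words_def on_word_def)
qed

lemma usl2_eval_abs:
  assumes "respects_sl2 \<phi>" "respects_sl2 \<psi>"
  shows "usl2_eval \<phi> \<psi> (abs_usl2 p) = lin (on_words \<phi> \<psi>) p"
proof -
  let ?P = "{on_words \<phi> \<psi> | \<phi> \<psi>. respects_sl2 \<phi> \<and> respects_sl2 \<psi>}"
  have "lin (on_words \<phi> \<psi>) (rep_usl2 (abs_usl2 p) - p) = 0"
  proof (rule lin_two_sided_ideal[of ?P "free_left ` usl_relators \<union> free_right ` usl_relators"])
    fix \<omega> and x :: "sl2_gen gword \<times> sl2_gen gword" assume "\<omega> \<in> ?P"
    then obtain \<alpha> \<beta> where \<omega>: "\<omega> = on_words \<alpha> \<beta>" and re: "respects_sl2 \<alpha>" "respects_sl2 \<beta>" by auto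
    obtain v w where x: "x = (v, w)" by (cases x)
    note tr = respects_sl2_translate
    have "(\<lambda>y. \<omega> (x + y))
        = on_words (Wfun (\<lambda>u. val \<alpha> (letters v @ u))) (Wfun (\<lambda>u. val \<beta> (letters w @ u)))"
      by (auto simp: \<omega> x on_words_def)
    then show "(\<lambda>y. \<omega> (x + y)) \<in> ?P" using tr re by blast
    have "(\<lambda>y. \<omega> (y + x))
        = on_words (Wfun (\<lambda>u. val \<alpha> (u @ letters v))) (Wfun (\<lambda>u. val \<beta> (u @ letters w)))"
      by (auto simp: \<omega> x on_words_def)
    then show "(\<lambda>y. \<omega> (y + x)) \<in> ?P" using tr re by blast
  next
    show "lin \<omega> r = 0" if "\<omega> \<in> ?P" "r \<in> free_left ` usl_relators \<union> free_right ` usl_relators" for \<omega> r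
      using that by (auto simp: lin_on_words_free lin_relator)
  qed (use rep_abs_usl2[of p] assms in \<open>auto simp: ideal_cong_def\<close>)
  then show ?thesis by (simp add: usl2_eval_def lin_diff)
qed

lemma usl2_cases: obtains p where "z = abs_usl2 p"
  by (metis Quotient3_abs_rep[OF Quotient3_usl2])

lemma usl_cases: obtains p where "u = abs_usl p"
  by (metis Quotient3_abs_rep[OF Quotient3_usl])

text \<open>
  The representative of \<open>z\<close> is the same on both sides, so this is the linearity of a finite sum.
\<close>

lemma usl2_eval_linear_functional:
  "usl2_eval (\<phi> + \<phi>') \<psi> z = usl2_eval \<phi> \<psi> z + usl2_eval \<phi>' \<psi> z"
  "usl2_eval \<phi> (\<psi> + \<psi>') z = usl2_eval \<phi> \<psi> z + usl2_eval \<phi> \<psi>' z"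
  "usl2_eval (wconst c * \<phi>) \<psi> z = c * usl2_eval \<phi> \<psi> z"
  "usl2_eval \<phi> (wconst c * \<psi>) z = c * usl2_eval \<phi> \<psi> z"
  unfolding usl2_eval_def lin_ext_def on_words_def case_prod_beta val_arith val_wconst_times
  by (simp_all add: algebra_simps sum.distrib sum_distrib_left)

lemma usl2_eval_lact:
  "usl2_eval \<phi> (lact F \<psi>) z
    = hsum (\<lambda>i. fps_const (fps_nth F i) * usl2_eval \<phi> ((lder Gplus ^^ i) \<psi>) z)"
  by (simp add: usl2_eval_def lin_ext_def on_words_def case_prod_beta val_lact val_lder_funpow
      sum_distrib_left hsum_sum hsum_mult_left[symmetric] mult_ac)

lemma usl2_eval_ract:
  "usl2_eval \<phi> (ract F \<psi>) z
    = hsum (\<lambda>i. fps_const (fps_nth F i) * usl2_eval \<phi> ((rder Gplus ^^ i) \<psi>) z)"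
  by (simp add: usl2_eval_def lin_ext_def on_words_def case_prod_beta val_ract val_rder_funpow
      sum_distrib_left hsum_sum hsum_mult_left[symmetric] mult_ac)

context
  fixes \<phi> \<psi> :: "complex fps wfun"
  assumes re: "respects_sl2 \<phi>" "respects_sl2 \<psi>"
begin

lemma usl2_eval_add: "usl2_eval \<phi> \<psi> (z + z') = usl2_eval \<phi> \<psi> z + usl2_eval \<phi> \<psi> z'"
  by (cases z rule: usl2_cases, cases z' rule: usl2_cases)
    (simp add: plus_usl2.abs_eq usl2_eval_abs[OF re] lin_simps)

lemma usl2_eval_zero: "usl2_eval \<phi> \<psi> 0 = 0"
  using usl2_eval_add[of 0 0] by simp

lemma usl2_eval_sum: "usl2_eval \<phi> \<psi> (\<Sum>i\<in>I. z i) = (\<Sum>i\<in>I. usl2_eval \<phi> \<psi> (z i))"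
  by (induction I rule: infinite_finite_induct) (simp_all add: usl2_eval_zero usl2_eval_add)

lemma usl2_eval_one: "usl2_eval \<phi> \<psi> 1 = val \<phi> [] * val \<psi> []"
  unfolding one_usl2.abs_eq usl2_eval_abs[OF re]
  using lin_simps(3)[of "on_words \<phi> \<psi>" 0 1] by (simp add: on_words_def, simp add: zero_prod_def)

lemma usl2_eval_scal: "usl2_eval \<phi> \<psi> (usl2_scal c * z) = fps_const c * usl2_eval \<phi> \<psi> z"
  by (cases z rule: usl2_cases)
    (simp add: usl2_scal_def scal_def times_usl2.abs_eq usl2_eval_abs[OF re] lin_single_times)

lemma usl2_eval_tens_left:
  "usl2_eval \<phi> \<psi> (tens_left (usl_gen g) * z) = usl2_eval (lder g \<phi>) \<psi> z"
  "usl2_eval \<phi> \<psi> (z * tens_left (usl_gen g)) = usl2_eval (rder g \<phi>) \<psi> z"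
proof -
  obtain p where z: "z = abs_usl2 p" by (rule usl2_cases)
  have "(\<lambda>y. on_words \<phi> \<psi> ((GWord [g], 0) + y)) = on_words (lder g \<phi>) \<psi>"
    "(\<lambda>y. on_words \<phi> \<psi> (y + (GWord [g], 0))) = on_words (rder g \<phi>) \<psi>"
    by (auto simp: on_words_def)
  then show "usl2_eval \<phi> \<psi> (tens_left (usl_gen g) * z) = usl2_eval (lder g \<phi>) \<psi> z"
    "usl2_eval \<phi> \<psi> (z * tens_left (usl_gen g)) = usl2_eval (rder g \<phi>) \<psi> z"
    by (simp_all add: z usl_gen_def tens_left.abs_eq times_usl2.abs_eq free_left_gen usl2_eval_abs re
        lin_single_times lin_times_single respects_sl2_lder respects_sl2_rder)
qed

lemma usl2_eval_tens_right:
  "usl2_eval \<phi> \<psi> (tens_right (usl_gen g) * z) = usl2_eval \<phi> (lder g \<psi>) z"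
  "usl2_eval \<phi> \<psi> (z * tens_right (usl_gen g)) = usl2_eval \<phi> (rder g \<psi>) z"
proof -
  obtain p where z: "z = abs_usl2 p" by (rule usl2_cases)
  have "(\<lambda>y. on_words \<phi> \<psi> ((0, GWord [g]) + y)) = on_words \<phi> (lder g \<psi>)"
    "(\<lambda>y. on_words \<phi> \<psi> (y + (0, GWord [g]))) = on_words \<phi> (rder g \<psi>)"
    by (auto simp: on_words_def)
  then show "usl2_eval \<phi> \<psi> (tens_right (usl_gen g) * z) = usl2_eval \<phi> (lder g \<psi>) z"
    "usl2_eval \<phi> \<psi> (z * tens_right (usl_gen g)) = usl2_eval \<phi> (rder g \<psi>) z"
    by (simp_all add: z usl_gen_def tens_right.abs_eq times_usl2.abs_eq free_right_gen usl2_eval_abs re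
        lin_single_times lin_times_single respects_sl2_lder respects_sl2_rder)
qed

end

text \<open>The shuffle product is the transpose of the undeformed coproduct.\<close>

lemma usl2_eval_coprod0:
  assumes "respects_sl2 \<phi>" "respects_sl2 \<psi>"
  shows "usl2_eval \<phi> \<psi> (coprod0 u) = usl_eval (\<phi> * \<psi>) u"
proof -
  let ?d = "\<lambda>w. prod_list (map (\<lambda>g. tens_left (usl_gen g) + tens_right (usl_gen g)) w)"
  have word: "usl2_eval \<phi> \<psi> (?d w) = val (\<phi> * \<psi>) w" if "respects_sl2 \<phi>" "respects_sl2 \<psi>" for \<phi> \<psi> w
    using that
  proof (induction w arbitrary: \<phi> \<psi>)
    case Nil
    then show ?case by (simp add: usl2_eval_one val_times)
  next
    case (Cons g w)
    have "val (\<phi> * \<psi>) (g # w) = val (lder g (\<phi> * \<psi>)) w" by simp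
    then show ?case
      using Cons by (simp add: distrib_right usl2_eval_add usl2_eval_tens_left usl2_eval_tens_right
          respects_sl2_lder lder_mult del: val_lder)
  qed
  obtain p where u: "u = abs_usl p" by (rule usl_cases)
  have "usl2_eval \<phi> \<psi> (free_coprod0 p) = lin (on_word (\<phi> * \<psi>)) p"
  proof (induction p rule: poly_mapping_single_induct)
    case zero
    then show ?case
      using free_coprod0_add[of 0 0] by (simp add: lin_simps usl2_eval_zero assms)
  next
    case (single k c)
    then show ?case
      by (simp add: free_coprod0_def lin_ext_single usl2_scal_hom usl2_eval_scal word assms
          lin_simps on_word_def)
  qed (simp add: free_coprod0_add usl2_eval_add assms lin_simps)
  then show ?thesis
    by (simp add: u coprod0.abs_eq usl_eval_abs respects_sl2_mult assms)
qed

section \<open>Functionals on power series\<close>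

text \<open>
  Extension to power series, linear over \<open>complex fps\<close> and continuous; every functional that enters the
  definition of the pairing has this form.
\<close>
definition fnl :: "complex fps wfun \<Rightarrow> usl fps \<Rightarrow> complex fps"
  where "fnl \<phi> X = hsum (\<lambda>n. usl_eval \<phi> (fps_nth X n))"

definition fnl2 :: "complex fps wfun \<Rightarrow> complex fps wfun \<Rightarrow> usl2 fps \<Rightarrow> complex fps"
  where "fnl2 \<phi> \<psi> Z = hsum (\<lambda>n. usl2_eval \<phi> \<psi> (fps_nth Z n))"

lemma fnl_word:
  assumes "respects_sl2 \<phi>"
  shows "fnl \<phi> (fps_const (abs_usl (Poly_Mapping.single (GWord w) 1))) = val \<phi> w"
proof -
  have "abs_usl 0 = 0" by (simp add: zero_usl.abs_eq)
  then have "usl_eval \<phi> 0 = 0" using usl_eval_abs[OF assms, of 0] by (simp add: lin_simps)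
  then have "(\<lambda>n. usl_eval \<phi> (fps_nth (fps_const (abs_usl (Poly_Mapping.single (GWord w) 1))) n))
      = (\<lambda>n. if n = 0 then val \<phi> w else 0)"
    by (auto simp: usl_eval_abs[OF assms] lin_simps on_word_def)
  then show ?thesis by (simp add: fnl_def hsum_single)
qed

lemma fnl_inject:
  assumes "respects_sl2 \<phi>" "respects_sl2 \<psi>" "\<And>X. fnl \<phi> X = fnl \<psi> X"
  shows "\<phi> = \<psi>"
  using assms by (intro wfun_eqI) (metis fnl_word)

lemma tens_fun_fnl:
  assumes "respects_sl2 \<phi>" "respects_sl2 \<psi>"
  shows "tens_fun (fnl \<phi>) (fnl \<psi>) Z = fnl2 \<phi> \<psi> Z"
proof -
  have "fnl \<phi> (fps_const (abs_usl (Poly_Mapping.single v 1))) = val \<phi> (letters v)"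
    if "respects_sl2 \<phi>" for \<phi> v
    using fnl_word[OF that, of "letters v"] by simp
  then have "tens_fun0 (fnl \<phi>) (fnl \<psi>) z = usl2_eval \<phi> \<psi> z" for z
    using assms by (simp add: tens_fun0_def usl2_eval_def on_words_def)
  then show ?thesis by (simp add: tens_fun_def fnl2_def hsum_def)
qed

lemma fnl2_linear_functional:
  "fnl2 (\<phi> + \<phi>') \<psi> Z = fnl2 \<phi> \<psi> Z + fnl2 \<phi>' \<psi> Z" "fnl2 \<phi> (\<psi> + \<psi>') Z = fnl2 \<phi> \<psi> Z + fnl2 \<phi> \<psi>' Z"
  "fnl2 (wconst c * \<phi>) \<psi> Z = c * fnl2 \<phi> \<psi> Z" "fnl2 \<phi> (wconst c * \<psi>) Z = c * fnl2 \<phi> \<psi> Z"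
  by (simp_all add: fnl2_def usl2_eval_linear_functional hsum_add hsum_mult_left)

lemma fnl2_coprod0:
  "respects_sl2 \<phi> \<Longrightarrow> respects_sl2 \<psi> \<Longrightarrow> fnl2 \<phi> \<psi> (map_fps coprod0 X) = fnl (\<phi> * \<psi>) X"
  by (simp add: fnl2_def fnl_def map_fps_def usl2_eval_coprod0)

lemma fnl2_one:
  assumes "respects_sl2 \<phi>" "respects_sl2 \<psi>"
  shows "fnl2 \<phi> \<psi> 1 = val \<phi> [] * val \<psi> []"
proof -
  have "(\<lambda>n. usl2_eval \<phi> \<psi> (fps_nth 1 n)) = (\<lambda>n. if n = 0 then val \<phi> [] * val \<psi> [] else 0)"
    by (auto simp: usl2_eval_one usl2_eval_zero assms)
  then show ?thesis by (simp add: fnl2_def hsum_single)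
qed

lemma counit_eq: "counit X = fnl 1 X"
proof -
  have "usl_eval 1 u = fps_const (Poly_Mapping.lookup (rep_usl u) 0)" for u
  proof -
    have "lin (on_word 1) p = fps_const (Poly_Mapping.lookup p 0)" for p
      by (induction p rule: poly_mapping_single_induct)
        (auto simp: lin_simps lookup_add lookup_single on_word_def val_one when_def
          zero_gword_def gword.expand simp flip: fps_const_add)
    then show ?thesis by (simp add: usl_eval_def)
  qed
  moreover have "counit X = Abs_fps (\<lambda>n. Poly_Mapping.lookup (rep_usl (fps_nth X n)) 0)"
    by (simp add: counit_def map_fps_def)
  ultimately show ?thesis
    using hsum_const[of "counit X"] by (simp add: fnl_def)
qed

section \<open>The twist in closed form\<close>

text \<open>The series \<open>- ln (1 - 2 z)\<close>.\<close>

definition ln_series :: "complex fps"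
  where "ln_series = Abs_fps (\<lambda>n. 2 ^ n / of_nat n)"

lemma ln_series_nth [simp]: "fps_nth ln_series n = 2 ^ n / of_nat n"
  by (simp add: ln_series_def)

text \<open>
  This is \<open>(1 - 2 z) powr a = exp (a ln (1 - 2 z))\<close>: both sides solve \<open>(1 - 2 z) f' = - 2 a f\<close> with
  \<open>f 0 = 1\<close>, which determines the coefficients recursively.
\<close>

lemma bin_series_exp: "bin_series a = fps_exp (- a) oo ln_series"
proof -
  let ?E = "fps_exp (- a) oo ln_series"
  have "fps_nth ln_series 0 = 0" by simp
  then have "fps_deriv ?E = (fps_deriv (fps_exp (- a)) oo ln_series) * fps_deriv ln_series"
    by (rule fps_compose_deriv)
  then have dE: "fps_deriv ?E = fps_const (- a) * ?E * fps_deriv ln_series"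
    by (simp only: fps_exp_deriv fps_const_mult_apply_left)
  have dl: "fps_nth (fps_deriv ln_series) n = 2 * 2 ^ n" for n
    by (simp del: of_nat_Suc)
  have geom: "(1 - fps_const 2 * fps_X) * fps_deriv ln_series = fps_const 2"
  proof (rule fps_ext)
    show "fps_nth ((1 - fps_const 2 * fps_X) * fps_deriv ln_series) n = fps_nth (fps_const 2) n" for n
      by (cases n) (simp_all add: left_diff_distrib mult.assoc dl del: fps_deriv_nth)
  qed
  have "(1 - fps_const 2 * fps_X) * fps_deriv ?E
      = fps_const (- a) * ?E * ((1 - fps_const 2 * fps_X) * fps_deriv ln_series)"
    unfolding dE by (simp only: mult_ac)
  also have "\<dots> = (fps_const (- a) * fps_const 2) * ?E"
    unfolding geom by (simp only: mult_ac)
  also have "fps_const (- a) * fps_const 2 = fps_const (- 2 * a)"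
    by (simp add: mult.commute)
  finally have ode: "(1 - fps_const 2 * fps_X) * fps_deriv ?E = fps_const (- 2 * a) * ?E" .
  have rec: "of_nat (Suc n) * fps_nth ?E (Suc n) = (2 * of_nat n - 2 * a) * fps_nth ?E n" for n
  proof -
    have "fps_nth ((1 - fps_const 2 * fps_X) * fps_deriv ?E) n
        = of_nat (Suc n) * fps_nth ?E (Suc n) - 2 * of_nat n * fps_nth ?E n"
      by (cases n) (simp_all add: left_diff_distrib mult.assoc)
    then show ?thesis unfolding ode by (simp add: algebra_simps)
  qed
  have rec': "of_nat (Suc n) * fps_nth (bin_series a) (Suc n)
      = (2 * of_nat n - 2 * a) * fps_nth (bin_series a) n" for n
  proof -
    have "of_nat (Suc n) * (a gchoose Suc n) = (a - of_nat n) * (a gchoose n)"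
      using gbinomial_absorb_comp[of a n] gbinomial_absorption[of n a] by simp
    then have "of_nat (Suc n) * (a gchoose Suc n) * (- 2) ^ Suc n = (a - of_nat n) * (a gchoose n) * (- 2) ^ Suc n"
      by (rule arg_cong)
    then show ?thesis by (simp add: algebra_simps del: of_nat_Suc)
  qed
  show ?thesis
  proof (rule fps_ext)
    show "fps_nth (bin_series a) n = fps_nth ?E n" for n
    proof (induction n)
      case (Suc n)
      then have "of_nat (Suc n) * fps_nth (bin_series a) (Suc n) = of_nat (Suc n) * fps_nth ?E (Suc n)"
        unfolding rec rec' by simp
      then show ?case by (metis mult_cancel_left of_nat_neq_0)
    qed simp
  qed
qed

lemma tens_right_scal: "tens_right (usl_scal c) = usl2_scal c"
proof -
  have "tens_right (abs_usl (scal c)) = abs_usl2 (scal c)"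
    by (simp add: tens_right.abs_eq scal_def free_right_single zero_prod_def)
  then show ?thesis by (simp add: usl_scal_def usl2_scal_def)
qed

lemma tens_right_one: "tens_right 1 = 1"
  by (metis one_usl.abs_eq scal_1 tens_right_scal usl2_scal_hom(2) usl_scal_def)

lemma tens_right_power: "tens_right (u ^ n) = tens_right u ^ n"
  by (induction n) (simp_all add: tens_right_one tens_right_mult)

lemma usl2_scal_sum: "usl2_scal (\<Sum>i\<in>I. c i) = (\<Sum>i\<in>I. usl2_scal (c i))"
  by (induction I rule: infinite_finite_induct) (simp_all add: usl2_scal_hom)

lemma usl2_scal_left_commute: "z * (usl2_scal a * w) = usl2_scal a * (z * w)"
  by (simp only: usl2_scal_central[of a z] flip: mult.assoc)

lemma usl2_scal_scal: "usl2_scal a * (usl2_scal b * z) = usl2_scal (a * b) * z"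
  by (simp add: usl2_scal_hom mult.assoc)

lemma tens_gen_power_commute:
  "tens_left (usl_gen g) ^ k * tens_right (usl_gen g') ^ n
    = tens_right (usl_gen g') ^ n * tens_left (usl_gen g) ^ k"
proof -
  have 1: "tens_left (usl_gen g) * tens_right (usl_gen g') ^ n
      = tens_right (usl_gen g') ^ n * tens_left (usl_gen g)"
    by (rule power_commuting_commutes[symmetric]) (rule tens_gen_commute[symmetric])
  show ?thesis by (rule power_commuting_commutes) (rule 1)
qed

text \<open>Substitution of \<open>h * (1 \<otimes> J_+)\<close> into a scalar power series.\<close>

definition subst_plus :: "complex fps \<Rightarrow> usl2 fps"
  where "subst_plus F = Abs_fps (\<lambda>n. usl2_scal (fps_nth F n) * tens_right J_plus ^ n)"

lemma subst_plus_nth: "fps_nth (subst_plus F) n = usl2_scal (fps_nth F n) * tens_right J_plus ^ n"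
  by (simp add: subst_plus_def)

lemma subst_plus_mult: "subst_plus (F * G) = subst_plus F * subst_plus G"
proof (rule fps_ext)
  fix n
  let ?J = "tens_right J_plus"
  have "usl2_scal a * ?J ^ i * (usl2_scal b * ?J ^ (n - i)) = usl2_scal (a * b) * ?J ^ n"
    if "i \<le> n" for a b i
  proof -
    have "?J ^ i * ?J ^ (n - i) = ?J ^ n" using that by (simp flip: power_add)
    then show ?thesis
      by (simp only: mult.assoc usl2_scal_left_commute[of "?J ^ i"] usl2_scal_scal)
  qed
  then show "fps_nth (subst_plus (F * G)) n = fps_nth (subst_plus F * subst_plus G) n"
    unfolding subst_plus_nth fps_mult_nth usl2_scal_sum sum_distrib_right
    by (intro sum.cong refl) simp
qed

lemma subst_plus_one: "subst_plus 1 = 1"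
  by (rule fps_ext) (simp add: subst_plus_nth usl2_scal_hom)

lemma map_tens_right_sigma: "map_fps tens_right sigma = subst_plus ln_series"
proof (rule fps_ext)
  fix n
  have pow: "(fps_X * fps_const c) ^ k = fps_X ^ k * fps_const (c ^ k)" for k and c :: usl
  proof (induction k)
    case (Suc k)
    have "(fps_X * fps_const c) ^ Suc k = fps_X * (fps_const c * fps_X ^ k) * fps_const (c ^ k)"
      by (simp add: Suc mult.assoc)
    also have "fps_const c * fps_X ^ k = fps_X ^ k * fps_const c"
      by (rule fps_mult_fps_X_power_commute[symmetric])
    finally show ?case by (simp add: mult.assoc)
  qed simp
  have two: "tens_right (2 * J_plus) = usl2_scal 2 * tens_right J_plus"
  proof -
    have "usl2_scal 2 = 1 + 1" using usl2_scal_hom(3)[of 1 1] by (simp add: usl2_scal_hom(2))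
    then show ?thesis by (simp add: mult_2 tens_right_add distrib_right)
  qed
  have twopow: "(usl2_scal 2 * tens_right J_plus) ^ k = usl2_scal (2 ^ k) * tens_right J_plus ^ k" for k
    by (induction k)
      (simp_all add: usl2_scal_hom(2) mult.assoc usl2_scal_left_commute[of "tens_right J_plus"] usl2_scal_scal)
  have nth: "fps_nth ((fps_X * fps_const c) ^ k) n = (if k = n then c ^ n else 0)" for k and c :: usl
    by (simp add: pow fps_X_power_mult_nth)
  have "fps_nth sigma n = (\<Sum>k=1..n. usl_scal (1 / of_nat k) * (if k = n then (2 * J_plus) ^ n else 0))"
    by (simp add: sigma_def h_ln_one_minus_def nth)
  also have "\<dots> = (if n = 0 then 0 else usl_scal (1 / of_nat n) * (2 * J_plus) ^ n)"
    by (simp add: if_distrib sum.delta cong: if_cong)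
  finally have "tens_right (fps_nth sigma n)
      = (if n = 0 then 0 else usl2_scal (1 / of_nat n) * (usl2_scal (2 ^ n) * tens_right J_plus ^ n))"
    using tens_right_add[of 0 0]
    by (simp add: tens_right_mult[of "usl_scal _"] tens_right_scal tens_right_power two twopow)
  then show "fps_nth (map_fps tens_right sigma) n = fps_nth (subst_plus ln_series) n"
    by (simp add: map_fps_def subst_plus_nth usl2_scal_hom(1) mult.assoc[symmetric])
      (simp flip: usl2_scal_hom(4))
qed

definition twist_coeff :: "nat \<Rightarrow> nat \<Rightarrow> complex"
  where "twist_coeff n k = 1 / fact k * (- 1 / 2) ^ k * fps_nth (ln_series ^ k) n"

text \<open>
  The coefficients only involve \<open>J_0 ^ k \<otimes> J_+ ^ n\<close>, as the logarithm of the twist is \<open>J_0\<close> times a series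
  in \<open>h J_+\<close> and its two tensor factors commute.
\<close>
lemma twist_nth:
  "fps_nth twist n
    = (\<Sum>k\<le>n. usl2_scal (twist_coeff n k) * (tens_left J_zero ^ k * tens_right J_plus ^ n))"
proof -
  let ?H = "tens_left J_zero" and ?J = "tens_right J_plus"
  have neg: "usl2_scal (- a) = - usl2_scal a" for a
    using usl2_scal_hom(3)[of a "- a"] by (simp add: usl2_scal_hom(1) eq_neg_iff_add_eq_0 add.commute)
  have A: "- (fps_const (usl2_scal (1 / 2)) * (fps_const ?H * map_fps tens_right sigma))
      = fps_const (usl2_scal (- 1 / 2) * ?H) * subst_plus ln_series"
    by (rule fps_ext) (simp add: map_tens_right_sigma neg mult.assoc)
  have comm: "subst_plus F * fps_const (usl2_scal a * ?H) = fps_const (usl2_scal a * ?H) * subst_plus F"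
    for F a
  proof (rule fps_ext)
    fix m
    have "usl2_scal f * ?J ^ m * (usl2_scal a * ?H) = usl2_scal a * ?H * (usl2_scal f * ?J ^ m)" for f
      using tens_gen_power_commute[of Gzero 1 Gplus m]
      by (simp add: mult.assoc usl2_scal_left_commute[of "?J ^ m"] usl2_scal_left_commute[of ?H]
          usl2_scal_scal mult.commute[of f])
    then show "fps_nth (subst_plus F * fps_const (usl2_scal a * ?H)) m
        = fps_nth (fps_const (usl2_scal a * ?H) * subst_plus F) m"
      by (simp add: subst_plus_nth)
  qed
  have scalpow: "(usl2_scal a * ?H) ^ k = usl2_scal (a ^ k) * ?H ^ k" for a k
    by (induction k)
      (simp_all add: usl2_scal_hom(2) mult.assoc usl2_scal_left_commute[of ?H] usl2_scal_scal)
  have pow: "(fps_const (usl2_scal a * ?H) * subst_plus F) ^ k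
      = fps_const ((usl2_scal a * ?H) ^ k) * subst_plus (F ^ k)" for a F k
  proof (induction k)
    case (Suc k)
    have "(fps_const (usl2_scal a * ?H) * subst_plus F) ^ Suc k
        = fps_const ((usl2_scal a * ?H) ^ k) * (subst_plus (F ^ k) * fps_const (usl2_scal a * ?H)) * subst_plus F"
      by (simp only: power_Suc2 Suc mult.assoc)
    also have "\<dots> = fps_const ((usl2_scal a * ?H) ^ k) * fps_const (usl2_scal a * ?H)
        * (subst_plus (F ^ k) * subst_plus F)"
      by (simp only: comm) (simp only: mult.assoc)
    also have "\<dots> = fps_const ((usl2_scal a * ?H) ^ Suc k) * subst_plus (F ^ Suc k)"
      by (simp only: subst_plus_mult power_Suc2 fps_const_mult)
    finally show ?case .
  qed (simp add: subst_plus_one)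
  have scalars: "usl2_scal (1 / fact k) * (usl2_scal ((- 1 / 2) ^ k) * ?H ^ k * (usl2_scal f * ?J ^ n))
      = usl2_scal (1 / fact k * (- 1 / 2) ^ k * f) * (?H ^ k * ?J ^ n)" for f k
    by (simp only: mult.assoc usl2_scal_left_commute[of "?H ^ k"] usl2_scal_scal)
  show ?thesis
    by (simp only: twist_def h_exp_def A pow fps_nth_Abs_fps fps_mult_left_const_nth scalpow
        subst_plus_nth scalars twist_coeff_def)
qed

lemma twist_nth_0: "fps_nth twist 0 = 1"
  by (simp add: twist_nth twist_coeff_def usl2_scal_hom)

lemma twist_inverse: "twist * twist_inv = 1" "twist_inv * twist = 1"
proof -
  have "twist * fps_right_inverse twist 1 = 1"
    by (rule fps_right_inverse) (simp add: twist_nth_0)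
  moreover have "fps_left_inverse twist 1 * twist = 1"
    by (rule fps_left_inverse) (simp add: twist_nth_0)
  moreover have "fps_left_inverse twist 1 = fps_right_inverse twist 1"
    by (rule fps_left_inverse_eq_fps_right_inverse) (simp_all add: twist_nth_0)
  ultimately obtain G where G: "twist * G = 1" "G * twist = 1" by metis
  have "twist * twist_inv = 1 \<and> twist_inv * twist = 1"
    unfolding twist_inv_def
  proof (rule theI)
    show "twist * G = 1 \<and> G * twist = 1" using G by simp
    show "G' = G" if "twist * G' = 1 \<and> G' * twist = 1" for G'
      by (metis G(2) mult.assoc mult.left_neutral mult.right_neutral that)
  qed
  then show "twist * twist_inv = 1" "twist_inv * twist = 1" by auto
qed

section \<open>The twisted product of functionals of definite weight\<close>

definition has_weights :: "complex \<Rightarrow> complex \<Rightarrow> complex fps wfun \<Rightarrow> bool"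
  where "has_weights s t \<phi> \<longleftrightarrow> lder Gzero \<phi> = wconst (fps_const (2 * s)) * \<phi>
    \<and> rder Gzero \<phi> = wconst (fps_const (2 * t)) * \<phi>"

text \<open>
  Replacing \<open>J_0\<close> by the number \<open>2 s\<close> turns the twist into \<open>(1 - 2 h J_+) powr s\<close>.
\<close>
lemma sum_twist_coeff: "(\<Sum>k\<le>n. twist_coeff n k * (2 * s) ^ k) = fps_nth (bin_series s) n"
proof -
  have "twist_coeff n k * (2 * s) ^ k = fps_nth (fps_exp (- s)) k * fps_nth (ln_series ^ k) n" for k
  proof -
    have "(- 1 / 2) ^ k * (2 * s) ^ k = ((- 1 / 2) * (2 * s)) ^ k" by (rule power_mult_distrib[symmetric])
    also have "(- 1 / 2) * (2 * s) = - s" by simp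
    finally have "(- 1 / 2) ^ k * (2 * s) ^ k = (- s) ^ k" .
    moreover have "twist_coeff n k * (2 * s) ^ k
        = 1 / fact k * ((- 1 / 2) ^ k * (2 * s) ^ k) * fps_nth (ln_series ^ k) n"
      by (simp only: twist_coeff_def mult_ac)
    ultimately show ?thesis by simp
  qed
  then show ?thesis by (simp add: bin_series_exp fps_compose_nth atLeast0AtMost)
qed

lemma lder_Gzero_power:
  "has_weights s t \<phi> \<Longrightarrow> (lder Gzero ^^ k) \<phi> = wconst (fps_const ((2 * s) ^ k)) * \<phi>"
proof (induction k)
  case (Suc k)
  have "lder Gzero \<phi> = wconst (fps_const (2 * s)) * \<phi>" using Suc.prems by (simp add: has_weights_def)
  with Suc show ?case
    by (simp only: funpow.simps o_apply lder_linear power_Suc2 wconst_hom(4) mult.assoc flip: fps_const_mult)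
qed (simp add: wconst_hom)

lemma rder_Gzero_power:
  "has_weights s t \<phi> \<Longrightarrow> (rder Gzero ^^ k) \<phi> = wconst (fps_const ((2 * t) ^ k)) * \<phi>"
proof (induction k)
  case (Suc k)
  have "rder Gzero \<phi> = wconst (fps_const (2 * t)) * \<phi>" using Suc.prems by (simp add: has_weights_def)
  with Suc show ?case
    by (simp only: funpow.simps o_apply rder_linear power_Suc2 wconst_hom(4) mult.assoc flip: fps_const_mult)
qed (simp add: wconst_hom)

lemma usl2_eval_tens_power:
  assumes "respects_sl2 \<phi>" "respects_sl2 \<psi>"
  shows "usl2_eval \<phi> \<psi> (tens_left (usl_gen g) ^ k * z) = usl2_eval ((lder g ^^ k) \<phi>) \<psi> z"
    "usl2_eval \<phi> \<psi> (z * tens_left (usl_gen g) ^ k) = usl2_eval ((rder g ^^ k) \<phi>) \<psi> z"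
    "usl2_eval \<phi> \<psi> (tens_right (usl_gen g) ^ k * z) = usl2_eval \<phi> ((lder g ^^ k) \<psi>) z"
    "usl2_eval \<phi> \<psi> (z * tens_right (usl_gen g) ^ k) = usl2_eval \<phi> ((rder g ^^ k) \<psi>) z"
proof -
  note re = assms respects_sl2_lder_funpow respects_sl2_rder_funpow
  show "usl2_eval \<phi> \<psi> (tens_left (usl_gen g) ^ k * z) = usl2_eval ((lder g ^^ k) \<phi>) \<psi> z"
    by (induction k arbitrary: z)
      (simp_all add: power_Suc2 mult.assoc re usl2_eval_tens_left del: power_Suc)
  show "usl2_eval \<phi> \<psi> (z * tens_left (usl_gen g) ^ k) = usl2_eval ((rder g ^^ k) \<phi>) \<psi> z"
    by (induction k arbitrary: z)
      (simp_all add: mult.assoc[symmetric] re usl2_eval_tens_left)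
  show "usl2_eval \<phi> \<psi> (tens_right (usl_gen g) ^ k * z) = usl2_eval \<phi> ((lder g ^^ k) \<psi>) z"
    by (induction k arbitrary: z)
      (simp_all add: power_Suc2 mult.assoc re usl2_eval_tens_right del: power_Suc)
  show "usl2_eval \<phi> \<psi> (z * tens_right (usl_gen g) ^ k) = usl2_eval \<phi> ((rder g ^^ k) \<psi>) z"
    by (induction k arbitrary: z)
      (simp_all add: mult.assoc[symmetric] re usl2_eval_tens_right)
qed

text \<open>
  Since the first leg of the twist contains only \<open>J_0\<close>, which acts on \<open>\<phi>\<close> by a scalar, only a power
  of \<open>1 - 2 h J_+\<close> on the second leg remains.
\<close>

lemma usl2_eval_twist:
  assumes "respects_sl2 \<phi>" "respects_sl2 \<psi>" "has_weights s t \<phi>"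
  shows "usl2_eval \<phi> \<psi> (fps_nth twist n * z)
      = fps_const (fps_nth (bin_series s) n) * usl2_eval \<phi> ((lder Gplus ^^ n) \<psi>) z"
    "usl2_eval \<phi> \<psi> (z * fps_nth twist n)
      = fps_const (fps_nth (bin_series t) n) * usl2_eval \<phi> ((rder Gplus ^^ n) \<psi>) z"
proof -
  note re = assms(1,2) respects_sl2_lder_funpow respects_sl2_rder_funpow
  have "usl2_eval \<phi> \<psi> (fps_nth twist n * z)
      = (\<Sum>k\<le>n. fps_const (twist_coeff n k)
          * usl2_eval ((lder Gzero ^^ k) \<phi>) ((lder Gplus ^^ n) \<psi>) z)"
    by (simp add: twist_nth sum_distrib_right usl2_eval_sum mult.assoc usl2_eval_scal
        usl2_eval_tens_power re)
  also have "\<dots> = fps_const (\<Sum>k\<le>n. twist_coeff n k * (2 * s) ^ k)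
      * usl2_eval \<phi> ((lder Gplus ^^ n) \<psi>) z"
    by (simp add: lder_Gzero_power[OF assms(3)] usl2_eval_linear_functional fps_const_sum sum_distrib_right
        mult.assoc flip: fps_const_mult)
  finally show "usl2_eval \<phi> \<psi> (fps_nth twist n * z)
      = fps_const (fps_nth (bin_series s) n) * usl2_eval \<phi> ((lder Gplus ^^ n) \<psi>) z"
    by (simp only: sum_twist_coeff)
  have z: "z * (usl2_scal c * (a * b)) = usl2_scal c * (z * a * b)" for c a b
    by (simp only: usl2_scal_left_commute[of z] mult.assoc)
  have "usl2_eval \<phi> \<psi> (z * fps_nth twist n)
      = (\<Sum>k\<le>n. fps_const (twist_coeff n k)
          * usl2_eval ((rder Gzero ^^ k) \<phi>) ((rder Gplus ^^ n) \<psi>) z)"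
    by (simp add: twist_nth sum_distrib_left usl2_eval_sum z usl2_eval_scal usl2_eval_tens_power re)
  also have "\<dots> = fps_const (\<Sum>k\<le>n. twist_coeff n k * (2 * t) ^ k)
      * usl2_eval \<phi> ((rder Gplus ^^ n) \<psi>) z"
    by (simp add: rder_Gzero_power[OF assms(3)] usl2_eval_linear_functional fps_const_sum sum_distrib_right
        mult.assoc flip: fps_const_mult)
  finally show "usl2_eval \<phi> \<psi> (z * fps_nth twist n)
      = fps_const (fps_nth (bin_series t) n) * usl2_eval \<phi> ((rder Gplus ^^ n) \<psi>) z"
    by (simp only: sum_twist_coeff)
qed

lemma fnl2_twist:
  assumes "respects_sl2 \<phi>" "respects_sl2 \<psi>" "has_weights s t \<phi>"
  shows "fnl2 \<phi> \<psi> (twist * Z) = fnl2 \<phi> (lpow s \<psi>) Z" "fnl2 \<phi> \<psi> (Z * twist) = fnl2 \<phi> (rpow t \<psi>) Z"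
proof -
  let ?l = "\<lambda>i n. fps_const (fps_nth (bin_series s) i) * usl2_eval \<phi> ((lder Gplus ^^ i) \<psi>) (fps_nth Z n)"
  let ?r = "\<lambda>n i. fps_const (fps_nth (bin_series t) i) * usl2_eval \<phi> ((rder Gplus ^^ i) \<psi>) (fps_nth Z n)"
  have "fnl2 \<phi> \<psi> (twist * Z) = hsum (\<lambda>m. \<Sum>i\<le>m. ?l i (m - i))"
    by (simp only: fnl2_def fps_mult_nth usl2_eval_sum[OF assms(1,2)] usl2_eval_twist[OF assms]
        atLeast0AtMost)
  also have "\<dots> = hsum (\<lambda>n. hsum (\<lambda>i. ?l i n))" by (rule hsum_diagonal')
  also have "\<dots> = fnl2 \<phi> (lpow s \<psi>) Z" by (simp only: fnl2_def usl2_eval_lact)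
  finally show "fnl2 \<phi> \<psi> (twist * Z) = fnl2 \<phi> (lpow s \<psi>) Z" .
  have "fnl2 \<phi> \<psi> (Z * twist) = hsum (\<lambda>m. \<Sum>n\<le>m. ?r n (m - n))"
    by (simp only: fnl2_def fps_mult_nth usl2_eval_sum[OF assms(1,2)] usl2_eval_twist[OF assms]
        atLeast0AtMost)
  also have "\<dots> = hsum (\<lambda>n. hsum (?r n))" by (rule hsum_diagonal)
  also have "\<dots> = fnl2 \<phi> (rpow t \<psi>) Z" by (simp only: fnl2_def usl2_eval_ract)
  finally show "fnl2 \<phi> \<psi> (Z * twist) = fnl2 \<phi> (rpow t \<psi>) Z" .
qed

lemma fnl2_twist_inv:
  assumes "respects_sl2 \<phi>" "respects_sl2 \<psi>" "has_weights s t \<phi>"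
  shows "fnl2 \<phi> \<psi> (Z * twist_inv) = fnl2 \<phi> (rpow (- t) \<psi>) Z"
proof -
  \<comment> \<open>\<open>rpow t\<close> amounts to right multiplication by the twist, which then cancels its inverse.\<close>
  have "fnl2 \<phi> \<psi> (Z * twist_inv) = fnl2 \<phi> (rpow t (rpow (- t) \<psi>)) (Z * twist_inv)"
    by (simp add: rpow_add del: bin_series_nth)
  also have "\<dots> = fnl2 \<phi> (rpow (- t) \<psi>) (Z * twist_inv * twist)"
    by (rule fnl2_twist(2)[symmetric]) (use assms in \<open>simp_all add: respects_sl2_ract\<close>)
  finally show ?thesis by (simp add: mult.assoc twist_inverse)
qed

text \<open>
  The twist multiplies the undeformed coproduct from the left, its inverse from the right; this is the
  source of the two powers and of their opposite signs.
\<close>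
lemma fnl2_coprod:
  assumes "respects_sl2 \<phi>" "respects_sl2 \<psi>" "has_weights s t \<phi>"
  shows "fnl2 \<phi> \<psi> (coprod X) = fnl (\<phi> * lpow s (rpow (- t) \<psi>)) X"
proof -
  have "fnl2 \<phi> \<psi> (coprod X) = fnl2 \<phi> (lpow s \<psi>) (map_fps coprod0 X * twist_inv)"
    unfolding coprod_def mult.assoc by (rule fnl2_twist(1)[OF assms])
  also have "\<dots> = fnl2 \<phi> (rpow (- t) (lpow s \<psi>)) (map_fps coprod0 X)"
    by (rule fnl2_twist_inv) (use assms in \<open>simp_all add: respects_sl2_lact\<close>)
  also have "\<dots> = fnl (\<phi> * lpow s (rpow (- t) \<psi>)) X"
    by (simp add: fnl2_coprod0 respects_sl2_ract respects_sl2_lact assms lact_ract_commute)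
  finally show ?thesis .
qed

section \<open>The twisted product\<close>

text \<open>
  The transpose of the twisted coproduct.  This form is bilinear in arbitrary functionals, whereas
  the explicit formula \<open>star_weights\<close> requires a left factor of definite weights.
\<close>
definition star :: "complex fps wfun \<Rightarrow> complex fps wfun \<Rightarrow> complex fps wfun"
  where "star \<phi> \<psi>
    = Wfun (\<lambda>w. fnl2 \<phi> \<psi> (coprod (fps_const (abs_usl (Poly_Mapping.single (GWord w) 1)))))"

lemma star_linear:
  "star (\<phi> + \<phi>') \<psi> = star \<phi> \<psi> + star \<phi>' \<psi>" "star \<phi> (\<psi> + \<psi>') = star \<phi> \<psi> + star \<phi> \<psi>'"
  "star (wconst c * \<phi>) \<psi> = wconst c * star \<phi> \<psi>" "star \<phi> (wconst c * \<psi>) = wconst c * star \<phi> \<psi>"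
  by (rule wfun_eqI, simp add: star_def fnl2_linear_functional)+

lemma star_zero: "star 0 \<psi> = 0" "star \<phi> 0 = 0"
  using star_linear(3)[of 0 0 \<psi>] star_linear(4)[of \<phi> 0 0] by (simp_all add: wconst_hom)

lemma star_sum_left: "star (\<Sum>i\<in>I. \<phi> i) \<psi> = (\<Sum>i\<in>I. star (\<phi> i) \<psi>)"
  by (induction I rule: infinite_finite_induct) (simp_all add: star_zero star_linear)

lemma star_weights:
  assumes "respects_sl2 \<phi>" "respects_sl2 \<psi>" "has_weights s t \<phi>"
  shows "star \<phi> \<psi> = \<phi> * lpow s (rpow (- t) \<psi>)"
  by (rule wfun_eqI)
    (simp add: star_def fnl2_coprod[OF assms] fnl_word respects_sl2_mult respects_sl2_lact
      respects_sl2_ract assms)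

text \<open>Nilpotency of \<open>J_+\<close> on both sides keeps all Taylor expansions finite.\<close>
definition weight_vec :: "complex \<Rightarrow> complex \<Rightarrow> complex fps wfun \<Rightarrow> bool"
  where "weight_vec s t \<phi> \<longleftrightarrow> respects_sl2 \<phi> \<and> has_weights s t \<phi>
    \<and> (\<exists>N. (lder Gplus ^^ N) \<phi> = 0) \<and> (\<exists>N. (rder Gplus ^^ N) \<phi> = 0)"

lemma weight_vec_respects: "weight_vec s t \<phi> \<Longrightarrow> respects_sl2 \<phi>"
  by (simp add: weight_vec_def)

lemma rder_funpow_linear:
  "(rder g ^^ k) 0 = 0" "(rder g ^^ k) (\<phi> + \<psi>) = (rder g ^^ k) \<phi> + (rder g ^^ k) \<psi>"
  "(rder g ^^ k) (wconst c * \<phi>) = wconst c * (rder g ^^ k) \<phi>"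
  by (rule wfun_eqI; simp add: val_rder_funpow)+

lemma weight_vec_wconst: "weight_vec s t \<phi> \<Longrightarrow> weight_vec s t (wconst c * \<phi>)"
  unfolding weight_vec_def has_weights_def lder_linear rder_linear lder_funpow_linear rder_funpow_linear
  by (auto simp: respects_sl2_linear mult.left_commute[of "wconst c"]; metis mult_zero_right)

lemma weight_vec_one: "weight_vec 0 0 1"
proof -
  have "(lder Gplus ^^ 1) (1 :: complex fps wfun) = 0" "(rder Gplus ^^ 1) (1 :: complex fps wfun) = 0"
    by simp_all
  then show ?thesis
    unfolding weight_vec_def has_weights_def
    by (auto simp: respects_sl2_linear wconst_hom simp del: funpow.simps)
qed

lemma weight_vec_mult:
  assumes "weight_vec s t \<phi>" "weight_vec s' t' \<psi>"
  shows "weight_vec (s + s') (t + t') (\<phi> * \<psi>)"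
proof -
  have two: "wconst (fps_const (2 * (a + b))) = wconst (fps_const (2 * a)) + wconst (fps_const (2 * b))"
    for a b :: complex
    by (simp add: distrib_left wconst_hom flip: fps_const_add)
  have "lder Gzero \<phi> = wconst (fps_const (2 * s)) * \<phi>" "rder Gzero \<phi> = wconst (fps_const (2 * t)) * \<phi>"
    "lder Gzero \<psi> = wconst (fps_const (2 * s')) * \<psi>" "rder Gzero \<psi> = wconst (fps_const (2 * t')) * \<psi>"
    using assms by (auto simp: weight_vec_def has_weights_def)
  then have "has_weights (s + s') (t + t') (\<phi> * \<psi>)"
    by (simp only: has_weights_def lder_mult rder_mult two) (simp only: distrib_left mult_ac)
  moreover obtain M N where "(lder Gplus ^^ M) \<phi> = 0" "(lder Gplus ^^ N) \<psi> = 0"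
    using assms by (auto simp: weight_vec_def)
  then have "(lder Gplus ^^ (M + N)) (\<phi> * \<psi>) = 0" by (rule lder_funpow_mult_eq_0)
  moreover obtain M N where "(rder Gplus ^^ M) \<phi> = 0" "(rder Gplus ^^ N) \<psi> = 0"
    using assms by (auto simp: weight_vec_def)
  then have "(rder Gplus ^^ (M + N)) (\<phi> * \<psi>) = 0" by (rule rder_funpow_mult_eq_0)
  ultimately show ?thesis
    using assms unfolding weight_vec_def by (blast intro: respects_sl2_mult)
qed

text \<open>
  \<open>J_0\<close> has to pass \<open>J_+\<close> to reach the functional: \<open>J_+ J_0 = (J_0 - 2) J_+\<close> lowers the left weight by
  one, \<open>J_0 J_+ = J_+ (J_0 + 2)\<close> raises the right one.
\<close>
lemma weight_vec_lder:
  assumes "weight_vec s t \<phi>"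
  shows "weight_vec (s - 1) t (lder Gplus \<phi>)"
proof -
  obtain N M where N: "(lder Gplus ^^ N) \<phi> = 0" and M: "(rder Gplus ^^ M) \<phi> = 0"
    and re: "respects_sl2 \<phi>" and wt: "has_weights s t \<phi>"
    using assms by (auto simp: weight_vec_def)
  have br: "(Gzero, Gplus, 2, Gplus) \<in> sl2_brackets" by (simp add: sl2_brackets_def)
  have "lder Gplus (lder Gzero \<phi>) = lder Gzero (lder Gplus \<phi>) + wconst (fps_const 2) * lder Gplus \<phi>"
    by (rule wfun_eqI) (use respects_sl2D[OF re br, of "[]"] in simp)
  moreover have "lder Gzero \<phi> = wconst (fps_const (2 * s)) * \<phi>"
    using wt by (simp add: has_weights_def)
  moreover have "wconst (fps_const (2 * (s - 1))) = wconst (fps_const (2 * s)) - wconst (fps_const 2)"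
    by (simp add: right_diff_distrib wconst_hom flip: fps_const_sub)
  ultimately have "lder Gzero (lder Gplus \<phi>) = wconst (fps_const (2 * (s - 1))) * lder Gplus \<phi>"
    by (simp only: left_diff_distrib lder_linear) (metis add_diff_cancel_right')
  moreover have "rder Gzero (lder Gplus \<phi>) = wconst (fps_const (2 * t)) * lder Gplus \<phi>"
    using wt by (simp add: has_weights_def flip: lder_rder_commute)
  moreover have "(lder Gplus ^^ N) (lder Gplus \<phi>) = 0"
    using N by (metis funpow_swap1 lder_linear(1))
  moreover have "(rder Gplus ^^ M) (lder Gplus \<phi>) = 0"
    using M lder_rder_funpow_commute[of 1 Gplus M Gplus \<phi>] by simp
  ultimately show ?thesis
    using respects_sl2_lder[OF re] unfolding weight_vec_def has_weights_def by blast
qed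

lemma weight_vec_rder:
  assumes "weight_vec s t \<phi>"
  shows "weight_vec s (t + 1) (rder Gplus \<phi>)"
proof -
  obtain N M where N: "(lder Gplus ^^ N) \<phi> = 0" and M: "(rder Gplus ^^ M) \<phi> = 0"
    and re: "respects_sl2 \<phi>" and wt: "has_weights s t \<phi>"
    using assms by (auto simp: weight_vec_def)
  have br: "(Gzero, Gplus, 2, Gplus) \<in> sl2_brackets" by (simp add: sl2_brackets_def)
  have "rder Gzero (rder Gplus \<phi>) = rder Gplus (rder Gzero \<phi>) + wconst (fps_const 2) * rder Gplus \<phi>"
    by (rule wfun_eqI) (use respects_sl2D[OF re br, of _ "[]"] in simp)
  moreover have "rder Gzero \<phi> = wconst (fps_const (2 * t)) * \<phi>"
    using wt by (simp add: has_weights_def)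
  moreover have "wconst (fps_const (2 * (t + 1))) = wconst (fps_const (2 * t)) + wconst (fps_const 2)"
    by (simp add: distrib_left wconst_hom flip: fps_const_add)
  ultimately have "rder Gzero (rder Gplus \<phi>) = wconst (fps_const (2 * (t + 1))) * rder Gplus \<phi>"
    by (simp only: distrib_right rder_linear)
  moreover have "lder Gzero (rder Gplus \<phi>) = wconst (fps_const (2 * s)) * rder Gplus \<phi>"
    using wt by (simp add: has_weights_def lder_rder_commute)
  moreover have "(rder Gplus ^^ M) (rder Gplus \<phi>) = 0"
    using M by (metis funpow_swap1 rder_linear(1))
  moreover have "(lder Gplus ^^ N) (rder Gplus \<phi>) = 0"
    using N lder_rder_funpow_commute[of N Gplus 1 Gplus \<phi>] by simp
  ultimately show ?thesis
    using respects_sl2_rder[OF re] unfolding weight_vec_def has_weights_def by blast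
qed

lemma weight_vec_lder_funpow:
  "weight_vec s t \<phi> \<Longrightarrow> weight_vec (s - of_nat i) t ((lder Gplus ^^ i) \<phi>)"
proof (induction i)
  case (Suc i)
  then show ?case using weight_vec_lder[of "s - of_nat i" t "(lder Gplus ^^ i) \<phi>"]
    by (simp add: algebra_simps)
qed simp

lemma weight_vec_rder_funpow:
  "weight_vec s t \<phi> \<Longrightarrow> weight_vec s (t + of_nat i) ((rder Gplus ^^ i) \<phi>)"
proof (induction i)
  case (Suc i)
  then show ?case using weight_vec_rder[of s "t + of_nat i" "(rder Gplus ^^ i) \<phi>"]
    by (simp add: algebra_simps)
qed simp

lemma star_weight_vec:
  assumes "weight_vec s t \<phi>" "weight_vec s' t' \<psi>"
    and N: "(lder Gplus ^^ N) \<psi> = 0" "(rder Gplus ^^ M) \<psi> = 0"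
  shows "star \<phi> \<psi> = (\<Sum>k<M. \<Sum>i<N.
    wconst (fps_const (fps_nth (bin_series (- t)) k) * fps_X ^ k
          * (fps_const (fps_nth (bin_series s) i) * fps_X ^ i))
    * (\<phi> * (lder Gplus ^^ i) ((rder Gplus ^^ k) \<psi>)))"
proof -
  have nil: "(lder Gplus ^^ N) ((rder Gplus ^^ k) \<psi>) = 0" for k
    by (simp add: lder_rder_funpow_commute N(1)) (simp add: rder_funpow_wrev lder_funpow_linear)
  have "star \<phi> \<psi> = \<phi> * lpow s (rpow (- t) \<psi>)"
    by (rule star_weights) (use assms in \<open>simp_all add: weight_vec_def\<close>)
  also have "lpow s (rpow (- t) \<psi>) = (\<Sum>k<M. wconst (fps_const (fps_nth (bin_series (- t)) k) * fps_X ^ k)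
      * (\<Sum>i<N. wconst (fps_const (fps_nth (bin_series s) i) * fps_X ^ i)
        * (lder Gplus ^^ i) ((rder Gplus ^^ k) \<psi>)))"
    by (simp only: ract_finite[OF N(2)] lact_sum lact_linear(4) lact_finite[OF nil])
  finally show ?thesis
    by (simp only: sum_distrib_left wconst_hom(4)[symmetric] mult.left_commute[of \<phi> "wconst _"] mult.assoc[symmetric])
       (simp only: mult.assoc wconst_hom(4) mult.left_commute[of \<phi> "wconst _"])
qed

text \<open>
  Associativity, which on the dual side is the cocycle identity of the twist.  Each \<open>J_+\<close> that
  reaches the middle factor changes its weight by one, and Taylor's formula produces exactly the
  correspondingly shifted power on the third factor.
\<close>

lemma star_assoc_weight_vec:
  assumes \<phi>: "weight_vec s t \<phi>" and \<psi>: "weight_vec s' t' \<psi>" and \<theta>: "respects_sl2 \<theta>"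
  shows "star (star \<phi> \<psi>) \<theta> = star \<phi> (star \<psi> \<theta>)"
proof -
  obtain N M where N: "(lder Gplus ^^ N) \<psi> = 0" and M: "(rder Gplus ^^ M) \<psi> = 0"
    using \<psi> by (auto simp: weight_vec_def)
  let ?c = "\<lambda>k. wconst (fps_const (fps_nth (bin_series (- t)) k) * fps_X ^ k)"
  let ?d = "\<lambda>i. wconst (fps_const (fps_nth (bin_series s) i) * fps_X ^ i)"
  let ?D = "\<lambda>i k. (lder Gplus ^^ i) ((rder Gplus ^^ k) \<psi>)"
  define \<theta>' where "\<theta>' = lpow s' (rpow (- t') \<theta>)"
  have \<theta>': "respects_sl2 \<theta>'" by (simp add: \<theta>'_def respects_sl2_lact respects_sl2_ract \<theta>)
  have nil: "(lder Gplus ^^ N) ((rder Gplus ^^ k) \<psi>) = 0" for k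
    by (simp add: lder_rder_funpow_commute N) (simp add: rder_funpow_wrev lder_funpow_linear)
  have "star \<psi> \<theta> = \<psi> * \<theta>'"
    unfolding \<theta>'_def by (rule star_weights) (use \<psi> \<theta> in \<open>simp_all add: weight_vec_def\<close>)
  then have "star \<phi> (star \<psi> \<theta>) = \<phi> * lpow s (rpow (- t) (\<psi> * \<theta>'))"
    using star_weights[of \<phi> "\<psi> * \<theta>'" s t] \<phi> \<psi> \<theta>' by (simp add: weight_vec_def respects_sl2_mult)
  also have "lpow s (rpow (- t) (\<psi> * \<theta>'))
      = (\<Sum>k<M. ?c k * (\<Sum>i<N. ?d i * (?D i k * lpow (s - of_nat i) (rpow (- t - of_nat k) \<theta>'))))"
    by (simp only: rpow_mult[OF M] lact_sum lact_linear(4) lpow_mult[OF nil])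
  also have "\<phi> * \<dots> = (\<Sum>k<M. \<Sum>i<N. ?c k * ?d i
      * (\<phi> * ?D i k * lpow (s - of_nat i) (rpow (- t - of_nat k) \<theta>')))"
    by (simp only: sum_distrib_left) (simp only: mult_ac)
  finally have R: "star \<phi> (star \<psi> \<theta>) = \<dots>" .
  have "star (\<phi> * ?D i k) \<theta> = \<phi> * ?D i k * lpow (s - of_nat i) (rpow (- t - of_nat k) \<theta>')" for i k
  proof -
    have "weight_vec (s + (s' - of_nat i)) (t + (t' + of_nat k)) (\<phi> * ?D i k)"
      by (intro weight_vec_mult \<phi> weight_vec_lder_funpow weight_vec_rder_funpow \<psi>)
    then have "star (\<phi> * ?D i k) \<theta>
        = \<phi> * ?D i k * lpow (s + (s' - of_nat i)) (rpow (- (t + (t' + of_nat k))) \<theta>)"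
      by (intro star_weights \<theta>) (simp_all add: weight_vec_def)
    also have "lpow (s + (s' - of_nat i)) (rpow (- (t + (t' + of_nat k))) \<theta>)
        = lpow (s - of_nat i) (rpow (- t - of_nat k) \<theta>')"
      by (simp add: \<theta>'_def lact_ract_commute[symmetric] rpow_add lpow_add algebra_simps)
    finally show ?thesis .
  qed
  moreover have "star \<phi> \<psi> = (\<Sum>k<M. \<Sum>i<N. ?c k * ?d i * (\<phi> * ?D i k))"
    by (simp only: star_weight_vec[OF \<phi> \<psi> N M] wconst_hom(4))
  ultimately show ?thesis
    unfolding R by (simp only: star_sum_left mult.assoc star_linear)
qed

text \<open>
  The twisted product mixes weights, so products of coordinate functions are only sums of weight vectors.
\<close>
inductive finite_type :: "complex fps wfun \<Rightarrow> bool"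
  where
    zero: "finite_type 0"
  | weight: "weight_vec s t \<phi> \<Longrightarrow> finite_type \<phi>"
  | add: "finite_type \<phi> \<Longrightarrow> finite_type \<psi> \<Longrightarrow> finite_type (\<phi> + \<psi>)"

lemma finite_type_respects: "finite_type \<phi> \<Longrightarrow> respects_sl2 \<phi>"
  by (induction rule: finite_type.induct) (auto simp: respects_sl2_linear weight_vec_respects)

lemma finite_type_sum: "(\<And>i. i \<in> I \<Longrightarrow> finite_type (\<phi> i)) \<Longrightarrow> finite_type (\<Sum>i\<in>I. \<phi> i)"
  by (induction I rule: infinite_finite_induct) (auto intro: finite_type.intros)

lemma finite_type_wconst: "finite_type \<phi> \<Longrightarrow> finite_type (wconst c * \<phi>)"
  by (induction rule: finite_type.induct)
    (auto simp: distrib_left intro: finite_type.intros weight_vec_wconst)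

lemma finite_type_star:
  assumes "finite_type \<phi>" "finite_type \<psi>"
  shows "finite_type (star \<phi> \<psi>)"
  using assms
proof (induction \<phi> rule: finite_type.induct)
  case (weight s t \<phi>)
  from weight(2,1) show ?case
  proof (induction \<psi> rule: finite_type.induct)
    case (weight s' t' \<psi>)
    obtain N M where N: "(lder Gplus ^^ N) \<psi> = 0" "(rder Gplus ^^ M) \<psi> = 0"
      using weight(1) by (auto simp: weight_vec_def)
    show ?case
      unfolding star_weight_vec[OF weight(2,1) N]
      by (rule finite_type_sum finite_type.weight[OF weight_vec_wconst[OF weight_vec_mult[OF weight(2)
          weight_vec_lder_funpow[OF weight_vec_rder_funpow[OF weight(1)]]]]])+
  qed (auto simp: star_zero star_linear intro: finite_type.intros)
qed (auto simp: star_zero star_linear intro: finite_type.intros)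

lemma star_assoc:
  assumes "finite_type \<phi>" "finite_type \<psi>" "respects_sl2 \<theta>"
  shows "star (star \<phi> \<psi>) \<theta> = star \<phi> (star \<psi> \<theta>)"
  using assms
proof (induction \<phi> rule: finite_type.induct)
  case (weight s t \<phi>)
  from weight(2,1,3) show ?case
    by (induction \<psi> rule: finite_type.induct)
      (auto simp: star_zero star_linear star_assoc_weight_vec)
qed (auto simp: star_zero star_linear)

lemma lact_one_fun: "fps_nth F 0 = 1 \<Longrightarrow> lact F 1 = 1" "fps_nth F 0 = 1 \<Longrightarrow> ract F 1 = 1"
  using lact_finite[of 1 1 F] ract_finite[of 1 1 F] by (simp_all add: wconst_hom)

lemma star_one: "respects_sl2 \<phi> \<Longrightarrow> star 1 \<phi> = \<phi>" "weight_vec s t \<phi> \<Longrightarrow> star \<phi> 1 = \<phi>"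
  using star_weights[of 1 \<phi> 0 0] star_weights[of \<phi> 1 s t] weight_vec_one
  by (simp_all add: weight_vec_def lact_one_fun)

section \<open>Matrix coefficients of the spin representations\<close>

definition mat_coeff :: "real \<Rightarrow> real \<Rightarrow> real \<Rightarrow> complex fps wfun"
  where "mat_coeff j m' m = Wfun (\<lambda>w. fps_const (complex_of_real (word_elt j w m' m)))"

abbreviation rconst :: "real \<Rightarrow> complex fps wfun"
  where "rconst r \<equiv> wconst (fps_const (complex_of_real r))"

lemma spin_elt_fnl: "spin_elt j m' m = fnl (mat_coeff j m' m)"
proof
  fix X
  have "usl_eval (mat_coeff j m' m) u = fps_const (spin_elt0 j m' m u)" for u
    by (simp add: usl_eval_def spin_elt0_def lin_ext_def on_word_def mat_coeff_def fps_const_sum)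
  moreover have "spin_elt j m' m X = Abs_fps (\<lambda>n. spin_elt0 j m' m (fps_nth X n))"
    by (simp add: spin_elt_def map_fps_def)
  ultimately show "spin_elt j m' m X = fnl (mat_coeff j m' m) X"
    using hsum_const[of "spin_elt j m' m X"] by (simp add: fnl_def)
qed

lemma weights_spin: "2 * j = real n \<Longrightarrow> weights j = (\<lambda>i. - j + real i) ` {..n}"
  by (auto simp: weights_def)

lemma finite_weights [simp]: "finite (weights j)"
proof (rule finite_subset)
  show "weights j \<subseteq> (\<lambda>i. - j + real i) ` {..nat \<lfloor>2 * j\<rfloor>}"
    by (auto simp: weights_def le_nat_iff le_floor_iff)
qed simp

lemma weights_bounds: "m \<in> weights j \<Longrightarrow> - j \<le> m \<and> m \<le> j"
  by (auto simp: weights_def)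

lemma weights_pred: "m \<in> weights j \<Longrightarrow> m \<noteq> - j \<Longrightarrow> m - 1 \<in> weights j"
proof -
  assume "m \<in> weights j" "m \<noteq> - j"
  then obtain i where "m = - j + real i" "m \<le> j" "i \<noteq> 0" by (auto simp: weights_def)
  then show "m - 1 \<in> weights j" by (auto simp: weights_def intro!: exI[of _ "i - 1"])
qed

lemma weights_succ: "spin j \<Longrightarrow> m \<in> weights j \<Longrightarrow> m \<noteq> j \<Longrightarrow> m + 1 \<in> weights j"
proof -
  assume a: "spin j" "m \<in> weights j" "m \<noteq> j"
  then obtain n i where n: "2 * j = real n" and i: "m = - j + real i" "m \<le> j"
    by (auto simp: weights_def spin_def)
  then have "real i < real n" using a by linarith
  then have "real (Suc i) \<le> real n" by simp
  then show "m + 1 \<in> weights j" using n i by (auto simp: weights_def intro!: exI[of _ "Suc i"])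
qed

lemma weights_uminus: "spin j \<Longrightarrow> m \<in> weights j \<Longrightarrow> - m \<in> weights j"
proof -
  assume "spin j" "m \<in> weights j"
  then obtain n i where "2 * j = real n" "m = - j + real i" "m \<le> j"
    by (auto simp: weights_def spin_def)
  then show "- m \<in> weights j" by (auto simp: weights_def intro!: exI[of _ "n - i"])
qed

text \<open>
  The ladder coefficients vanish at the ends of the spectrum, so the sums over intermediate weights
  reduce to one term without boundary cases.
\<close>

lemma sum_gen_elt_left:
  assumes "spin j" "m' \<in> weights j"
  shows "(\<Sum>s\<in>weights j. gen_elt j Gzero m' s * f s) = 2 * m' * f m'"
    "(\<Sum>s\<in>weights j. gen_elt j Gplus m' s * f s) = sqrt ((j - m' + 1) * (j + m')) * f (m' - 1)"
    "(\<Sum>s\<in>weights j. gen_elt j Gminus m' s * f s) = sqrt ((j + m' + 1) * (j - m')) * f (m' + 1)"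
proof -
  show "(\<Sum>s\<in>weights j. gen_elt j Gzero m' s * f s) = 2 * m' * f m'"
    using assms by (simp add: if_distrib[of "\<lambda>x. x * _"] sum.delta cong: if_cong)
  have "(\<Sum>s\<in>weights j. gen_elt j Gplus m' s * f s)
      = (\<Sum>s\<in>weights j. if s = m' - 1 then sqrt ((j - m' + 1) * (j + m')) * f (m' - 1) else 0)"
    by (intro sum.cong) (auto simp: algebra_simps)
  then show "(\<Sum>s\<in>weights j. gen_elt j Gplus m' s * f s) = sqrt ((j - m' + 1) * (j + m')) * f (m' - 1)"
    using weights_pred[OF assms(2)] by (cases "m' = - j") (auto simp: sum.delta)
  have "(\<Sum>s\<in>weights j. gen_elt j Gminus m' s * f s)
      = (\<Sum>s\<in>weights j. if s = m' + 1 then sqrt ((j + m' + 1) * (j - m')) * f (m' + 1) else 0)"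
    by (intro sum.cong) (auto simp: algebra_simps)
  then show "(\<Sum>s\<in>weights j. gen_elt j Gminus m' s * f s) = sqrt ((j + m' + 1) * (j - m')) * f (m' + 1)"
    using weights_succ[OF assms] by (cases "m' = j") (auto simp: sum.delta)
qed

lemma gen_elt_bracket:
  assumes "spin j" "m' \<in> weights j" "m \<in> weights j" "(a, b, c, g) \<in> sl2_brackets"
  shows "complex_of_real (\<Sum>s\<in>weights j. gen_elt j a m' s * gen_elt j b s m)
    = complex_of_real (\<Sum>s\<in>weights j. gen_elt j b m' s * gen_elt j a s m) + c * complex_of_real (gen_elt j g m' m)"
proof -
  have nn: "0 \<le> j + m" "0 \<le> j - m" "0 \<le> (j - m + 1) * (j + m)" "0 \<le> (j + m + 1) * (j - m)"
    using weights_bounds[OF assms(3)] by auto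
  have sq: "sqrt ((j - m + 1) * (j + m)) * sqrt ((j + m) * (j - m + 1)) = (j - m + 1) * (j + m)"
    "sqrt ((j + m + 1) * (j - m)) * sqrt ((j - m) * (j + m + 1)) = (j + m + 1) * (j - m)"
    using nn by (simp_all add: mult.commute flip: power2_eq_square)
  have "(\<Sum>s\<in>weights j. gen_elt j Gzero m' s * gen_elt j Gplus s m)
      = (\<Sum>s\<in>weights j. gen_elt j Gplus m' s * gen_elt j Gzero s m) + 2 * gen_elt j Gplus m' m"
    "(\<Sum>s\<in>weights j. gen_elt j Gzero m' s * gen_elt j Gminus s m)
      = (\<Sum>s\<in>weights j. gen_elt j Gminus m' s * gen_elt j Gzero s m) + - 2 * gen_elt j Gminus m' m"
    "(\<Sum>s\<in>weights j. gen_elt j Gplus m' s * gen_elt j Gminus s m)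
      = (\<Sum>s\<in>weights j. gen_elt j Gminus m' s * gen_elt j Gplus s m) + 1 * gen_elt j Gzero m' m"
    unfolding sum_gen_elt_left[OF assms(1,2)] using sq by (auto simp: algebra_simps)
  from this[THEN arg_cong[of _ _ complex_of_real]] show ?thesis
    using assms(4) by (auto simp: sl2_brackets_def simp del: gen_elt.simps of_real_sum)
qed

lemma word_elt_append:
  assumes "m' \<in> weights j"
  shows "word_elt j (v @ w) m' m = (\<Sum>s\<in>weights j. word_elt j v m' s * word_elt j w s m)"
  using assms
proof (induction v arbitrary: m')
  case Nil
  then show ?case by (simp add: if_distrib[of "\<lambda>x. x * _"] sum.delta cong: if_cong)
next
  case (Cons g v)
  have "word_elt j ((g # v) @ w) m' m
      = (\<Sum>s\<in>weights j. \<Sum>t\<in>weights j. gen_elt j g m' s * (word_elt j v s t * word_elt j w t m))"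
    using Cons.IH by (simp add: sum_distrib_left)
  also have "\<dots> = (\<Sum>t\<in>weights j. \<Sum>s\<in>weights j. gen_elt j g m' s * (word_elt j v s t * word_elt j w t m))"
    by (rule sum.swap)
  finally show ?case by (simp add: sum_distrib_right mult.assoc)
qed

lemma word_elt_single: "m \<in> weights j \<Longrightarrow> word_elt j [g] m' m = gen_elt j g m' m"
  by (simp add: if_distrib[of "\<lambda>x. _ * x"] sum.delta cong: if_cong)

lemma val_mat_coeff: "val (mat_coeff j m' m) w = fps_const (complex_of_real (word_elt j w m' m))"
  by (simp add: mat_coeff_def)

lemma lder_mat_coeff:
  "lder g (mat_coeff j m' m) = (\<Sum>s\<in>weights j. rconst (gen_elt j g m' s) * mat_coeff j s m)"
  by (rule wfun_eqI) (simp add: val_mat_coeff fps_const_sum flip: fps_const_mult)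

lemma rder_mat_coeff:
  assumes "m' \<in> weights j" "m \<in> weights j"
  shows "rder g (mat_coeff j m' m) = (\<Sum>s\<in>weights j. rconst (gen_elt j g s m) * mat_coeff j m' s)"
  by (rule wfun_eqI)
    (simp add: val_mat_coeff word_elt_append[OF assms(1)] word_elt_single[OF assms(2)] fps_const_sum
      del: word_elt.simps flip: fps_const_mult, simp add: mult.commute)

lemma rconst_sum_gen_elt:
  assumes "spin j" "m' \<in> weights j"
  shows "(\<Sum>s\<in>weights j. rconst (gen_elt j Gzero m' s) * \<phi> s) = rconst (2 * m') * \<phi> m'"
    "(\<Sum>s\<in>weights j. rconst (gen_elt j Gplus m' s) * \<phi> s)
      = rconst (sqrt ((j - m' + 1) * (j + m'))) * \<phi> (m' - 1)"
    "(\<Sum>s\<in>weights j. rconst (gen_elt j Gminus m' s) * \<phi> s)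
      = rconst (sqrt ((j + m' + 1) * (j - m'))) * \<phi> (m' + 1)"
proof -
  show "(\<Sum>s\<in>weights j. rconst (gen_elt j Gzero m' s) * \<phi> s) = rconst (2 * m') * \<phi> m'"
    using assms by (simp add: if_distrib[of "\<lambda>x. wconst (fps_const (complex_of_real x)) * _"] wconst_hom
        sum.delta cong: if_cong)
  have "(\<Sum>s\<in>weights j. rconst (gen_elt j Gplus m' s) * \<phi> s)
      = (\<Sum>s\<in>weights j. if s = m' - 1 then rconst (sqrt ((j - m' + 1) * (j + m'))) * \<phi> (m' - 1) else 0)"
    by (intro sum.cong) (auto simp: algebra_simps wconst_hom)
  then show "(\<Sum>s\<in>weights j. rconst (gen_elt j Gplus m' s) * \<phi> s)
      = rconst (sqrt ((j - m' + 1) * (j + m'))) * \<phi> (m' - 1)"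
    using weights_pred[OF assms(2)] by (cases "m' = - j") (auto simp: sum.delta wconst_hom)
  have "(\<Sum>s\<in>weights j. rconst (gen_elt j Gminus m' s) * \<phi> s)
      = (\<Sum>s\<in>weights j. if s = m' + 1 then rconst (sqrt ((j + m' + 1) * (j - m'))) * \<phi> (m' + 1) else 0)"
    by (intro sum.cong) (auto simp: algebra_simps wconst_hom)
  then show "(\<Sum>s\<in>weights j. rconst (gen_elt j Gminus m' s) * \<phi> s)
      = rconst (sqrt ((j + m' + 1) * (j - m'))) * \<phi> (m' + 1)"
    using weights_succ[OF assms] by (cases "m' = j") (auto simp: sum.delta wconst_hom)
qed

lemma respects_sl2_mat_coeff:
  assumes "spin j" "m' \<in> weights j"
  shows "respects_sl2 (mat_coeff j m' m)"
proof (rule respects_sl2I)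
  fix a b c g v w
  assume br: "(a, b, c, g) \<in> sl2_brackets"
  have two: "word_elt j (a # b # w) s m
      = (\<Sum>t\<in>weights j. (\<Sum>r\<in>weights j. gen_elt j a s r * gen_elt j b r t) * word_elt j w t m)" for a b s
    by (simp add: sum_distrib_left sum_distrib_right mult.assoc del: gen_elt.simps) (rule sum.swap)
  have os: "complex_of_real (\<Sum>t\<in>weights j. F t * G t)
      = (\<Sum>t\<in>weights j. complex_of_real (F t) * complex_of_real (G t))" for F G
    by simp
  have two': "complex_of_real (word_elt j (a # b # w) s m) = (\<Sum>t\<in>weights j.
      complex_of_real (\<Sum>r\<in>weights j. gen_elt j a s r * gen_elt j b r t) * complex_of_real (word_elt j w t m))"
    for a b s
    unfolding two by (rule os)
  have "complex_of_real (word_elt j (a # b # w) s m)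
      = complex_of_real (word_elt j (b # a # w) s m) + c * complex_of_real (word_elt j (g # w) s m)"
    if s: "s \<in> weights j" for s
  proof -
    have "complex_of_real (word_elt j (a # b # w) s m) = (\<Sum>t\<in>weights j.
      (complex_of_real (\<Sum>r\<in>weights j. gen_elt j b s r * gen_elt j a r t)
        + c * complex_of_real (gen_elt j g s t)) * complex_of_real (word_elt j w t m))"
      unfolding two' by (intro sum.cong refl) (simp only: gen_elt_bracket[OF assms(1) s _ br])
    moreover have "c * complex_of_real (word_elt j (g # w) s m)
        = (\<Sum>t\<in>weights j. c * complex_of_real (gen_elt j g s t) * complex_of_real (word_elt j w t m))"
      by (simp add: sum_distrib_left mult.assoc)
    ultimately show ?thesis
      by (simp only: two'[of b a] distrib_right sum.distrib)
  qed
  then have "complex_of_real (word_elt j (v @ a # b # w) m' m)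
      = complex_of_real (word_elt j (v @ b # a # w) m' m) + c * complex_of_real (word_elt j (v @ g # w) m' m)"
    unfolding word_elt_append[OF assms(2)] of_real_sum of_real_mult
    by (simp add: sum_distrib_left distrib_left sum.distrib mult_ac del: word_elt.simps)
  then show "val (mat_coeff j m' m) (v @ a # b # w)
      = val (mat_coeff j m' m) (v @ b # a # w) + fps_const c * val (mat_coeff j m' m) (v @ g # w)"
    by (simp add: val_mat_coeff)
qed

lemma sum_gen_elt_Gzero_right:
  assumes "m \<in> weights j"
  shows "(\<Sum>s\<in>weights j. rconst (gen_elt j Gzero s m) * \<phi> s) = rconst (2 * m) * \<phi> m"
  using assms by (simp add: if_distrib[of "\<lambda>x. wconst (fps_const (complex_of_real x)) * _"] wconst_hom
        sum.delta' cong: if_cong)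

lemma weight_vec_mat_coeff:
  assumes "spin j" "m' \<in> weights j" "m \<in> weights j"
  shows "weight_vec (of_real m') (of_real m) (mat_coeff j m' m)"
proof -
  have "has_weights (of_real m') (of_real m) (mat_coeff j m' m)"
    using rconst_sum_gen_elt(1)[OF assms(1,2)] sum_gen_elt_Gzero_right[OF assms(3)]
    by (simp add: has_weights_def lder_mat_coeff rder_mat_coeff assms)
  \<comment> \<open>From the left \<open>J_+\<close> lowers \<open>m'\<close>, so \<open>Suc i\<close> steps lead below the lowest weight \<open>- j\<close>; from the right it raises \<open>m\<close>.\<close>
  moreover have L: "(lder Gplus ^^ Suc i) (mat_coeff j (- j + real i) m) = 0" if "- j + real i \<in> weights j" for i
    using that
  proof (induction i)
    case 0
    then show ?case using rconst_sum_gen_elt(2)[OF assms(1) 0] by (simp add: lder_mat_coeff wconst_hom)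
  next
    case (Suc i)
    have "lder Gplus (mat_coeff j (- j + real (Suc i)) m)
        = rconst (sqrt ((j - (- j + real (Suc i)) + 1) * (j + (- j + real (Suc i))))) * mat_coeff j (- j + real i) m"
      using rconst_sum_gen_elt(2)[OF assms(1) Suc.prems] by (simp add: lder_mat_coeff)
    moreover have "- j + real i \<in> weights j" using Suc.prems by (auto simp: weights_def)
    ultimately show ?case
      using Suc.IH unfolding funpow_Suc_right o_apply by (simp add: lder_funpow_linear del: funpow.simps)
  qed
  then have "\<exists>N. (lder Gplus ^^ N) (mat_coeff j m' m) = 0"
  proof -
    obtain i where "m' = - j + real i" using assms(2) by (auto simp: weights_def)
    then show ?thesis using L[of i] assms(2) by blast
  qed
  moreover have R: "(rder Gplus ^^ Suc i) (mat_coeff j m' (j - real i)) = 0" if "j - real i \<in> weights j" for i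
    using that
  proof (induction i)
    case 0
    have "(\<Sum>s\<in>weights j. rconst (gen_elt j Gplus s j) * mat_coeff j m' s) = 0"
      by (intro sum.neutral) (auto simp: wconst_hom)
    then show ?case using 0 by (simp add: rder_mat_coeff assms)
  next
    case (Suc i)
    have s: "j - real i \<in> weights j"
      using weights_succ[OF assms(1) Suc.prems] by (simp add: algebra_simps)
    have "(\<Sum>s\<in>weights j. rconst (gen_elt j Gplus s (j - real (Suc i))) * mat_coeff j m' s)
        = (\<Sum>s\<in>weights j. if s = j - real i
            then rconst (gen_elt j Gplus (j - real i) (j - real (Suc i))) * mat_coeff j m' (j - real i) else 0)"
      by (intro sum.cong) (auto simp: wconst_hom)
    then have "rder Gplus (mat_coeff j m' (j - real (Suc i)))
        = rconst (gen_elt j Gplus (j - real i) (j - real (Suc i))) * mat_coeff j m' (j - real i)"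
      using s Suc.prems by (simp add: rder_mat_coeff assms sum.delta)
    then show ?case
      using Suc.IH[OF s] unfolding funpow_Suc_right o_apply rder_funpow_wrev
      by (simp add: wrev_mult lder_funpow_linear del: funpow.simps)
  qed
  then have "\<exists>N. (rder Gplus ^^ N) (mat_coeff j m' m) = 0"
  proof -
    have "- m \<in> weights j" by (rule weights_uminus[OF assms(1,3)])
    then obtain i where "- m = - j + real i" unfolding weights_def by blast
    then have "m = j - real i" by linarith
    then show ?thesis using R[of i] assms(3) by (metis (no_types))
  qed
  ultimately show ?thesis
    using respects_sl2_mat_coeff[OF assms(1,2)] by (simp add: weight_vec_def)
qed

section \<open>The quantum group as an algebra of functionals\<close>

fun left_weight :: "slh_gen \<Rightarrow> real"
  where "left_weight Gx = 1/2" | "left_weight Gu = 1/2" | "left_weight Gv = - 1/2" | "left_weight Gy = - 1/2"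

fun right_weight :: "slh_gen \<Rightarrow> real"
  where "right_weight Gx = 1/2" | "right_weight Gu = - 1/2" | "right_weight Gv = 1/2" | "right_weight Gy = - 1/2"

definition gen_fun :: "slh_gen \<Rightarrow> complex fps wfun"
  where "gen_fun a = mat_coeff (1/2) (left_weight a) (right_weight a)"

lemma spin_half: "spin (1/2)"
  by (auto simp: spin_def intro: exI[of _ 1])

lemma weights_half: "weights (1/2) = {- 1/2, 1/2}"
  using weights_spin[of "1/2" 1] by (auto simp: atMost_Suc)

lemma gen_pairing_fnl: "gen_pairing a = fnl (gen_fun a)"
  by (cases a) (simp_all add: gen_fun_def spin_elt_fnl)

lemma left_right_weight_mem: "left_weight a \<in> weights (1/2)" "right_weight a \<in> weights (1/2)"
  by (cases a; simp add: weights_half)+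

lemma weight_vec_gen_fun:
  "weight_vec (of_real (left_weight a)) (of_real (right_weight a)) (gen_fun a)"
  unfolding gen_fun_def by (intro weight_vec_mat_coeff spin_half left_right_weight_mem)

lemma finite_type_gen_fun: "finite_type (gen_fun a)"
  by (rule finite_type.weight[OF weight_vec_gen_fun])

lemma lder_gen_fun:
  "lder Gplus (gen_fun Gx) = gen_fun Gv" "lder Gplus (gen_fun Gu) = gen_fun Gy"
  "lder Gplus (gen_fun Gv) = 0" "lder Gplus (gen_fun Gy) = 0"
  "lder Gminus (gen_fun Gx) = 0" "lder Gminus (gen_fun Gu) = 0"
  "lder Gminus (gen_fun Gv) = gen_fun Gx" "lder Gminus (gen_fun Gy) = gen_fun Gu"
  "lder Gzero (gen_fun Gx) = gen_fun Gx" "lder Gzero (gen_fun Gu) = gen_fun Gu"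
  "lder Gzero (gen_fun Gv) = - gen_fun Gv" "lder Gzero (gen_fun Gy) = - gen_fun Gy"
  unfolding gen_fun_def lder_mat_coeff weights_half
  by (simp_all add: wconst_hom flip: fps_const_neg)

lemma rder_gen_fun:
  "rder Gplus (gen_fun Gu) = gen_fun Gx" "rder Gplus (gen_fun Gy) = gen_fun Gv"
  "rder Gplus (gen_fun Gx) = 0" "rder Gplus (gen_fun Gv) = 0"
proof -
  have r: "rder g (gen_fun a) = (\<Sum>s\<in>weights (1/2).
      rconst (gen_elt (1/2) g s (right_weight a)) * mat_coeff (1/2) (left_weight a) s)" for g a
    unfolding gen_fun_def by (rule rder_mat_coeff[OF left_right_weight_mem])
  show "rder Gplus (gen_fun Gu) = gen_fun Gx" "rder Gplus (gen_fun Gy) = gen_fun Gv"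
    "rder Gplus (gen_fun Gx) = 0" "rder Gplus (gen_fun Gv) = 0"
    unfolding r by (simp_all add: weights_half wconst_hom gen_fun_def)
qed

lemma val_gen_fun_Nil:
  "val (gen_fun Gx) [] = 1" "val (gen_fun Gu) [] = 0" "val (gen_fun Gv) [] = 0" "val (gen_fun Gy) [] = 1"
  by (simp_all add: gen_fun_def val_mat_coeff)

text \<open>The determinant takes the value 1 at the identity and is invariant.\<close>

lemma gen_fun_det: "gen_fun Gx * gen_fun Gy - gen_fun Gu * gen_fun Gv = 1"
proof (rule wfun_eqI)
  fix w
  show "val (gen_fun Gx * gen_fun Gy - gen_fun Gu * gen_fun Gv) w = val 1 w"
  proof (cases w)
    case Nil
    then show ?thesis by (simp add: val_gen_fun_Nil val_one)
  next
    case (Cons g w')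
    have "lder g (gen_fun Gx * gen_fun Gy - gen_fun Gu * gen_fun Gv) = 0"
      by (cases g) (simp_all add: lder_mult lder_gen_fun algebra_simps)
    then have "val (lder g (gen_fun Gx * gen_fun Gy - gen_fun Gu * gen_fun Gv)) w' = 0" by simp
    then show ?thesis by (simp add: Cons val_one)
  qed
qed

text \<open>
  \<open>J_+\<close> squares to zero in the spin 1/2 representation, so each of the two powers of \<open>1 - 2 h J_+\<close>
  reduces to its first two terms, \<open>1 + l J_+\<close> on the left and \<open>1 + r J_+\<close> on the right.
\<close>
lemma star_gen_fun:
  fixes a b :: slh_gen
  defines "l \<equiv> wconst (fps_const (of_real (- 2 * left_weight a)) * fps_X)"
    and "r \<equiv> wconst (fps_const (of_real (2 * right_weight a)) * fps_X)"
  shows "star (gen_fun a) (gen_fun b) = gen_fun a * (gen_fun b + l * lder Gplus (gen_fun b)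
    + r * rder Gplus (gen_fun b) + l * (r * lder Gplus (rder Gplus (gen_fun b))))"
proof -
  have nil: "(lder Gplus ^^ 2) (gen_fun c) = 0" "(rder Gplus ^^ 2) (gen_fun c) = 0" for c
    by (cases c; simp add: numeral_2_eq_2 lder_gen_fun rder_gen_fun)+
  have "(lder Gplus ^^ 2) (gen_fun b + r * rder Gplus (gen_fun b)) = 0"
    unfolding r_def lder_funpow_linear nil
    by (cases b) (simp_all add: rder_gen_fun lder_funpow_linear nil)
  note eqs = ract_finite[OF nil(2), of "bin_series (- of_real (right_weight a))" b]
    lact_finite[OF this, of "bin_series (of_real (left_weight a))"]
  have "star (gen_fun a) (gen_fun b)
      = gen_fun a * lpow (of_real (left_weight a)) (rpow (- of_real (right_weight a)) (gen_fun b))"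
    using weight_vec_gen_fun[of a] weight_vec_gen_fun[of b]
    by (intro star_weights) (auto simp: weight_vec_def)
  also have "rpow (- of_real (right_weight a)) (gen_fun b) = gen_fun b + r * rder Gplus (gen_fun b)"
    unfolding eqs(1) r_def by (simp add: numeral_2_eq_2 wconst_hom(2) mult.commute)
  also have "lpow (of_real (left_weight a)) (gen_fun b + r * rder Gplus (gen_fun b))
      = gen_fun b + l * lder Gplus (gen_fun b)
        + r * rder Gplus (gen_fun b) + l * (r * lder Gplus (rder Gplus (gen_fun b)))"
  proof -
    have "lder Gplus (r * \<phi>) = r * lder Gplus \<phi>" for \<phi> by (simp add: r_def)
    then show ?thesis
      unfolding eqs(2) l_def
      by (simp add: numeral_2_eq_2 wconst_hom(2) distrib_left mult.commute[of 2])
  qed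
  finally show ?thesis .
qed

lemma star_wconst: "respects_sl2 \<phi> \<Longrightarrow> star (wconst c) \<phi> = wconst c * \<phi>"
  using star_linear(3)[of c 1 \<phi>] by (simp add: star_one)

primrec word_fun :: "slh_gen list \<Rightarrow> complex fps wfun"
  where "word_fun [] = 1" | "word_fun (a # w) = star (gen_fun a) (word_fun w)"

lemma finite_type_word_fun: "finite_type (word_fun w)"
  by (induction w) (auto intro: finite_type.weight[OF weight_vec_one] finite_type_star finite_type_gen_fun)

lemmas respects_sl2_word_fun = finite_type_respects[OF finite_type_word_fun]

text \<open>
  The pairing is defined by splitting off the first letter; associativity allows a word to be split anywhere.
\<close>
lemma word_fun_append: "word_fun (v @ w) = star (word_fun v) (word_fun w)"
  by (induction v)
    (simp_all add: star_one respects_sl2_word_fun star_assoc finite_type_gen_fun finite_type_word_fun)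

lemma fnl_star:
  assumes "respects_sl2 \<phi>" "respects_sl2 \<psi>" "has_weights s t \<phi>"
  shows "fnl2 \<phi> \<psi> (coprod X) = fnl (star \<phi> \<psi>) X"
  by (simp add: fnl2_coprod[OF assms] star_weights[OF assms])

lemma word_pairing_fnl: "word_pairing w = fnl (word_fun w)"
proof (induction w)
  case Nil
  then show ?case by (simp add: counit_eq fun_eq_iff)
next
  case (Cons a w)
  have "word_pairing (a # w) X = fnl (word_fun (a # w)) X" for X
  proof -
    have "fnl2 (gen_fun a) (word_fun w) (coprod X) = fnl (star (gen_fun a) (word_fun w)) X"
      using weight_vec_gen_fun[of a] by (intro fnl_star respects_sl2_word_fun) (auto simp: weight_vec_def)
    then show ?thesis
      using weight_vec_gen_fun[of a]
      by (simp add: Cons.IH gen_pairing_fnl tens_fun_fnl respects_sl2_word_fun weight_vec_def)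
  qed
  then show ?case by (rule ext)
qed

definition free_fun :: "free_slh \<Rightarrow> complex fps wfun"
  where "free_fun = lin_ext wconst (\<lambda>w. word_fun (letters w))"

lemma free_fun_add: "free_fun (p + q) = free_fun p + free_fun q"
  unfolding free_fun_def by (rule lin_ext_add) (simp_all add: wconst_hom)

lemma free_fun_single: "free_fun (Poly_Mapping.single w c) = wconst c * word_fun (letters w)"
  unfolding free_fun_def by (rule lin_ext_single) (simp add: wconst_hom)

lemma free_fun_zero: "free_fun 0 = 0"
  using free_fun_add[of 0 0] by simp

lemma free_fun_diff: "free_fun (p - q) = free_fun p - free_fun q"
  using free_fun_add[of "p - q" q] by simp

lemma finite_type_free_fun: "finite_type (free_fun p)"
  by (induction p rule: poly_mapping_single_induct)
    (auto simp: free_fun_zero free_fun_add free_fun_single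
      intro: finite_type.intros finite_type_wconst finite_type_word_fun)

lemma free_fun_mult: "free_fun (p * q) = star (free_fun p) (free_fun q)"
proof (induction p rule: poly_mapping_single_induct)
  case (single v c)
  show ?case
    by (induction q rule: poly_mapping_single_induct)
      (simp_all add: free_fun_zero free_fun_add free_fun_single distrib_left mult_single star_zero
        star_linear word_fun_append wconst_hom mult.assoc)
qed (simp_all add: free_fun_zero star_zero distrib_right free_fun_add star_linear)

lemma free_fun_gen: "free_fun (gen a) = gen_fun a"
  using star_one(2)[OF weight_vec_gen_fun] by (simp add: gen_def free_fun_single wconst_hom)

lemma free_fun_scal: "free_fun (scal c) = wconst c"
  by (simp add: scal_def free_fun_single)

text \<open>
  All relators have degree at most two in the generators, so they are checked on the table of twisted
  products of two coordinate functions, using only that the classical determinant is 1.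
\<close>
lemma free_fun_relator:
  assumes "r \<in> slh_relators"
  shows "free_fun r = 0"
proof -
  define x u v y h where "x = gen_fun Gx" and "u = gen_fun Gu" and "v = gen_fun Gv"
    and "y = gen_fun Gy" and "h = wconst (fps_X :: complex fps)"
  have det: "x * y - u * v = 1" using gen_fun_det by (simp add: x_def y_def u_def v_def)
  have half: "wconst (fps_const (1 :: complex) * fps_X) = h" "wconst (fps_const (- 1 :: complex) * fps_X) = - h"
    by (simp_all add: h_def wconst_hom flip: fps_const_neg)
  note table = star_gen_fun[of Gx] star_gen_fun[of Gu] star_gen_fun[of Gv] star_gen_fun[of Gy]
  have st:
    "star x x = x * (x - h * v)" "star x v = x * v" "star v x = v * (x + h * v)" "star v v = v * v"
    "star u x = u * (x - h * v)" "star x u = x * (u - h * y + h * x - h * (h * v))"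
    "star v y = v * (y + h * v)" "star y v = y * v" "star u y = u * (y - h * v)"
    "star y u = y * (u + h * y - h * x - h * (h * v))" "star y y = y * (y - h * v)"
    "star x y = x * (y + h * v)" "star y x = y * (x + h * v)"
    "star v u = v * (u + h * y + h * x + h * (h * v))" "star u v = u * v"
    unfolding x_def u_def v_def y_def table
    by (simp_all add: lder_gen_fun rder_gen_fun half flip: h_def)
  have quad: "free_fun (gen a * gen b) = star (gen_fun a) (gen_fun b)" for a b
    by (simp add: free_fun_mult free_fun_gen)
  have one: "free_fun 1 = 1" using free_fun_scal[of 1] by (simp add: scal_1 wconst_hom)
  have scal: "free_fun (scal c * p) = wconst c * free_fun p" for c p
    by (simp add: free_fun_mult free_fun_scal star_wconst finite_type_respects[OF finite_type_free_fun])
  show ?thesis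
    using assms
    by (auto simp: slh_relators_def Let_def commutator_def power2_eq_square mult.assoc free_fun_diff
        free_fun_add scal quad one simp flip: h_def x_def u_def v_def y_def)
      (use det in \<open>simp_all add: st algebra_simps\<close>)
qed

text \<open>
  Associativity is what lets a relator be evaluated inside a product of generators.
\<close>
lemma free_fun_ideal: "p \<in> two_sided_ideal slh_relators \<Longrightarrow> free_fun p = 0"
  by (induction rule: two_sided_ideal.induct)
    (simp_all add: free_fun_zero free_fun_add free_fun_mult free_fun_relator star_zero)

lift_definition slh_fun :: "slh \<Rightarrow> complex fps wfun" is free_fun
proof -
  fix p q :: free_slh
  assume "ideal_cong slh_relators p q"
  then have "free_fun (p - q) = 0" unfolding ideal_cong_def by (rule free_fun_ideal)
  then show "free_fun p = free_fun q" by (simp add: free_fun_diff)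
qed

lemma slh_fun_hom:
  "slh_fun (a + b) = slh_fun a + slh_fun b" "slh_fun (a * b) = star (slh_fun a) (slh_fun b)"
  "slh_fun (slh_scal c) = wconst c" "slh_fun 0 = 0"
  by (transfer, simp add: free_fun_add) (transfer, simp add: free_fun_mult, simp add: slh_scal_def slh_fun.abs_eq free_fun_scal, transfer, simp add: free_fun_zero)

lemma finite_type_slh_fun: "finite_type (slh_fun a)"
  by transfer (rule finite_type_free_fun)

lemma slh_fun_rep: "free_fun (rep_slh a) = slh_fun a"
  by (simp add: slh_fun.rep_eq)

lemma fnl_linear:
  "fnl (\<phi> + \<psi>) X = fnl \<phi> X + fnl \<psi> X" "fnl (wconst c * \<phi>) X = c * fnl \<phi> X" "fnl 0 X = 0"
proof -
  have "usl_eval (\<phi> + \<psi>) u = usl_eval \<phi> u + usl_eval \<psi> u" "usl_eval (wconst c * \<phi>) u = c * usl_eval \<phi> u"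
    "usl_eval 0 u = 0" for u
    by (simp_all add: usl_eval_def lin_ext_def on_word_def distrib_left sum.distrib sum_distrib_left mult.left_commute)
  then show "fnl (\<phi> + \<psi>) X = fnl \<phi> X + fnl \<psi> X" "fnl (wconst c * \<phi>) X = c * fnl \<phi> X" "fnl 0 X = 0"
    by (simp_all add: fnl_def hsum_add hsum_mult_left hsum_zero)
qed

lemma pairing_fnl: "pairing a X = fnl (slh_fun a) X"
proof -
  have "fnl (\<Sum>w\<in>S. wconst (c w) * \<phi> w) X = (\<Sum>w\<in>S. c w * fnl (\<phi> w) X)" for S and c :: "slh_gen gword \<Rightarrow> _" and \<phi>
    by (induction S rule: infinite_finite_induct) (simp_all add: fnl_linear)
  then show ?thesis
    by (simp add: pairing_def lin_ext_def word_pairing_fnl free_fun_def flip: slh_fun_rep)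
qed

section \<open>A spanning set of the quantum group\<close>

lemma slh_scal_hom:
  "slh_scal 0 = 0" "slh_scal 1 = 1" "slh_scal (a + b) = slh_scal a + slh_scal b"
  "slh_scal (a * b) = slh_scal a * slh_scal b"
  by (simp_all add: slh_scal_def scal_0 scal_1 scal_add scal_mult zero_slh.abs_eq
      one_slh.abs_eq plus_slh.abs_eq times_slh.abs_eq)

lemma slh_cases: obtains p where "a = abs_slh p"
  by (metis Quotient3_abs_rep[OF Quotient3_slh])

lemma slh_scal_central: "slh_scal c * a = a * slh_scal c"
proof -
  have "scal c * p = p * scal c" for p :: free_slh
    by (induction p rule: poly_mapping_single_induct)
      (simp_all add: distrib_left distrib_right scal_def mult_single mult.commute)
  then show ?thesis
    by (cases a rule: slh_cases) (simp add: slh_scal_def times_slh.abs_eq)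
qed

lemma slh_scal_left_commute: "a * (slh_scal c * b) = slh_scal c * (a * b)"
  by (simp only: slh_scal_central[of c a] flip: mult.assoc)

definition slh_word :: "slh_gen list \<Rightarrow> slh"
  where "slh_word w = abs_slh (Poly_Mapping.single (GWord w) 1)"

lemma slh_word_append: "slh_word (v @ w) = slh_word v * slh_word w"
  by (simp add: slh_word_def times_slh.abs_eq mult_single plus_gword_def)

lemma slh_word_Nil: "slh_word [] = 1"
  by (simp add: slh_word_def one_slh.abs_eq flip: zero_gword_def)

lemma abs_slh_single: "abs_slh (Poly_Mapping.single w c) = slh_scal c * slh_word (letters w)"
  by (simp add: slh_scal_def slh_word_def scal_def times_slh.abs_eq mult_single)

text \<open>
  Rewriting of two adjacent letters.  Every rule lowers, in lexicographic order, the weight counting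
  \<open>u\<close> twice, \<open>x\<close> and \<open>y\<close> once and \<open>v\<close> not at all, then the number of letters \<open>x\<close> and \<open>y\<close>, then the
  number of inversions with respect to \<open>x, y < u < v\<close>.  The rules for \<open>xy\<close> and \<open>yx\<close> eliminate these
  products by means of \<open>D = 1\<close>.
\<close>

fun rewrite_pair :: "slh_gen \<Rightarrow> slh_gen \<Rightarrow> (complex fps \<times> slh_gen list) list"
  where
    "rewrite_pair Gv Gx = [(1, [Gx, Gv]), (fps_X, [Gv, Gv])]"
  | "rewrite_pair Gu Gx = [(1, [Gx, Gu]), (fps_X, []), (- fps_X, [Gx, Gx])]"
  | "rewrite_pair Gv Gy = [(1, [Gy, Gv]), (fps_X, [Gv, Gv])]"
  | "rewrite_pair Gu Gy = [(1, [Gy, Gu]), (fps_X, []), (- fps_X, [Gy, Gy])]"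
  | "rewrite_pair Gv Gu = [(1, [Gu, Gv]), (fps_X, [Gx, Gv]), (fps_X, [Gv, Gy])]"
  | "rewrite_pair Gx Gy = [(1, []), (1, [Gu, Gv]), (fps_X, [Gx, Gv])]"
  | "rewrite_pair Gy Gx = [(1, []), (1, [Gu, Gv]), (fps_X, [Gy, Gv])]"
  | "rewrite_pair a b = []"

lemma slh_word_rewrite_pair:
  assumes "rewrite_pair a b \<noteq> []"
  shows "slh_word [a, b] = (\<Sum>(c, w)\<leftarrow>rewrite_pair a b. slh_scal c * slh_word w)"
proof -
  have rel: "\<forall>r\<in>slh_relators. abs_slh r = 0"
    using two_sided_ideal.gener[of _ slh_relators 1 1]
    by (auto simp: zero_slh.abs_eq slh.abs_eq_iff ideal_cong_def)
  define x u v y h where "x = slh_word [Gx]" and "u = slh_word [Gu]" and "v = slh_word [Gv]"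
    and "y = slh_word [Gy]" and "h = slh_scal fps_X"
  have gens: "abs_slh (gen Gx) = x" "abs_slh (gen Gu) = u" "abs_slh (gen Gv) = v" "abs_slh (gen Gy) = y"
    "abs_slh (scal fps_X) = h"
    by (simp_all add: x_def u_def v_def y_def h_def gen_def slh_word_def slh_scal_def)
  have D: "x * y - u * v - h * x * v = 1"
    and r: "v * x - x * v = h * (v * v)"
    "u * x - x * u = h * (x * y - u * v - h * x * v - x * x)"
    "v * y - y * v = h * (v * v)"
    "u * y - y * u = h * (x * y - u * v - h * x * v - y * y)"
    "x * y - y * x = h * (x * v - y * v)"
    "v * u - u * v = h * (x * v + v * y)"
    using rel unfolding slh_relators_def Let_def commutator_def power2_eq_square ball_simps
    by (simp_all add: minus_slh.abs_eq[symmetric] times_slh.abs_eq[symmetric] plus_slh.abs_eq[symmetric]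
        one_slh.abs_eq[symmetric] gens del: diff_diff_eq)
  have xy: "x * y = 1 + u * v + h * (x * v)" using D by (simp add: algebra_simps)
  have eqs: "v * x = x * v + h * (v * v)" "u * x = x * u + h - h * (x * x)"
    "v * y = y * v + h * (v * v)" "u * y = y * u + h - h * (y * y)"
    "v * u = u * v + h * (x * v) + h * (v * y)" "y * x = 1 + u * v + h * (y * v)"
  proof -
    show "v * x = x * v + h * (v * v)" "v * y = y * v + h * (v * v)"
      "v * u = u * v + h * (x * v) + h * (v * y)"
      using r(1,3,6) by (simp_all add: diff_eq_eq distrib_left add_ac)
    show "u * x = x * u + h - h * (x * x)" "u * y = y * u + h - h * (y * y)"
      using r(2,4) unfolding D by (simp_all add: diff_eq_eq right_diff_distrib add_ac)
    have "y * x = x * y - h * (x * v - y * v)" using r(5) by (simp add: algebra_simps)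
    then show "y * x = 1 + u * v + h * (y * v)" by (simp add: xy right_diff_distrib)
  qed
  have s: "slh_word [Gx] = x" "slh_word [Gu] = u" "slh_word [Gv] = v" "slh_word [Gy] = y" "slh_scal fps_X = h"
    "slh_scal (- fps_X) = - h"
    using slh_scal_hom(3)[of "fps_X" "- fps_X"]
    by (simp_all add: x_def u_def v_def y_def h_def slh_scal_hom eq_neg_iff_add_eq_0 add.commute)
  have w2: "slh_word [a, b] = slh_word [a] * slh_word [b]" for a b
    using slh_word_append[of "[a]" "[b]"] by simp
  show ?thesis
    using assms xy eqs
    by (cases a; cases b) (simp_all add: w2 s slh_scal_hom(2) slh_word_Nil add.assoc)
qed

fun letter_weight :: "slh_gen \<Rightarrow> nat"
  where "letter_weight Gu = 2" | "letter_weight Gx = 1" | "letter_weight Gy = 1" | "letter_weight Gv = 0"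

fun letter_rank :: "slh_gen \<Rightarrow> nat"
  where "letter_rank Gx = 0" | "letter_rank Gy = 0" | "letter_rank Gu = 1" | "letter_rank Gv = 2"

fun inversions :: "slh_gen list \<Rightarrow> nat"
  where
    "inversions [] = 0"
  | "inversions (a # w) = length (filter (\<lambda>b. letter_rank b < letter_rank a) w) + inversions w"

definition word_order :: "(slh_gen list \<times> slh_gen list) set"
  where "word_order = measures [\<lambda>w. sum_list (map letter_weight w),
    \<lambda>w. length (filter (\<lambda>a. letter_rank a = 0) w), inversions]"

lemma wf_word_order: "wf word_order"
  by (simp add: word_order_def)

lemma inversions_swap:
  "letter_rank b < letter_rank a \<Longrightarrow> inversions (p @ b # a # q) < inversions (p @ a # b # q)"
  by (induction p) auto

lemma rewrite_pair_decreases: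
  "(c, w) \<in> set (rewrite_pair a b) \<Longrightarrow> (p @ w @ q, p @ [a, b] @ q) \<in> word_order"
  by (cases a; cases b) (auto simp: word_order_def inversions_swap)

text \<open>The irreducible words are \<open>x ^ a u ^ b v ^ c\<close> and, for negative first index, \<open>y ^ (- a) u ^ b v ^ c\<close>.\<close>

definition normal_word :: "int \<times> nat \<times> nat \<Rightarrow> slh_gen list"
  where "normal_word = (\<lambda>(a, b, c).
    replicate (nat a) Gx @ replicate (nat (- a)) Gy @ replicate b Gu @ replicate c Gv)"

lemma irreducible_normal_word:
  "(\<nexists>p a b q. w = p @ [a, b] @ q \<and> rewrite_pair a b \<noteq> []) \<Longrightarrow> \<exists>i. w = normal_word i"
proof (induction w)
  case Nil
  then show ?case by (intro exI[of _ "(0, 0, 0)"]) (simp add: normal_word_def)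
next
  case (Cons a w)
  have "\<nexists>p a b q. w = p @ [a, b] @ q \<and> rewrite_pair a b \<noteq> []"
    using Cons.prems by (metis append_Cons)
  then obtain k b c where w: "w = normal_word (k, b, c)" using Cons.IH by (metis prod_cases3)
  have head: "rewrite_pair a d = []" if "w = d # q" for d q
    using Cons.prems that by (metis append_Cons append_Nil)
  show ?case
  proof (cases "k = 0")
    case False
    show ?thesis
    proof (cases "k > 0")
      case True
      then obtain q where "w = Gx # q" by (cases "nat k") (auto simp: w normal_word_def)
      then have "a = Gx" using head[of Gx q] by (cases a) auto
      then have "a # w = normal_word (k + 1, b, c)"
        using True by (simp add: w normal_word_def nat_add_distrib)
      then show ?thesis ..
    next
      case neg: False
      then obtain q where "w = Gy # q" using False by (cases "nat (- k)") (auto simp: w normal_word_def)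
      then have "a = Gy" using head[of Gy q] by (cases a) auto
      moreover have "nat (- (k - 1)) = Suc (nat (- k))" using neg by simp
      ultimately have "a # w = normal_word (k - 1, b, c)"
        using neg False by (simp add: w normal_word_def)
      then show ?thesis ..
    qed
  next
    case k: True
    show ?thesis
    proof (cases a)
      case Gx
      then show ?thesis using k by (intro exI[of _ "(1, b, c)"]) (simp add: w normal_word_def)
    next
      case Gy
      then show ?thesis using k by (intro exI[of _ "(- 1, b, c)"]) (simp add: w normal_word_def)
    next
      case Gu
      then show ?thesis using k by (intro exI[of _ "(0, Suc b, c)"]) (simp add: w normal_word_def)
    next
      case Gv
      then have "b = 0" using head[of Gu] k by (cases b) (auto simp: w normal_word_def)
      then show ?thesis using k Gv by (intro exI[of _ "(0, 0, Suc c)"]) (simp add: w normal_word_def)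
    qed
  qed
qed

definition normal_comb :: "(int \<times> nat \<times> nat \<Rightarrow>\<^sub>0 complex fps) \<Rightarrow> slh"
  where "normal_comb = lin_ext slh_scal (\<lambda>i. slh_word (normal_word i))"

lemma normal_comb_add: "normal_comb (p + q) = normal_comb p + normal_comb q"
  unfolding normal_comb_def by (rule lin_ext_add) (simp_all add: slh_scal_hom)

lemma normal_comb_zero: "normal_comb 0 = 0"
  using normal_comb_add[of 0 0] by simp

lemma normal_comb_single: "normal_comb (Poly_Mapping.single i c) = slh_scal c * slh_word (normal_word i)"
  unfolding normal_comb_def by (rule lin_ext_single) (simp add: slh_scal_hom)

lemma normal_comb_scal: "\<exists>q. slh_scal c * normal_comb p = normal_comb q"
proof (induction p rule: poly_mapping_single_induct)
  case zero
  show ?case by (intro exI[of _ 0]) (simp add: normal_comb_zero)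
next
  case (single k d)
  then show ?case
    by (intro exI[of _ "Poly_Mapping.single k (c * d)"])
      (simp add: normal_comb_single slh_scal_hom mult.assoc)
next
  case (add p q)
  then show ?case by (metis normal_comb_add distrib_left)
qed

lemma slh_word_normal_comb: "\<exists>p. slh_word w = normal_comb p"
proof (induction w rule: wf_induct_rule[OF wf_word_order])
  case (1 w)
  show ?case
  proof (cases "\<exists>p a b q. w = p @ [a, b] @ q \<and> rewrite_pair a b \<noteq> []")
    case True
    then obtain p a b q where w: "w = p @ [a, b] @ q" and r: "rewrite_pair a b \<noteq> []" by auto
    have sum: "\<exists>r. (\<Sum>(c, w')\<leftarrow>l. slh_scal c * slh_word (p @ w' @ q)) = normal_comb r"
      if "set l \<subseteq> set (rewrite_pair a b)" for l
      using that
    proof (induction l)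
      case Nil
      show ?case by (intro exI[of _ 0]) (simp add: normal_comb_zero)
    next
      case (Cons cw l)
      obtain c w' where cw: "cw = (c, w')" by (cases cw)
      then have "(p @ w' @ q, w) \<in> word_order"
        unfolding w using Cons.prems by (intro rewrite_pair_decreases) auto
      then obtain r1 where "slh_word (p @ w' @ q) = normal_comb r1" using 1 by blast
      then obtain r2 where "slh_scal c * slh_word (p @ w' @ q) = normal_comb r2"
        using normal_comb_scal by metis
      then show ?case using Cons by (auto simp: cw) (metis normal_comb_add)
    qed
    have "slh_word w = slh_word p * (\<Sum>(c, w')\<leftarrow>rewrite_pair a b. slh_scal c * slh_word w') * slh_word q"
      by (simp only: w slh_word_append slh_word_rewrite_pair[OF r] mult.assoc)
    also have "\<dots> = (\<Sum>(c, w')\<leftarrow>rewrite_pair a b. slh_scal c * slh_word (p @ w' @ q))"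
      by (simp add: case_prod_unfold sum_list_const_mult[symmetric] sum_list_mult_const[symmetric]
          slh_word_append slh_scal_left_commute mult.assoc)
    finally show ?thesis using sum by auto
  next
    case False
    then obtain i where "w = normal_word i" using irreducible_normal_word by blast
    then have "slh_word w = normal_comb (Poly_Mapping.single i 1)"
      by (simp add: normal_comb_single slh_scal_hom)
    then show ?thesis ..
  qed
qed

lemma slh_normal_comb: "\<exists>p. a = normal_comb p"
proof -
  obtain q where a: "a = abs_slh q" by (rule slh_cases)
  have "\<exists>p. abs_slh q = normal_comb p"
  proof (induction q rule: poly_mapping_single_induct)
    case zero
    show ?case by (metis normal_comb_zero zero_slh.abs_eq)
  next
    case (single k c)
    show ?case
      unfolding abs_slh_single using slh_word_normal_comb normal_comb_scal by metis
  next
    case (add p q)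
    then show ?case by (metis normal_comb_add plus_slh.abs_eq)
  qed
  then show ?thesis by (simp add: a)
qed

section \<open>Linear independence at h = 0\<close>

definition at_zero :: "complex fps wfun \<Rightarrow> complex wfun"
  where "at_zero \<phi> = Wfun (\<lambda>w. fps_nth (val \<phi> w) 0)"

lemma val_at_zero [simp]: "val (at_zero \<phi>) w = fps_nth (val \<phi> w) 0"
  by (simp add: at_zero_def)

lemma at_zero_hom:
  "at_zero (\<phi> + \<psi>) = at_zero \<phi> + at_zero \<psi>" "at_zero (\<phi> * \<psi>) = at_zero \<phi> * at_zero \<psi>"
  "at_zero 1 = 1" "at_zero 0 = 0" "at_zero (wconst c) = wconst (fps_nth c 0)"
proof -
  have "fps_nth (shuffle_prod w f g) 0 = shuffle_prod w (\<lambda>v. fps_nth (f v) 0) (\<lambda>v. fps_nth (g v) 0)" for w f g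
    by (induction w arbitrary: f g) simp_all
  moreover have "val (at_zero \<theta>) = (\<lambda>v. fps_nth (val \<theta> v) 0)" for \<theta> by (rule ext) simp
  ultimately show "at_zero (\<phi> * \<psi>) = at_zero \<phi> * at_zero \<psi>"
    by (intro wfun_eqI) (simp add: val_times)
qed (rule wfun_eqI; simp add: val_one val_wconst)+

lemma at_zero_sum: "at_zero (\<Sum>i\<in>I. \<phi> i) = (\<Sum>i\<in>I. at_zero (\<phi> i))"
  by (induction I rule: infinite_finite_induct) (simp_all add: at_zero_hom)

lemma at_zero_lder: "at_zero (lder g \<phi>) = lder g (at_zero \<phi>)" "at_zero (rder g \<phi>) = rder g (at_zero \<phi>)"
  by (rule wfun_eqI, simp)+

lemma at_zero_lact: "fps_nth F 0 = 1 \<Longrightarrow> at_zero (lact F \<phi>) = at_zero \<phi>"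
  "fps_nth F 0 = 1 \<Longrightarrow> at_zero (ract F \<phi>) = at_zero \<phi>"
  by (rule wfun_eqI, simp add: val_lact val_ract hsum_nth)+

abbreviation gen_fun0 :: "slh_gen \<Rightarrow> complex wfun"
  where "gen_fun0 a \<equiv> at_zero (gen_fun a)"

lemma at_zero_word_fun: "at_zero (word_fun w) = prod_list (map (\<lambda>a. gen_fun0 a) w)"
proof (induction w)
  case (Cons a w)
  have "star (gen_fun a) (word_fun w) = gen_fun a * lpow (of_real (left_weight a))
      (rpow (- of_real (right_weight a)) (word_fun w))"
    using weight_vec_gen_fun[of a] by (intro star_weights) (auto simp: weight_vec_def respects_sl2_word_fun)
  then show ?case by (simp add: at_zero_hom at_zero_lact Cons)
qed (simp add: at_zero_hom)

lemma map_fps_hom: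
  fixes f :: "'a::ring_1 \<Rightarrow> 'b::ring_1"
  assumes "\<And>a b. f (a + b) = f a + f b" "\<And>a b. f (a * b) = f a * f b"
  shows "map_fps f (F + G) = map_fps f F + map_fps f G" "map_fps f (F * G) = map_fps f F * map_fps f G"
proof -
  have z: "f 0 = 0" using assms(1)[of 0 0] by simp
  have "f (\<Sum>i\<in>I. g i) = (\<Sum>i\<in>I. f (g i))" for I and g :: "nat \<Rightarrow> 'a"
    by (induction I rule: infinite_finite_induct) (simp_all add: assms z)
  then show "map_fps f (F * G) = map_fps f F * map_fps f G"
    by (simp add: fps_eq_iff map_fps_def fps_mult_nth assms)
qed (simp add: fps_eq_iff map_fps_def assms)

text \<open>The one-parameter group of automorphisms generated by a derivation.\<close>

definition exp_lder :: "sl2_gen \<Rightarrow> complex wfun \<Rightarrow> complex wfun fps"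
  where "exp_lder g \<phi> = Abs_fps (\<lambda>n. wconst (1 / fact n) * (lder g ^^ n) \<phi>)"

lemma exp_lder_nth: "fps_nth (exp_lder g \<phi>) n = wconst (1 / fact n) * (lder g ^^ n) \<phi>"
  by (simp add: exp_lder_def)

lemma exp_lder_hom:
  "exp_lder g (\<phi> + \<psi>) = exp_lder g \<phi> + exp_lder g \<psi>" "exp_lder g (\<phi> * \<psi>) = exp_lder g \<phi> * exp_lder g \<psi>"
proof -
  show "exp_lder g (\<phi> + \<psi>) = exp_lder g \<phi> + exp_lder g \<psi>"
    by (simp add: fps_eq_iff exp_lder_nth lder_funpow_linear distrib_left)
  have nat: "of_nat m = (wconst (of_nat m) :: complex wfun)" for m
    by (induction m) (simp_all add: wconst_hom)
  have c: "wconst (1 / fact n) * (of_nat (n choose i) * (a * b))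
      = wconst (1 / fact i) * a * (wconst (1 / fact (n - i)) * b)" if "i \<le> n" for n i and a b :: "complex wfun"
  proof -
    have "1 / fact n * of_nat (n choose i) = (1 / fact i * (1 / fact (n - i)) :: complex)"
      using binomial_fact[OF that, where 'a = complex] by simp
    then have eq: "wconst (1 / fact n) * wconst (of_nat (n choose i))
        = wconst (1 / fact i) * (wconst (1 / fact (n - i)) :: complex wfun)"
      by (simp flip: wconst_hom(4))
    have "wconst (1 / fact n) * (of_nat (n choose i) * (a * b))
        = (wconst (1 / fact n) * wconst (of_nat (n choose i))) * (a * b)"
      by (simp only: nat mult.assoc)
    then show ?thesis unfolding eq by (simp only: mult_ac)
  qed
  show "exp_lder g (\<phi> * \<psi>) = exp_lder g \<phi> * exp_lder g \<psi>"
    unfolding fps_eq_iff exp_lder_nth fps_mult_nth lder_funpow_mult sum_distrib_left atLeast0AtMost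
    by (intro allI sum.cong refl c) simp
qed

text \<open>
  Evaluation at the generic product \<open>exp (p J_-) exp (q J_+)\<close>, where \<open>p\<close> is the variable of the outer
  and \<open>q\<close> that of the inner power series.  In matrix form this element has rows \<open>(1, q)\<close> and
  \<open>(p, 1 + p q)\<close>.
\<close>

definition plus_point :: "complex wfun \<Rightarrow> complex fps"
  where "plus_point \<phi> = map_fps (\<lambda>\<psi>. val \<psi> []) (exp_lder Gplus \<phi>)"

definition generic_point :: "complex wfun \<Rightarrow> complex fps fps"
  where "generic_point \<phi> = map_fps plus_point (exp_lder Gminus \<phi>)"

lemma plus_point_hom:
  "plus_point (\<phi> + \<psi>) = plus_point \<phi> + plus_point \<psi>"
  "plus_point (\<phi> * \<psi>) = plus_point \<phi> * plus_point \<psi>"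
  unfolding plus_point_def exp_lder_hom
  by (rule map_fps_hom(1), simp, simp, rule map_fps_hom(2), simp, simp)

lemma generic_point_hom:
  "generic_point (\<phi> + \<psi>) = generic_point \<phi> + generic_point \<psi>"
  "generic_point (\<phi> * \<psi>) = generic_point \<phi> * generic_point \<psi>"
  unfolding generic_point_def exp_lder_hom
  by (rule map_fps_hom(1), rule plus_point_hom(1), rule plus_point_hom(2),
      rule map_fps_hom(2), rule plus_point_hom(1), rule plus_point_hom(2))

lemma generic_point_nth:
  "fps_nth (fps_nth (generic_point \<phi>) m) n
    = 1 / fact m * (1 / fact n) * val \<phi> (replicate m Gminus @ replicate n Gplus)"
  by (simp add: generic_point_def plus_point_def map_fps_def exp_lder_nth val_lder_funpow val_wconst)

lemma generic_point_wconst: "generic_point (wconst c) = fps_const (fps_const c)"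
  by (simp add: fps_eq_iff generic_point_nth val_wconst)

lemma generic_point_power: "generic_point (\<phi> ^ n) = generic_point \<phi> ^ n"
  using generic_point_wconst[of 1] by (induction n) (simp_all add: wconst_hom generic_point_hom)

lemma generic_point_sum: "generic_point (\<Sum>i\<in>I. \<phi> i) = (\<Sum>i\<in>I. generic_point (\<phi> i))"
  using generic_point_wconst[of 0]
  by (induction I rule: infinite_finite_induct) (simp_all add: wconst_hom generic_point_hom)

lemma generic_point_gen_fun0:
  "generic_point (gen_fun0 Gx) = 1" "generic_point (gen_fun0 Gu) = fps_const fps_X"
  "generic_point (gen_fun0 Gv) = fps_X" "generic_point (gen_fun0 Gy) = 1 + fps_const fps_X * fps_X"
proof -
  have step: "val (gen_fun0 a) (g # w) = val (at_zero (lder g (gen_fun a))) w" for a g w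
    by simp
  have rules:
    "val (gen_fun0 Gx) (Gminus # w) = 0" "val (gen_fun0 Gx) (Gplus # w) = val (gen_fun0 Gv) w"
    "val (gen_fun0 Gu) (Gminus # w) = 0" "val (gen_fun0 Gu) (Gplus # w) = val (gen_fun0 Gy) w"
    "val (gen_fun0 Gv) (Gminus # w) = val (gen_fun0 Gx) w" "val (gen_fun0 Gv) (Gplus # w) = 0"
    "val (gen_fun0 Gy) (Gminus # w) = val (gen_fun0 Gu) w" "val (gen_fun0 Gy) (Gplus # w) = 0"
    "val (gen_fun0 Gx) [] = 1" "val (gen_fun0 Gu) [] = 0" "val (gen_fun0 Gv) [] = 0"
    "val (gen_fun0 Gy) [] = 1" for w
    unfolding step lder_gen_fun by (simp_all add: val_gen_fun_Nil)
  have eval: "val (gen_fun0 a) (replicate m Gminus @ replicate n Gplus)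
     = (case a of Gx \<Rightarrow> of_bool (m = 0 \<and> n = 0) | Gu \<Rightarrow> of_bool (m = 0 \<and> n = 1)
        | Gv \<Rightarrow> of_bool (m = 1 \<and> n = 0) | Gy \<Rightarrow> of_bool (m = 0 \<and> n = 0) + of_bool (m = 1 \<and> n = 1))" for a m n
  proof -
    have "m = 0 \<or> m = 1 \<or> (\<exists>m'. m = Suc (Suc m'))" "n = 0 \<or> n = 1 \<or> (\<exists>n'. n = Suc (Suc n'))"
      by (metis One_nat_def not0_implies_Suc)+
    then show ?thesis
      by (cases a) (auto simp: rules simp del: val_at_zero)
  qed
  show "generic_point (gen_fun0 Gx) = 1" "generic_point (gen_fun0 Gu) = fps_const fps_X"
    "generic_point (gen_fun0 Gv) = fps_X" "generic_point (gen_fun0 Gy) = 1 + fps_const fps_X * fps_X"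
    by (simp_all add: fps_eq_iff generic_point_nth eval fps_one_nth del: val_at_zero) (auto simp: le_Suc_eq)
qed

definition normal_mono :: "int \<Rightarrow> nat \<Rightarrow> nat \<Rightarrow> complex wfun"
  where "normal_mono a b c
    = gen_fun0 Gx ^ nat a * gen_fun0 Gy ^ nat (- a) * gen_fun0 Gu ^ b * gen_fun0 Gv ^ c"

lemma at_zero_normal_word: "at_zero (word_fun (normal_word (a, b, c))) = normal_mono a b c"
  by (simp add: at_zero_word_fun normal_word_def normal_mono_def prod_list_replicate mult.assoc)

text \<open>
  The usual argument: applying \<open>T - \<mu> b\<close> removes the summand \<open>f b\<close> and rescales the others by nonzero factors.
\<close>
lemma eigenvector_separation:
  fixes T :: "complex wfun \<Rightarrow> complex wfun"
  assumes "finite A" "\<And>\<phi> \<psi>. T (\<phi> + \<psi>) = T \<phi> + T \<psi>" "\<And>c \<phi>. T (wconst c * \<phi>) = wconst c * T \<phi>"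
    and "\<And>a. a \<in> A \<Longrightarrow> T (f a) = wconst (\<mu> a) * f a" "inj_on \<mu> A" "(\<Sum>a\<in>A. f a) = 0" "a \<in> A"
  shows "f a = 0"
  using assms(1,4-)
proof (induction A arbitrary: f a rule: finite_induct)
  case (insert b A)
  have T0: "T 0 = 0" using assms(2)[of 0 0] by simp
  have Tsum: "T (\<Sum>a\<in>I. g a) = (\<Sum>a\<in>I. T (g a))" for I g
    by (induction I rule: infinite_finite_induct) (simp_all add: assms(2) T0)
  have "(\<Sum>a\<in>insert b A. wconst (\<mu> a) * f a) = T (\<Sum>a\<in>insert b A. f a)"
    unfolding Tsum using insert.prems(1) by simp
  then have "(\<Sum>a\<in>insert b A. wconst (\<mu> a) * f a) - wconst (\<mu> b) * (\<Sum>a\<in>insert b A. f a) = 0"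
    using insert.prems(3) T0 by simp
  then have "(\<Sum>a\<in>insert b A. wconst (\<mu> a - \<mu> b) * f a) = 0"
    by (simp only: sum_distrib_left sum_subtractf[symmetric] wconst_hom(6) left_diff_distrib)
  then have sum0: "(\<Sum>a\<in>A. wconst (\<mu> a - \<mu> b) * f a) = 0"
    using insert.hyps by (simp add: wconst_hom(1))
  have A: "f a = 0" if "a \<in> A" for a
  proof -
    have "wconst (\<mu> a - \<mu> b) * f a = 0"
    proof (rule insert.IH[where f = "\<lambda>a. wconst (\<mu> a - \<mu> b) * f a"])
      show "T (wconst (\<mu> a - \<mu> b) * f a) = wconst (\<mu> a) * (wconst (\<mu> a - \<mu> b) * f a)" if "a \<in> A" for a
        using that insert.prems(1)[of a] by (simp add: assms(3) mult.left_commute)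
    qed (use insert.prems that sum0 in auto)
    then have "(\<mu> a - \<mu> b) * val (f a) w = 0" for w
      by (metis val_arith(1) val_wconst_times)
    moreover have "\<mu> a \<noteq> \<mu> b"
      using insert.prems(2) insert.hyps that by (auto simp: inj_on_def)
    ultimately show ?thesis by (intro wfun_eqI) simp
  qed
  moreover from A have "f b = 0" using insert.prems(3) insert.hyps by simp
  ultimately show ?case using insert.prems(4) by auto
qed simp

text \<open>
  The sum of the two weights counts letters \<open>x\<close> minus letters \<open>y\<close>, that is, it recovers the first index.
\<close>
lemma normal_mono_eigenvector:
  "lder Gzero (normal_mono a b c) + rder Gzero (normal_mono a b c) = wconst (of_int (2 * a)) * normal_mono a b c"
proof -
  define T where "T = (\<lambda>\<phi> :: complex wfun. lder Gzero \<phi> + rder Gzero \<phi>)"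
  have prod: "T (\<phi> * \<psi>) = wconst (k + l) * (\<phi> * \<psi>)" if "T \<phi> = wconst k * \<phi>" "T \<psi> = wconst l * \<psi>" for \<phi> \<psi> k l
  proof -
    have "T (\<phi> * \<psi>) = T \<phi> * \<psi> + \<phi> * T \<psi>"
      by (simp add: T_def lder_mult rder_mult algebra_simps)
    then show ?thesis by (simp only: that wconst_hom(3)) (simp only: distrib_left distrib_right mult_ac)
  qed
  have one: "T 1 = wconst 0 * 1" by (simp add: T_def wconst_hom)
  have pow: "T (\<phi> ^ n) = wconst (of_nat n * k) * \<phi> ^ n" if "T \<phi> = wconst k * \<phi>" for \<phi> n k
  proof (induction n)
    case (Suc n)
    from prod[OF that Suc] show ?case by (simp add: algebra_simps)
  qed (use one in simp)
  have gens: "T (gen_fun0 a) = wconst (of_real (left_weight a + right_weight a)) * gen_fun0 a * 1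
      + wconst (of_real (left_weight a + right_weight a)) * gen_fun0 a * 1" for a
  proof -
    have "lder Gzero (gen_fun a) = rconst (2 * left_weight a) * gen_fun a"
      "rder Gzero (gen_fun a) = rconst (2 * right_weight a) * gen_fun a"
      using weight_vec_gen_fun[of a] by (auto simp: weight_vec_def has_weights_def)
    then have "T (gen_fun0 a) = wconst (of_real (2 * left_weight a)) * gen_fun0 a
        + wconst (of_real (2 * right_weight a)) * gen_fun0 a"
      by (simp only: T_def at_zero_lder[symmetric] at_zero_hom fps_nth_fps_const) simp
    then show ?thesis
      by (cases a) (simp_all add: wconst_hom distrib_right[symmetric] flip: wconst_hom(3))
  qed
  have g: "T (gen_fun0 Gx) = wconst 2 * gen_fun0 Gx" "T (gen_fun0 Gy) = wconst (- 2) * gen_fun0 Gy"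
    "T (gen_fun0 Gu) = wconst 0 * gen_fun0 Gu" "T (gen_fun0 Gv) = wconst 0 * gen_fun0 Gv"
    unfolding gens by (simp_all add: wconst_hom(1) flip: distrib_right wconst_hom(3))
  have "T (normal_mono a b c) = wconst (of_nat (nat a) * 2 + of_nat (nat (- a)) * (- 2) + of_nat b * 0 + of_nat c * 0)
      * normal_mono a b c"
    unfolding normal_mono_def by (intro prod pow g)
  moreover have "of_nat (nat a) * 2 + of_nat (nat (- a)) * (- 2) + of_nat b * 0 + of_nat c * 0
      = (of_int (2 * a) :: complex)"
    by (cases "a \<ge> 0") (simp_all add: of_nat_nat)
  ultimately show ?thesis by (simp add: T_def)
qed

text \<open>
  The coordinate \<open>x\<close> equals 1 at the generic point, which therefore does not see the first index; the
  weights separate it first.  For fixed \<open>a\<close> what remains are the distinct monomials \<open>q ^ b p ^ c\<close>,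
  multiplied by a common power of \<open>1 + p q\<close>.
\<close>
lemma normal_mono_independent:
  assumes "finite A" "(\<Sum>a\<in>A. \<Sum>b\<le>N. \<Sum>c\<le>N. wconst (\<gamma> a b c) * normal_mono a b c) = 0"
    and "a \<in> A" "b \<le> N" "c \<le> N"
  shows "\<gamma> a b c = 0"
proof -
  let ?f = "\<lambda>a. \<Sum>b\<le>N. \<Sum>c\<le>N. wconst (\<gamma> a b c) * normal_mono a b c"
  let ?T = "\<lambda>\<phi> :: complex wfun. lder Gzero \<phi> + rder Gzero \<phi>"
  have "?f a = 0"
  proof (rule eigenvector_separation[where T = ?T and \<mu> = "\<lambda>a. of_int (2 * a)" and f = ?f])
    show "inj_on (\<lambda>a. of_int (2 * a) :: complex) A" by (simp add: inj_on_def)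
    have T: "?T (wconst k * normal_mono a b c) = wconst (of_int (2 * a)) * (wconst k * normal_mono a b c)" for a b c k
      using normal_mono_eigenvector[of a b c]
      by (simp only: lder_linear rder_linear distrib_left[symmetric]) (simp only: mult.left_commute)
    show "?T (?f a) = wconst (of_int (2 * a)) * ?f a" for a
      by (simp only: lder_sum rder_sum sum.distrib[symmetric] T sum_distrib_left)
    show "?T (\<phi> + \<psi>) = ?T \<phi> + ?T \<psi>" for \<phi> \<psi> by (simp only: lder_linear rder_linear add_ac)
    show "?T (wconst k * \<phi>) = wconst k * ?T \<phi>" for k \<phi> by (simp only: lder_linear rder_linear distrib_left)
  qed (use assms in simp_all)
  then have "generic_point (?f a) = 0"
    using generic_point_wconst[of 0] by (simp add: wconst_hom)
  moreover define B where "B = (1 + fps_const fps_X * fps_X :: complex fps fps) ^ nat (- a)"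
  have "generic_point (?f a)
      = B * (\<Sum>b\<le>N. \<Sum>c\<le>N. fps_const (fps_const (\<gamma> a b c)) * (fps_const fps_X ^ b * fps_X ^ c))"
    by (simp only: generic_point_sum generic_point_hom generic_point_wconst generic_point_power
        normal_mono_def generic_point_gen_fun0 B_def sum_distrib_left power_one mult_1_left)
      (simp only: mult_ac)
  moreover have "B \<noteq> 0"
  proof -
    have "fps_nth (1 + fps_const fps_X * fps_X :: complex fps fps) 0 = 1" by simp
    then have "(1 + fps_const fps_X * fps_X :: complex fps fps) \<noteq> 0" by (metis fps_zero_nth zero_neq_one)
    then show ?thesis by (simp add: B_def)
  qed
  ultimately have S0: "(\<Sum>b\<le>N. \<Sum>c\<le>N. fps_const (fps_const (\<gamma> a b c)) * (fps_const fps_X ^ b * fps_X ^ c)) = 0"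
    (is "?S = 0") by (simp only: mult_eq_0_iff) blast
  have nth: "fps_nth (fps_nth (fps_const (fps_const \<alpha>) * (fps_const fps_X ^ b' * fps_X ^ c')) c) b
      = (if c' = c then if b' = b then \<alpha> else 0 else 0)" for \<alpha> :: complex and b' c'
    by (simp add: fps_X_power_iff)
  have "fps_nth (fps_nth ?S c) b = (\<Sum>b'\<le>N. \<Sum>c'\<le>N. if c' = c then if b' = b then \<gamma> a b' c' else 0 else 0)"
    by (simp only: fps_sum_nth nth)
  also have "\<dots> = (\<Sum>b'\<le>N. if b' = b then \<gamma> a b' c else 0)"
    using assms(5) by (simp add: sum.delta)
  also have "\<dots> = \<gamma> a b c" using assms(4) by (simp add: sum.delta)
  finally show ?thesis by (simp only: S0 fps_zero_nth)
qed

text \<open>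
  The coefficients vanish modulo \<open>h\<close> by independence at \<open>h = 0\<close>; dividing by \<open>h\<close> they vanish modulo
  every power of \<open>h\<close>.
\<close>

lemma word_fun_independent:
  assumes "finite A" "(\<Sum>a\<in>A. \<Sum>b\<le>N. \<Sum>c\<le>N. wconst (\<gamma> a b c) * word_fun (normal_word (a, b, c))) = 0"
    and "a \<in> A" "b \<le> N" "c \<le> N"
  shows "fps_nth (\<gamma> a b c) n = 0"
  using assms(2)
proof (induction n arbitrary: \<gamma>)
  case 0
  have "(\<Sum>a\<in>A. \<Sum>b\<le>N. \<Sum>c\<le>N. wconst (fps_nth (\<gamma> a b c) 0) * normal_mono a b c)
      = at_zero (\<Sum>a\<in>A. \<Sum>b\<le>N. \<Sum>c\<le>N. wconst (\<gamma> a b c) * word_fun (normal_word (a, b, c)))"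
    by (simp only: at_zero_sum at_zero_hom at_zero_normal_word)
  also have "\<dots> = 0" by (simp only: 0 at_zero_hom)
  finally show ?case
    by (rule normal_mono_independent[where \<gamma> = "\<lambda>a b c. fps_nth (\<gamma> a b c) 0", OF assms(1) _ assms(3-5)])
next
  case (Suc n)
  have zero: "fps_nth (\<gamma> a b c) 0 = 0" if "a \<in> A" "b \<le> N" "c \<le> N" for a b c
  proof -
    have "(\<Sum>a\<in>A. \<Sum>b\<le>N. \<Sum>c\<le>N. wconst (fps_nth (\<gamma> a b c) 0) * normal_mono a b c)
        = at_zero (\<Sum>a\<in>A. \<Sum>b\<le>N. \<Sum>c\<le>N. wconst (\<gamma> a b c) * word_fun (normal_word (a, b, c)))"
      by (simp only: at_zero_sum at_zero_hom at_zero_normal_word)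
    also have "\<dots> = 0" by (simp only: Suc.prems at_zero_hom)
    finally show ?thesis by (rule normal_mono_independent[where \<gamma> = "\<lambda>a b c. fps_nth (\<gamma> a b c) 0", OF assms(1) _ that])
  qed
  define \<delta> where "\<delta> = (\<lambda>a b c. fps_shift 1 (\<gamma> a b c))"
  have div: "\<gamma> a b c = fps_X * \<delta> a b c" if "a \<in> A" "b \<le> N" "c \<le> N" for a b c
    using zero[OF that] by (simp add: \<delta>_def fps_eq_iff)
  let ?S = "\<Sum>a\<in>A. \<Sum>b\<le>N. \<Sum>c\<le>N. wconst (\<delta> a b c) * word_fun (normal_word (a, b, c))"
  have "wconst fps_X * ?S = (\<Sum>a\<in>A. \<Sum>b\<le>N. \<Sum>c\<le>N. wconst (\<gamma> a b c) * word_fun (normal_word (a, b, c)))"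
    unfolding sum_distrib_left by (intro sum.cong refl) (simp add: div wconst_hom mult.assoc)
  then have S: "wconst fps_X * ?S = 0" by (simp only: Suc.prems)
  have "?S = 0"
  proof (rule wfun_eqI)
    fix w
    have "fps_X * val ?S w = val (wconst fps_X * ?S) w" by (simp only: val_wconst_times)
    also have "\<dots> = 0" unfolding S by (simp only: val_arith)
    finally have "val ?S w = 0" by (simp only: mult_eq_0_iff fps_X_neq_zero) blast
    then show "val ?S w = val 0 w" by (simp only: val_arith)
  qed
  then have "fps_nth (\<delta> a b c) n = 0" by (rule Suc.IH[where \<gamma> = \<delta>])
  then show ?case using div[OF assms(3-5)] by simp
qed

lemma slh_fun_eq_0:
  assumes "slh_fun a = 0"
  shows "a = 0"
proof -
  obtain p where a: "a = normal_comb p" using slh_normal_comb by blast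
  define S where "S = Poly_Mapping.keys p"
  define A where "A = fst ` S"
  define N where "N = Max (insert 0 ((fst \<circ> snd) ` S \<union> (snd \<circ> snd) ` S))"
  have fin: "finite S" "finite A" by (simp_all add: S_def A_def)
  have le: "b \<le> N" "c \<le> N" if "(k, b, c) \<in> S" for k b c
  proof -
    have "b \<in> (fst \<circ> snd) ` S" "c \<in> (snd \<circ> snd) ` S"
      by (rule rev_image_eqI[OF that], simp)+
    then show "b \<le> N" "c \<le> N"
      unfolding N_def by (intro Max_ge; simp add: fin)+
  qed
  have sub: "S \<subseteq> A \<times> {..N} \<times> {..N}"
  proof
    fix i assume i: "i \<in> S"
    obtain k b c where eq: "i = (k, b, c)" by (cases i)
    have "k \<in> A" unfolding A_def by (rule rev_image_eqI[OF i]) (simp add: eq)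
    then show "i \<in> A \<times> {..N} \<times> {..N}" using le i by (simp add: eq)
  qed
  have "slh_fun (normal_comb p)
      = (\<Sum>i\<in>A \<times> {..N} \<times> {..N}. wconst (Poly_Mapping.lookup p i) * word_fun (normal_word i))"
  proof -
    have sum: "slh_fun (\<Sum>i\<in>I. g i) = (\<Sum>i\<in>I. slh_fun (g i))" for I and g :: "int \<times> nat \<times> nat \<Rightarrow> slh"
      by (induction I rule: infinite_finite_induct) (simp_all add: slh_fun_hom)
    have word: "slh_fun (slh_word w) = word_fun w" for w
      by (simp add: slh_word_def slh_fun.abs_eq free_fun_single wconst_hom)
    have "normal_comb p = (\<Sum>i\<in>A \<times> {..N} \<times> {..N}. slh_scal (Poly_Mapping.lookup p i) * slh_word (normal_word i))"
      unfolding normal_comb_def by (rule lin_ext_superset) (use fin sub in \<open>auto simp: S_def slh_scal_hom\<close>)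
    then show ?thesis
      by (simp add: sum slh_fun_hom word star_wconst respects_sl2_word_fun)
  qed
  also have "\<dots> = (\<Sum>k\<in>A. \<Sum>b\<le>N. \<Sum>c\<le>N. wconst (Poly_Mapping.lookup p (k, b, c)) * word_fun (normal_word (k, b, c)))"
    by (simp add: sum.cartesian_product case_prod_beta)
  finally have "(\<Sum>k\<in>A. \<Sum>b\<le>N. \<Sum>c\<le>N. wconst (Poly_Mapping.lookup p (k, b, c)) * word_fun (normal_word (k, b, c))) = 0"
    using assms a by simp
  from word_fun_independent[OF fin(2) this] have coeff: "fps_nth (Poly_Mapping.lookup p (k, b, c)) n = 0"
    if "k \<in> A" "b \<le> N" "c \<le> N" for k b c n
    using that by blast
  then have "Poly_Mapping.lookup p i = 0" for i
  proof (cases "i \<in> S")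
    case True
    obtain k b c where i: "i = (k, b, c)" by (cases i)
    show ?thesis unfolding i by (rule fps_ext) (use True sub i coeff in auto)
  qed (simp add: S_def in_keys_iff)
  then have "p = 0" by (intro poly_mapping_eqI) simp
  then show ?thesis by (simp add: a normal_comb_zero)
qed

lemma slh_fun_inject: "slh_fun a = slh_fun b \<Longrightarrow> a = b"
  using slh_fun_eq_0[of "a - b"] slh_fun_hom(1)[of "a - b" b] by simp

section \<open>Existence of the D-functions\<close>

text \<open>
  The same homogeneous polynomial of degree \<open>n\<close> in commuting coordinates, evaluated once at the points of
  the classical group and once at the coordinate functionals.  Carrying both values along gives elements
  of the quantum group together with their specialisations at \<open>h = 0\<close>.
\<close>

inductive classical_poly :: "nat \<Rightarrow> (SL2C \<Rightarrow> complex) \<Rightarrow> complex fps wfun \<Rightarrow> bool"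
  where
    one: "classical_poly 0 (\<lambda>g. 1) 1"
  | gen: "classical_poly n f \<phi> \<Longrightarrow> classical_poly (Suc n) (\<lambda>g. coord a g * f g) (gen_fun a * \<phi>)"
  | add: "classical_poly n f \<phi> \<Longrightarrow> classical_poly n f' \<phi>' \<Longrightarrow> classical_poly n (\<lambda>g. f g + f' g) (\<phi> + \<phi>')"
  | scale: "classical_poly n f \<phi> \<Longrightarrow> classical_poly n (\<lambda>g. c * f g) (wconst (fps_const c) * \<phi>)"

lemma classical_poly_zero: "classical_poly n (\<lambda>g. 0) 0"
proof -
  have "\<exists>f \<phi>. classical_poly n f \<phi>"
    by (induction n) (auto intro: classical_poly.intros)
  then obtain f \<phi> where "classical_poly n f \<phi>" by blast
  from classical_poly.scale[OF this, of 0] show ?thesis by (simp add: wconst_hom)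
qed

lemma lder_gen_fun_cases: "lder Gplus (gen_fun a) = 0 \<or> (\<exists>b. lder Gplus (gen_fun a) = gen_fun b)"
  and rder_gen_fun_cases: "rder Gplus (gen_fun a) = 0 \<or> (\<exists>b. rder Gplus (gen_fun a) = gen_fun b)"
  by (cases a; auto simp: lder_gen_fun rder_gen_fun)+

lemma classical_poly_lder: "classical_poly n f \<phi> \<Longrightarrow> \<exists>f'. classical_poly n f' (lder Gplus \<phi>)"
proof (induction rule: classical_poly.induct)
  case (gen n f \<phi> a)
  then obtain f' where f': "classical_poly n f' (lder Gplus \<phi>)" by blast
  show ?case
  proof (cases "lder Gplus (gen_fun a) = 0")
    case True
    then show ?thesis using classical_poly.gen[OF f', of a] by (auto simp: lder_mult)
  next
    case False
    then obtain b where b: "lder Gplus (gen_fun a) = gen_fun b" using lder_gen_fun_cases[of a] by blast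
    show ?thesis
      unfolding lder_mult b
      using classical_poly.add[OF classical_poly.gen[OF gen.hyps] classical_poly.gen[OF f']] by blast
  qed
qed (auto intro: classical_poly_zero classical_poly.add classical_poly.scale)

lemma classical_poly_rder: "classical_poly n f \<phi> \<Longrightarrow> \<exists>f'. classical_poly n f' (rder Gplus \<phi>)"
proof (induction rule: classical_poly.induct)
  case (gen n f \<phi> a)
  then obtain f' where f': "classical_poly n f' (rder Gplus \<phi>)" by blast
  show ?case
  proof (cases "rder Gplus (gen_fun a) = 0")
    case True
    then show ?thesis using classical_poly.gen[OF f', of a] by (auto simp: rder_mult)
  next
    case False
    then obtain b where b: "rder Gplus (gen_fun a) = gen_fun b" using rder_gen_fun_cases[of a] by blast
    show ?thesis
      unfolding rder_mult b
      using classical_poly.add[OF classical_poly.gen[OF gen.hyps] classical_poly.gen[OF f']] by blast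
  qed
qed (auto intro: classical_poly_zero classical_poly.add classical_poly.scale)

lemma classical_poly_funpow:
  assumes "classical_poly n f \<phi>"
  shows "\<exists>f'. classical_poly n f' ((lder Gplus ^^ i) ((rder Gplus ^^ k) \<phi>))"
proof -
  have r: "\<exists>f'. classical_poly n f' ((rder Gplus ^^ k) \<phi>)"
    by (induction k) (use assms in \<open>auto dest: classical_poly_rder\<close>)
  show ?thesis
    by (induction i) (use r in \<open>auto dest: classical_poly_lder\<close>)
qed

lemma funpow_lder_eq_0_mono: "(lder g ^^ N) \<phi> = 0 \<Longrightarrow> N \<le> M \<Longrightarrow> (lder g ^^ M) \<phi> = 0"
  and funpow_rder_eq_0_mono: "(rder g ^^ N) \<phi> = 0 \<Longrightarrow> N \<le> M \<Longrightarrow> (rder g ^^ M) \<phi> = 0"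
proof -
  show "(lder g ^^ M) \<phi> = 0" if "(lder g ^^ N) \<phi> = 0" "N \<le> M"
  proof -
    have "(lder g ^^ M) \<phi> = (lder g ^^ (M - N + N)) \<phi>" using that(2) by simp
    also have "\<dots> = (lder g ^^ (M - N)) ((lder g ^^ N) \<phi>)" by (simp only: funpow_add o_apply)
    finally have "(lder g ^^ M) \<phi> = (lder g ^^ (M - N)) ((lder g ^^ N) \<phi>)" .
    then show ?thesis by (simp add: that lder_funpow_linear)
  qed
  show "(rder g ^^ M) \<phi> = 0" if "(rder g ^^ N) \<phi> = 0" "N \<le> M"
  proof -
    have "(rder g ^^ M) \<phi> = (rder g ^^ (M - N + N)) \<phi>" using that(2) by simp
    also have "\<dots> = (rder g ^^ (M - N)) ((rder g ^^ N) \<phi>)" by (simp only: funpow_add o_apply)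
    finally have "(rder g ^^ M) \<phi> = (rder g ^^ (M - N)) ((rder g ^^ N) \<phi>)" .
    then show ?thesis by (simp add: that(1)) (simp add: rder_funpow_wrev lder_funpow_linear)
  qed
qed

lemma classical_poly_nilpotent:
  "classical_poly n f \<phi> \<Longrightarrow> \<exists>N. (lder Gplus ^^ N) \<phi> = 0 \<and> (rder Gplus ^^ N) \<phi> = 0"
proof (induction rule: classical_poly.induct)
  case one
  show ?case by (intro exI[of _ 1]) simp
next
  case (gen n f \<phi> a)
  then obtain N where N: "(lder Gplus ^^ N) \<phi> = 0" "(rder Gplus ^^ N) \<phi> = 0" by blast
  have 2: "(lder Gplus ^^ 2) (gen_fun a) = 0" "(rder Gplus ^^ 2) (gen_fun a) = 0"
    by (cases a; simp add: numeral_2_eq_2 lder_gen_fun rder_gen_fun)+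
  from lder_funpow_mult_eq_0[OF 2(1) N(1)] rder_funpow_mult_eq_0[OF 2(2) N(2)] show ?case by blast
next
  case (add n f \<phi> f' \<phi>')
  then obtain N N' where "(lder Gplus ^^ N) \<phi> = 0" "(rder Gplus ^^ N) \<phi> = 0"
    "(lder Gplus ^^ N') \<phi>' = 0" "(rder Gplus ^^ N') \<phi>' = 0" by blast
  then have "(lder Gplus ^^ (N + N')) (\<phi> + \<phi>') = 0" "(rder Gplus ^^ (N + N')) (\<phi> + \<phi>') = 0"
    by (simp_all add: lder_funpow_linear rder_funpow_linear funpow_lder_eq_0_mono[of N _ _ "N + N'"]
        funpow_lder_eq_0_mono[of N' _ _ "N + N'"] funpow_rder_eq_0_mono[of N _ _ "N + N'"]
        funpow_rder_eq_0_mono[of N' _ _ "N + N'"])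
  then show ?case by blast
next
  case (scale n f \<phi> c)
  then show ?case by (auto simp: lder_funpow_linear rder_funpow_linear) (metis mult_zero_right)
qed

lemma free_at_h0_zero: "free_at_h0 0 g = 0"
  using free_at_h0_add[of 0 0 g] by simp

lemma free_at_h0_sum: "free_at_h0 (\<Sum>i\<in>I. p i) g = (\<Sum>i\<in>I. free_at_h0 (p i) g)"
  by (induction I rule: infinite_finite_induct) (simp_all add: free_at_h0_zero free_at_h0_add)

lemma free_fun_sum: "free_fun (\<Sum>i\<in>I. p i) = (\<Sum>i\<in>I. free_fun (p i))"
  by (induction I rule: infinite_finite_induct) (simp_all add: free_fun_zero free_fun_add)

lemma free_fun_scal_mult: "free_fun (scal c * p) = wconst c * free_fun p"
  by (simp add: free_fun_mult free_fun_scal star_wconst finite_type_respects[OF finite_type_free_fun])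

text \<open>
  The classical product by a coordinate is the twisted product preceded by the inverse of the operator
  in \<open>star_weights\<close>.  That inverse preserves the degree, so the induction hypothesis applies to its terms,
  and it is the identity modulo \<open>h\<close>, so the value at \<open>h = 0\<close> is the one prescribed.
\<close>

lemma classical_poly_lift:
  "classical_poly n f \<phi> \<Longrightarrow> \<exists>p. free_fun p = \<phi> \<and> (\<forall>g. free_at_h0 p g = f g)"
proof (induction n arbitrary: f \<phi> rule: less_induct)
  case (less n)
  from less.prems less.IH show ?case
  proof (induction rule: classical_poly.induct)
    case one
    show ?case
      by (intro exI[of _ "scal 1"]) (simp add: free_fun_scal free_at_h0_scal wconst_hom)
  next
    case (add n f \<phi> f' \<phi>')
    then obtain p p' where "free_fun p = \<phi> \<and> (\<forall>g. free_at_h0 p g = f g)"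
      "free_fun p' = \<phi>' \<and> (\<forall>g. free_at_h0 p' g = f' g)" by metis
    then show ?case by (intro exI[of _ "p + p'"]) (simp add: free_fun_add free_at_h0_add)
  next
    case (scale n f \<phi> c)
    then obtain p where "free_fun p = \<phi> \<and> (\<forall>g. free_at_h0 p g = f g)" by metis
    then show ?case
      by (intro exI[of _ "scal (fps_const c) * p"])
        (simp add: free_fun_scal_mult free_at_h0_mult free_at_h0_scal)
  next
    case (gen n f \<phi> a)
    define s t :: complex where "s = of_real (left_weight a)" and "t = of_real (right_weight a)"
    obtain N0 where "(lder Gplus ^^ N0) \<phi> = 0" "(rder Gplus ^^ N0) \<phi> = 0"
      using classical_poly_nilpotent[OF gen.hyps] by blast
    then have N: "(lder Gplus ^^ Suc N0) \<phi> = 0" "(rder Gplus ^^ Suc N0) \<phi> = 0" by simp_all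
    let ?D = "\<lambda>i k. (lder Gplus ^^ i) ((rder Gplus ^^ k) \<phi>)"
    let ?c = "\<lambda>k. fps_const (fps_nth (bin_series t) k) * fps_X ^ k"
    let ?d = "\<lambda>i. fps_const (fps_nth (bin_series (- s)) i) * fps_X ^ i"
    have "\<exists>p. free_fun p = ?D i k \<and> (i = 0 \<and> k = 0 \<longrightarrow> (\<forall>g. free_at_h0 p g = f g))" for i k
    proof (cases "i = 0 \<and> k = 0")
      case True
      then show ?thesis using gen.prems(1)[of n f \<phi>] gen.hyps by simp
    next
      case False
      obtain f' where "classical_poly n f' (?D i k)" using classical_poly_funpow[OF gen.hyps] by blast
      then show ?thesis using gen.prems(1)[of n f' "?D i k"] False by auto
    qed
    then obtain p where p: "\<And>i k. free_fun (p i k) = ?D i k" "\<And>g. free_at_h0 (p 0 0) g = f g" by metis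
    define q where "q = (\<Sum>k<Suc N0. \<Sum>i<Suc N0. scal (?c k * ?d i) * p i k)"
    have nil: "(lder Gplus ^^ Suc N0) ((rder Gplus ^^ k) \<phi>) = 0" for k
      unfolding lder_rder_funpow_commute N(1) by (simp add: rder_funpow_wrev lder_funpow_linear)
    have "free_fun q = (\<Sum>k<Suc N0. wconst (?c k) * (\<Sum>i<Suc N0. wconst (?d i) * ?D i k))"
      by (simp only: q_def free_fun_sum free_fun_scal_mult p(1) wconst_hom(4) sum_distrib_left mult.assoc)
    also have "\<dots> = lpow (- s) (rpow t \<phi>)"
      by (simp only: ract_finite[OF N(2)] lact_sum lact_linear(4) lact_finite[OF nil])
    finally have q: "free_fun q = lpow (- s) (rpow t \<phi>)" .
    have "free_fun (gen a * q) = star (gen_fun a) (free_fun q)"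
      by (simp add: free_fun_mult free_fun_gen)
    also have "\<dots> = gen_fun a * lpow s (rpow (- t) (free_fun q))"
      using weight_vec_gen_fun[of a]
      by (intro star_weights finite_type_respects[OF finite_type_free_fun])
        (auto simp: weight_vec_def s_def t_def)
    also have "lpow s (rpow (- t) (free_fun q)) = \<phi>"
      by (simp add: q lact_ract_commute rpow_add lpow_add)
    finally have "free_fun (gen a * q) = gen_fun a * \<phi>" .
    moreover have "free_at_h0 (gen a * q) g = coord a g * f g" for g
    proof -
      have coeff: "fps_nth (?c k * ?d i) 0 = (if k = 0 then if i = 0 then 1 else 0 else 0)" for k i
        by simp
      have "free_at_h0 q g = (\<Sum>k<Suc N0. \<Sum>i<Suc N0. (if k = 0 then if i = 0 then 1 else 0 else 0)
          * free_at_h0 (p i k) g)"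
        by (simp only: q_def free_at_h0_sum free_at_h0_mult free_at_h0_scal coeff)
      also have "\<dots> = (\<Sum>k<Suc N0. \<Sum>i<Suc N0. if i = 0 then if k = 0 then f g else 0 else 0)"
        by (intro sum.cong refl) (auto simp: p(2))
      also have "\<dots> = f g" by (simp add: sum.delta del: sum.lessThan_Suc)
      finally show ?thesis by (simp add: free_at_h0_mult free_at_h0_gen)
    qed
    ultimately show ?case by blast
  qed
qed

text \<open>
  The image of \<open>\<xi> ^ p \<eta> ^ q\<close> under the generic matrix, dehomogenised by \<open>\<xi> = 1\<close>; its coefficients are the
  matrix coefficients of spin \<open>(p + q) / 2\<close> up to normalisation.
\<close>

definition gen_poly :: "nat \<Rightarrow> nat \<Rightarrow> complex fps wfun poly"
  where "gen_poly p q = [:gen_fun Gx, gen_fun Gv:] ^ p * [:gen_fun Gu, gen_fun Gy:] ^ q"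

lemma coeff_linear_times:
  "coeff ([:a, b:] * P) i = a * coeff P i + (case i of 0 \<Rightarrow> 0 | Suc k \<Rightarrow> b * coeff P k)"
  for a b :: "'a::comm_ring_1"
  by (cases i) simp_all

lemma gen_poly_Suc:
  "gen_poly (Suc p) q = [:gen_fun Gx, gen_fun Gv:] * gen_poly p q"
  "gen_poly 0 (Suc q) = [:gen_fun Gu, gen_fun Gy:] * gen_poly 0 q"
  by (simp_all only: gen_poly_def power_Suc power_0 mult.assoc mult_1_left)

lemma gen_poly_induct [case_names zero right left]:
  assumes "P 0 0" "\<And>q. P 0 q \<Longrightarrow> P 0 (Suc q)" "\<And>p q. P p q \<Longrightarrow> P (Suc p) q"
  shows "P p q"
proof (induction p)
  case 0
  show ?case by (induction q) (use assms in auto)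
qed (use assms in auto)

lemma classical_poly_coeff:
  "classical_poly (p + q)
    (\<lambda>g. coeff ([:coord Gx g, coord Gv g:] ^ p * [:coord Gu g, coord Gy g:] ^ q) i) (coeff (gen_poly p q) i)"
proof (induction p q arbitrary: i rule: gen_poly_induct)
  case zero
  then show ?case
    using classical_poly.one classical_poly_zero[of 0] by (cases i) (simp_all add: gen_poly_def)
next
  case (right q)
  note gu = classical_poly.gen[OF right, of Gu] and gy = classical_poly.gen[OF right, of Gy]
  show ?case
    unfolding gen_poly_Suc
    using gu[of 0] classical_poly.add[OF gu gy]
    by (cases i) (simp_all add: coeff_linear_times del: mult_pCons_left coord.simps)
next
  case (left p q)
  note gx = classical_poly.gen[OF left, of Gx] and gv = classical_poly.gen[OF left, of Gv]
  show ?case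
    unfolding gen_poly_Suc
    using gx[of 0] classical_poly.add[OF gx gv]
    by (cases i) (simp_all add: coeff_linear_times mult.assoc del: mult_pCons_left coord.simps)
qed

lemma val_coeff_gen_poly: "val (coeff (gen_poly p q) i) [] = (if i = q then 1 else 0)"
proof (induction p q arbitrary: i rule: gen_poly_induct)
  case zero
  show ?case by (cases i) (simp_all add: gen_poly_def val_one)
qed (auto simp: gen_poly_Suc coeff_linear_times val_gen_fun_Nil split: nat.split simp del: mult_pCons_left)

text \<open>
  On the generating polynomial \<open>P\<close> of degree \<open>n\<close> in \<open>z\<close>, the left action of \<open>J_+, J_-, J_0\<close> is \<open>P'\<close>,
  \<open>n z P - z\<^sup>2 P'\<close> and \<open>n P - 2 z P'\<close>, which is a derivation property if \<open>n\<close> is additive under products.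
\<close>

lemma lder_coeff_linear_times:
  assumes L: "lder Gplus a = b" "lder Gplus b = 0" "lder Gminus a = 0" "lder Gminus b = a"
      "lder Gzero a = a" "lder Gzero b = - b"
    and P: "\<And>i. lder Gplus (coeff P i) = of_nat (Suc i) * coeff P (Suc i)"
      "\<And>i. lder Gminus (coeff P i) = (case i of 0 \<Rightarrow> 0 | Suc k \<Rightarrow> (of_nat n - of_nat k) * coeff P k)"
      "\<And>i. lder Gzero (coeff P i) = (of_nat n - 2 * of_nat i) * coeff P i"
    and Q: "Q = [:a, b:] * P"
  shows "lder Gplus (coeff Q i) = of_nat (Suc i) * coeff Q (Suc i)"
    "lder Gminus (coeff Q i) = (case i of 0 \<Rightarrow> 0 | Suc k \<Rightarrow> (of_nat (Suc n) - of_nat k) * coeff Q k)"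
    "lder Gzero (coeff Q i) = (of_nat (Suc n) - 2 * of_nat i) * coeff Q i"
proof -
  note c = coeff_linear_times[of a b P, folded Q]
  show "lder Gplus (coeff Q i) = of_nat (Suc i) * coeff Q (Suc i)"
    by (cases i) (simp_all add: c lder_mult L P algebra_simps)
  show "lder Gminus (coeff Q i) = (case i of 0 \<Rightarrow> 0 | Suc k \<Rightarrow> (of_nat (Suc n) - of_nat k) * coeff Q k)"
  proof (cases i)
    case (Suc k)
    then show ?thesis by (cases k) (simp_all add: c lder_mult L P algebra_simps)
  qed (simp add: c lder_mult L P)
  show "lder Gzero (coeff Q i) = (of_nat (Suc n) - 2 * of_nat i) * coeff Q i"
    by (cases i) (simp_all add: c lder_mult L P algebra_simps)
qed

lemma lder_coeff_gen_poly:
  "lder Gplus (coeff (gen_poly p q) i) = of_nat (Suc i) * coeff (gen_poly p q) (Suc i)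
  \<and> lder Gminus (coeff (gen_poly p q) i)
    = (case i of 0 \<Rightarrow> 0 | Suc k \<Rightarrow> (of_nat (p + q) - of_nat k) * coeff (gen_poly p q) k)
  \<and> lder Gzero (coeff (gen_poly p q) i) = (of_nat (p + q) - 2 * of_nat i) * coeff (gen_poly p q) i"
proof (induction p q arbitrary: i rule: gen_poly_induct)
  case zero
  show ?case by (cases i) (auto simp: gen_poly_def split: nat.split)
next
  case (right q)
  from right[unfolded add_0] have P: "lder Gplus (coeff (gen_poly 0 q) i) = of_nat (Suc i) * coeff (gen_poly 0 q) (Suc i)"
    "lder Gminus (coeff (gen_poly 0 q) i) = (case i of 0 \<Rightarrow> 0 | Suc k \<Rightarrow> (of_nat q - of_nat k) * coeff (gen_poly 0 q) k)"
    "lder Gzero (coeff (gen_poly 0 q) i) = (of_nat q - 2 * of_nat i) * coeff (gen_poly 0 q) i" for i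
    by blast+
  note L = lder_coeff_linear_times[of "gen_fun Gu" "gen_fun Gy", OF _ _ _ _ _ _ P gen_poly_Suc(2)]
  show ?case
    by (intro conjI) (simp_all only: L lder_gen_fun add_0)
next
  case (left p q)
  then have P: "lder Gplus (coeff (gen_poly p q) i) = of_nat (Suc i) * coeff (gen_poly p q) (Suc i)"
    "lder Gminus (coeff (gen_poly p q) i)
      = (case i of 0 \<Rightarrow> 0 | Suc k \<Rightarrow> (of_nat (p + q) - of_nat k) * coeff (gen_poly p q) k)"
    "lder Gzero (coeff (gen_poly p q) i) = (of_nat (p + q) - 2 * of_nat i) * coeff (gen_poly p q) i" for i
    by blast+
  note L = lder_coeff_linear_times[of "gen_fun Gx" "gen_fun Gv", OF _ _ _ _ _ _ P gen_poly_Suc(1)]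
  show ?case
    by (intro conjI) (simp_all only: L lder_gen_fun add_Suc)
qed

lemma coeff_gen_poly_eq_0:
  assumes "p + q < i"
  shows "coeff (gen_poly p q) i = 0"
  using assms
proof (induction p q arbitrary: i rule: gen_poly_induct)
  case zero
  then show ?case by (cases i) (simp_all add: gen_poly_def)
qed (auto simp: gen_poly_Suc coeff_linear_times split: nat.split simp del: mult_pCons_left)

text \<open>
  The ratio of the norms of the basis vectors \<open>\<xi> ^ (p + q - r) \<eta> ^ r\<close> and \<open>\<xi> ^ p \<eta> ^ q\<close>.
\<close>
definition poly_norm :: "nat \<Rightarrow> nat \<Rightarrow> nat \<Rightarrow> real"
  where "poly_norm p q r = sqrt (fact (p + q - r) * fact r / (fact p * fact q))"

lemma rconst_mult: "rconst a * (rconst b * \<phi>) = rconst (a * b) * \<phi>"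
  by (simp add: wconst_hom mult.assoc flip: fps_const_mult)

lemma rconst_of_nat: "rconst (real k) = of_nat k"
proof (induction k)
  case (Suc k)
  then show ?case by (simp add: wconst_hom flip: fps_const_add)
qed (simp add: wconst_hom)

lemma rconst_diff: "rconst (a - b) = rconst a - rconst b"
  by (simp add: wconst_hom flip: fps_const_sub)

lemma poly_norm_Suc:
  assumes "r < p + q"
  shows "sqrt (real (Suc r) * real (p + q - r)) * poly_norm p q (Suc r) = poly_norm p q r * real (Suc r)"
    "sqrt (real (p + q - r) * real (Suc r)) * poly_norm p q r = poly_norm p q (Suc r) * real (p + q - r)"
proof -
  obtain d where d: "p + q - r = Suc d" using assms by (metis Suc_diff_Suc)
  then have d': "p + q - Suc r = d" by simp
  define A B where "A = real (Suc r)" and "B = real (Suc d)"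
  define C where "C = fact d * fact r / (fact p * fact q :: real)"
  have pos: "A \<ge> 0" "B \<ge> 0" "C \<ge> 0" by (simp_all add: A_def B_def C_def)
  have n: "poly_norm p q (Suc r) = sqrt (A * C)" "poly_norm p q r = sqrt (B * C)"
    by (simp_all add: poly_norm_def d d' A_def B_def C_def algebra_simps)
  show "sqrt (real (Suc r) * real (p + q - r)) * poly_norm p q (Suc r) = poly_norm p q r * real (Suc r)"
    "sqrt (real (p + q - r) * real (Suc r)) * poly_norm p q r = poly_norm p q (Suc r) * real (p + q - r)"
    unfolding n d A_def[symmetric] B_def[symmetric] using pos
    by (simp_all add: real_sqrt_mult mult.assoc mult.left_commute)
qed

text \<open>
  Both sides agree at the identity and obey the same recursion under the left action of the generators,
  hence agree on all words.
\<close>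
lemma mat_coeff_gen_poly:
  assumes "2 * j = real (p + q)" "r \<le> p + q"
  shows "mat_coeff j (j - real r) (j - real q) = rconst (poly_norm p q r) * coeff (gen_poly p q) r"
proof (rule wfun_eqI)
  fix w
  let ?D = "\<lambda>r. rconst (poly_norm p q r) * coeff (gen_poly p q) r"
  have spin: "spin j" using assms by (auto simp: spin_def intro!: exI[of _ "p + q"])
  have wt: "j - real r \<in> weights j" if "r \<le> p + q" for r
    using that assms(1) by (auto simp: weights_def intro!: exI[of _ "p + q - r"])
  note D = lder_coeff_gen_poly[of p q, THEN conjunct1] lder_coeff_gen_poly[of p q, THEN conjunct2, THEN conjunct1]
    lder_coeff_gen_poly[of p q, THEN conjunct2, THEN conjunct2]
  show "val (mat_coeff j (j - real r) (j - real q)) w = val (?D r) w"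
    using assms(2)
  proof (induction w arbitrary: r)
    case Nil
    have "poly_norm p q q = 1" by (simp add: poly_norm_def)
    then show ?case by (simp add: val_mat_coeff val_coeff_gen_poly val_wconst)
  next
    case (Cons g w)
    have step: "val \<phi> (g # w) = val (lder g \<phi>) w" for \<phi> :: "complex fps wfun" and g by simp
    show ?case
    proof (cases g)
      case Gzero
      have "lder Gzero (mat_coeff j (j - real r) (j - real q)) = rconst (2 * (j - real r)) * mat_coeff j (j - real r) (j - real q)"
        by (simp only: lder_mat_coeff rconst_sum_gen_elt(1)[OF spin wt[OF Cons.prems]])
      moreover have "lder Gzero (?D r) = rconst (2 * (j - real r)) * ?D r"
      proof -
        have "(of_nat (p + q) - 2 * of_nat r :: complex fps wfun) = rconst (2 * (j - real r))"
        proof -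
          have "2 * (j - real r) = real (p + q) - real (2 * r)" using assms(1) by simp
          then show ?thesis by (simp only: rconst_diff rconst_of_nat) simp
        qed
        then show ?thesis by (simp only: lder_linear D mult.left_commute)
      qed
      ultimately show ?thesis
        unfolding step Gzero using Cons.IH[OF Cons.prems] by (simp only: val_wconst_times)
    next
      case Gplus
      have s: "(j - (j - real r) + 1) * (j + (j - real r)) = real (Suc r) * real (p + q - r)"
        using assms(1) Cons.prems by (simp add: algebra_simps of_nat_diff)
      have "lder Gplus (mat_coeff j (j - real r) (j - real q))
          = rconst (sqrt (real (Suc r) * real (p + q - r))) * mat_coeff j (j - real (Suc r)) (j - real q)"
      proof -
        have e: "j - real r - 1 = j - real (Suc r)" by simp
        show ?thesis by (simp only: lder_mat_coeff rconst_sum_gen_elt(2)[OF spin wt[OF Cons.prems]] s e)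
      qed
      moreover have "lder Gplus (?D r) = rconst (poly_norm p q r * real (Suc r)) * coeff (gen_poly p q) (Suc r)"
        by (simp only: lder_linear D rconst_of_nat[symmetric] rconst_mult)
      moreover have "val (rconst (sqrt (real (Suc r) * real (p + q - r))) * mat_coeff j (j - real (Suc r)) (j - real q)) w
          = val (rconst (poly_norm p q r * real (Suc r)) * coeff (gen_poly p q) (Suc r)) w"
      proof (cases "r < p + q")
        case True
        then show ?thesis
          using Cons.IH[of "Suc r"]
          by (simp only: poly_norm_Suc(1)[symmetric] rconst_mult[symmetric] val_wconst_times Suc_le_eq)
      next
        case False
        then show ?thesis using Cons.prems by (simp add: coeff_gen_poly_eq_0)
      qed
      ultimately show ?thesis unfolding step Gplus by (simp only:)
    next
      case Gminus
      show ?thesis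
      proof (cases r)
        case 0
        have "lder Gminus (mat_coeff j (j - real r) (j - real q)) = 0"
          unfolding lder_mat_coeff rconst_sum_gen_elt(3)[OF spin wt[OF Cons.prems]]
          by (simp add: 0 wconst_hom)
        moreover have "lder Gminus (?D r) = 0"
          by (simp only: lder_linear D 0 nat.case mult_zero_right)
        ultimately show ?thesis unfolding step Gminus by (simp only:)
      next
        case (Suc k)
        have k: "k < p + q" using Cons.prems Suc by simp
        have s: "(j + (j - real r) + 1) * (j - (j - real r)) = real (p + q - k) * real (Suc k)"
          using assms(1) k by (simp add: Suc algebra_simps of_nat_diff)
        have "lder Gminus (mat_coeff j (j - real r) (j - real q))
            = rconst (sqrt (real (p + q - k) * real (Suc k))) * mat_coeff j (j - real k) (j - real q)"
        proof -
          have e: "j - real r + 1 = j - real k" by (simp add: Suc)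
          show ?thesis by (simp only: lder_mat_coeff rconst_sum_gen_elt(3)[OF spin wt[OF Cons.prems]] s e)
        qed
        moreover have "lder Gminus (?D r) = rconst (poly_norm p q (Suc k) * real (p + q - k)) * coeff (gen_poly p q) k"
        proof -
          have "(of_nat (p + q) - of_nat k :: complex fps wfun) = rconst (real (p + q - k))"
            unfolding rconst_of_nat using k by (simp add: of_nat_diff)
          then show ?thesis by (simp only: lder_linear D Suc nat.case rconst_mult)
        qed
        moreover have "val (rconst (sqrt (real (p + q - k) * real (Suc k))) * mat_coeff j (j - real k) (j - real q)) w
            = val (rconst (poly_norm p q (Suc k) * real (p + q - k)) * coeff (gen_poly p q) k) w"
          using Cons.IH[of k] k
          by (simp only: poly_norm_Suc(2)[OF k, symmetric] rconst_mult[symmetric] val_wconst_times less_imp_le)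
        ultimately show ?thesis unfolding step Gminus by (simp only:)
      qed
    qed
  qed
qed

text \<open>
  The matrix coefficient and the classical \<open>D\<close>-function are the same polynomial, with the same
  normalisation, in the coordinates.
\<close>
lemma spin_elt_lift:
  assumes "spin j" "m' \<in> weights j" "m \<in> weights j"
  shows "\<exists>p. free_fun p = mat_coeff j m' m \<and> (\<forall>g. free_at_h0 p g = classical_D_fun j m' m g)"
proof -
  obtain n where n: "2 * j = real n" using assms(1) by (auto simp: spin_def)
  have "- m \<in> weights j" "- m' \<in> weights j" using assms by (auto intro: weights_uminus)
  then obtain q r where qr: "- m = - j + real q" "- m' = - j + real r" by (auto simp: weights_def)
  have le: "q \<le> n" "r \<le> n"
    using weights_bounds[OF assms(2)] weights_bounds[OF assms(3)] qr n by linarith+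
  define p where "p = n - q"
  have pq: "n = p + q" using le by (simp add: p_def)
  have m: "m = j - real q" "m' = j - real r" using qr by linarith+
  have fl: "nat_floor (j + m) = p" "nat_floor (j - m) = q" "nat_floor (j + m') = p + q - r" "nat_floor (j - m') = r"
  proof -
    have "j + m = real p" "j - m = real q" "j + m' = real (p + q - r)" "j - m' = real r"
      using n le m pq by (simp_all add: of_nat_diff)
    then show "nat_floor (j + m) = p" "nat_floor (j - m) = q" "nat_floor (j + m') = p + q - r" "nat_floor (j - m') = r"
      by (simp_all only: nat_floor_def floor_of_nat nat_int)
  qed
  have "classical_poly (p + q) (\<lambda>g. complex_of_real (poly_norm p q r)
      * coeff ([:coord Gx g, coord Gv g:] ^ p * [:coord Gu g, coord Gy g:] ^ q) r)
      (rconst (poly_norm p q r) * coeff (gen_poly p q) r)"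
    by (rule classical_poly.scale[OF classical_poly_coeff])
  moreover have "(\<lambda>g. complex_of_real (poly_norm p q r)
      * coeff ([:coord Gx g, coord Gv g:] ^ p * [:coord Gu g, coord Gy g:] ^ q) r) = classical_D_fun j m' m"
    by (rule ext) (simp only: classical_D_fun_def fl poly_norm_def)
  moreover have "rconst (poly_norm p q r) * coeff (gen_poly p q) r = mat_coeff j m' m"
    using mat_coeff_gen_poly[of j p q r] n le by (simp add: m pq)
  ultimately show ?thesis using classical_poly_lift by metis
qed

text \<open>Injectivity of \<open>slh_fun\<close> is what makes the definite description in \<open>D_fun\<close> meaningful.\<close>
lemma D_fun_eqI:
  assumes "slh_fun a = mat_coeff j m' m"
  shows "D_fun j m' m = a"
  unfolding D_fun_def
proof (rule the_equality)
  show "\<forall>X. pairing a X = spin_elt j m' m X"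
    by (simp add: pairing_fnl spin_elt_fnl assms)
  show "b = a" if "\<forall>X. pairing b X = spin_elt j m' m X" for b
  proof (rule slh_fun_inject, rule fnl_inject)
    show "respects_sl2 (slh_fun b)" "respects_sl2 (slh_fun a)"
      by (rule finite_type_respects[OF finite_type_slh_fun])+
    show "fnl (slh_fun b) X = fnl (slh_fun a) X" for X
      using that by (simp add: assms flip: pairing_fnl spin_elt_fnl)
  qed
qed

lemma D_fun_properties:
  assumes "spin j" "m' \<in> weights j" "m \<in> weights j"
  shows "slh_fun (D_fun j m' m) = mat_coeff j m' m" "at_h0 (D_fun j m' m) = classical_D_fun j m' m"
proof -
  obtain p where p: "free_fun p = mat_coeff j m' m" "\<forall>g. free_at_h0 p g = classical_D_fun j m' m g"
    using spin_elt_lift[OF assms] by blast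
  have "D_fun j m' m = abs_slh p" by (rule D_fun_eqI) (simp add: slh_fun.abs_eq p)
  then show "slh_fun (D_fun j m' m) = mat_coeff j m' m" "at_h0 (D_fun j m' m) = classical_D_fun j m' m"
    using p by (simp_all add: slh_fun.abs_eq at_h0.abs_eq fun_eq_iff)
qed

section \<open>Orthogonality\<close>

lemma sign_pow_add_one: "sign_pow (z + 1) = - sign_pow z"
  by (simp add: sign_pow_def power_int_add)

lemma sign_pow_zero [simp]: "sign_pow 0 = 1"
  by (simp add: sign_pow_def)

lemma sign_pow_minus_one: "sign_pow (z - 1) = - sign_pow z"
  using sign_pow_add_one[of "z - 1"] by simp

text \<open>
  Invariance under sl(2) of the alternating sum of the \<open>|j m\<rangle> \<otimes> |j -m\<rangle>\<close>, and of the dual form: the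
  ladder coefficients are symmetric under \<open>m \<mapsto> -m\<close>, while a step of \<open>m\<close> changes the sign.
\<close>

lemma gen_elt_invariant_right:
  "sign_pow (k + t) * complex_of_real (gen_elt j g s (- t))
    + sign_pow (k - s) * complex_of_real (gen_elt j g t (- s)) = 0"
proof (cases g)
  case Gplus
  show ?thesis
  proof (cases "s = - t + 1")
    case True
    have "(j + t) * (j - t + 1) = (j + s) * (j - s + 1)" by (simp add: True algebra_simps)
    moreover have "sign_pow (k - s) = - sign_pow (k + t)"
    proof -
      have "k - s = k + t - 1" by (simp add: True)
      then show ?thesis by (simp only: sign_pow_minus_one)
    qed
    ultimately show ?thesis using True by (simp add: Gplus)
  qed (auto simp: Gplus)
next
  case Gminus
  show ?thesis
  proof (cases "s = - t - 1")
    case True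
    have "(j - t) * (j + t + 1) = (j - s) * (j + s + 1)" by (simp add: True algebra_simps)
    moreover have "sign_pow (k - s) = - sign_pow (k + t)"
    proof -
      have "k - s = k + t + 1" by (simp add: True)
      then show ?thesis by (simp only: sign_pow_add_one)
    qed
    ultimately show ?thesis using True by (simp add: Gminus)
  qed (auto simp: Gminus)
qed auto

lemma gen_elt_invariant_left:
  "sign_pow (k + t) * complex_of_real (gen_elt j g (- t) s)
    + sign_pow (k - s) * complex_of_real (gen_elt j g (- s) t) = 0"
proof (cases g)
  case Gplus
  show ?thesis
  proof (cases "s = - t - 1")
    case True
    have "(j - s) * (j + s + 1) = (j - t) * (j + t + 1)" by (simp add: True algebra_simps)
    moreover have "sign_pow (k - s) = - sign_pow (k + t)"
    proof -
      have "k - s = k + t + 1" by (simp add: True)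
      then show ?thesis by (simp only: sign_pow_add_one)
    qed
    ultimately show ?thesis using True by (simp add: Gplus)
  qed (auto simp: Gplus)
next
  case Gminus
  show ?thesis
  proof (cases "s = - t + 1")
    case True
    have "(j + s) * (j - s + 1) = (j + t) * (j - t + 1)" by (simp add: True algebra_simps)
    moreover have "sign_pow (k - s) = - sign_pow (k + t)"
    proof -
      have "k - s = k + t - 1" by (simp add: True)
      then show ?thesis by (simp only: sign_pow_minus_one)
    qed
    ultimately show ?thesis using True by (simp add: Gminus)
  qed (auto simp: Gminus)
qed auto

abbreviation sconst :: "real \<Rightarrow> complex fps wfun"
  where "sconst z \<equiv> wconst (fps_const (sign_pow z))"

lemma sum_weights_uminus:
  assumes "spin j"
  shows "(\<Sum>m\<in>weights j. f m) = (\<Sum>m\<in>weights j. f (- m))"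
  by (rule sum.reindex_bij_witness[of _ uminus uminus]) (auto intro: weights_uminus[OF assms])

lemma wconst_linear_comb_zero:
  "a * complex_of_real b + a' * complex_of_real b' = 0 \<Longrightarrow>
    wconst (fps_const a) * (rconst b * \<phi>) + wconst (fps_const a') * (rconst b' * \<phi>) = 0"
proof -
  assume "a * complex_of_real b + a' * complex_of_real b' = 0"
  then have "wconst (fps_const (a * complex_of_real b + a' * complex_of_real b')) * \<phi> = 0"
    by (simp add: wconst_hom)
  then show ?thesis
    by (simp only: wconst_hom fps_const_add[symmetric] fps_const_mult[symmetric] distrib_right mult.assoc)
qed

text \<open>
  By invariance all generators annihilate the left-hand side, so it is constant, and its value is
  read off at the identity.
\<close>
lemma classical_orthogonality_right:
  assumes "spin j" "k1 \<in> weights j" "k2 \<in> weights j"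
  shows "(\<Sum>m\<in>weights j. sconst (k1 - m) * (mat_coeff j k1 m * mat_coeff j k2 (- m)))
    = (if k2 = - k1 then 1 else 0)" (is "?B = _")
proof -
  note um = weights_uminus[OF assms(1)]
  let ?M = "\<lambda>s t. mat_coeff j k1 s * mat_coeff j k2 t"
  have "rder g ?B = 0" for g
  proof -
    have "rder g ?B = (\<Sum>m\<in>weights j. \<Sum>s\<in>weights j. sconst (k1 - m) * (rconst (gen_elt j g s m) * ?M s (- m)))
        + (\<Sum>m\<in>weights j. \<Sum>s\<in>weights j. sconst (k1 - m) * (rconst (gen_elt j g s (- m)) * ?M m s))"
      by (simp add: rder_mult rder_mat_coeff assms um sum_distrib_left sum_distrib_right distrib_left
          sum.distrib mult.assoc mult.left_commute[of "mat_coeff _ _ _"])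
    also have "(\<Sum>m\<in>weights j. \<Sum>s\<in>weights j. sconst (k1 - m) * (rconst (gen_elt j g s m) * ?M s (- m)))
        = (\<Sum>s\<in>weights j. \<Sum>t\<in>weights j. sconst (k1 + t) * (rconst (gen_elt j g s (- t)) * ?M s t))"
      by (subst sum_weights_uminus[OF assms(1)], subst sum.swap) simp
    also have "(\<Sum>s\<in>weights j. \<Sum>t\<in>weights j. sconst (k1 + t) * (rconst (gen_elt j g s (- t)) * ?M s t))
        + (\<Sum>m\<in>weights j. \<Sum>s\<in>weights j. sconst (k1 - m) * (rconst (gen_elt j g s (- m)) * ?M m s))
        = (\<Sum>s\<in>weights j. \<Sum>t\<in>weights j. sconst (k1 + t) * (rconst (gen_elt j g s (- t)) * ?M s t)
          + sconst (k1 - s) * (rconst (gen_elt j g t (- s)) * ?M s t))"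
      by (simp only: sum.distrib)
    also have "\<dots> = 0"
      by (intro sum.neutral ballI wconst_linear_comb_zero gen_elt_invariant_right)
    finally show ?thesis .
  qed
  moreover have "val ?B [] = (if k2 = - k1 then 1 else 0)"
  proof -
    have "val ?B [] = (\<Sum>m\<in>weights j. if m = k1 then (if k2 = - k1 then 1 else 0) else 0)"
      unfolding val_sum val_wconst_times val_times_Nil by (intro sum.cong refl) (auto simp: val_mat_coeff val_wconst)
    then show ?thesis using assms(2) by (simp add: sum.delta)
  qed
  ultimately have "val ?B w = (if w = [] then (if k2 = - k1 then 1 else 0) else 0)" for w
    by (cases w rule: rev_cases) (simp_all flip: val_rder del: val_sum val_wconst_times val_times_Nil)
  then show ?thesis
    by (intro wfun_eqI) (simp add: val_one del: val_sum)
qed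

lemma classical_orthogonality_left:
  assumes "spin j" "m1 \<in> weights j" "m2 \<in> weights j"
  shows "(\<Sum>k\<in>weights j. sconst (m1 - k) * (mat_coeff j k m1 * mat_coeff j (- k) m2))
    = (if m2 = - m1 then 1 else 0)" (is "?B = _")
proof -
  let ?M = "\<lambda>s t. mat_coeff j s m1 * mat_coeff j t m2"
  have "lder g ?B = 0" for g
  proof -
    have "lder g ?B = (\<Sum>k\<in>weights j. \<Sum>s\<in>weights j. sconst (m1 - k) * (rconst (gen_elt j g k s) * ?M s (- k)))
        + (\<Sum>k\<in>weights j. \<Sum>s\<in>weights j. sconst (m1 - k) * (rconst (gen_elt j g (- k) s) * ?M k s))"
      by (simp add: lder_mult lder_mat_coeff sum_distrib_left sum_distrib_right distrib_left
          sum.distrib mult.assoc mult.left_commute[of "mat_coeff _ _ _"])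
    also have "(\<Sum>k\<in>weights j. \<Sum>s\<in>weights j. sconst (m1 - k) * (rconst (gen_elt j g k s) * ?M s (- k)))
        = (\<Sum>s\<in>weights j. \<Sum>t\<in>weights j. sconst (m1 + t) * (rconst (gen_elt j g (- t) s) * ?M s t))"
      by (subst sum_weights_uminus[OF assms(1)], subst sum.swap) simp
    also have "(\<Sum>s\<in>weights j. \<Sum>t\<in>weights j. sconst (m1 + t) * (rconst (gen_elt j g (- t) s) * ?M s t))
        + (\<Sum>k\<in>weights j. \<Sum>s\<in>weights j. sconst (m1 - k) * (rconst (gen_elt j g (- k) s) * ?M k s))
        = (\<Sum>s\<in>weights j. \<Sum>t\<in>weights j. sconst (m1 + t) * (rconst (gen_elt j g (- t) s) * ?M s t)
          + sconst (m1 - s) * (rconst (gen_elt j g (- s) t) * ?M s t))"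
      by (simp only: sum.distrib)
    also have "\<dots> = 0"
      by (intro sum.neutral ballI wconst_linear_comb_zero gen_elt_invariant_left)
    finally show ?thesis .
  qed
  moreover have "val ?B [] = (if m2 = - m1 then 1 else 0)"
  proof -
    have "val ?B [] = (\<Sum>k\<in>weights j. if k = m1 then (if m2 = - m1 then 1 else 0) else 0)"
      unfolding val_sum val_wconst_times val_times_Nil by (intro sum.cong refl) (auto simp: val_mat_coeff val_wconst)
    then show ?thesis using assms(2) by (simp add: sum.delta)
  qed
  ultimately have "val ?B w = (if w = [] then (if m2 = - m1 then 1 else 0) else 0)" for w
    by (cases w) (simp_all flip: val_lder del: val_sum val_wconst_times val_times_Nil)
  then show ?thesis
    by (intro wfun_eqI) (simp add: val_one del: val_sum)
qed

text \<open>The matrix element of \<open>(1 - 2 h J_+) powr a\<close>.\<close>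

definition pow_elt :: "real \<Rightarrow> real \<Rightarrow> real \<Rightarrow> real \<Rightarrow> complex fps"
  where "pow_elt j a k s = val (lpow (of_real a) (mat_coeff j k s)) []"

lemma pow_elt_rpow: "pow_elt j a k s = val (rpow (of_real a) (mat_coeff j k s)) []"
  by (simp add: pow_elt_def val_lact val_ract)

lemma val_mat_coeff_append:
  "k \<in> weights j \<Longrightarrow> val (mat_coeff j k m) (v @ w)
    = (\<Sum>s\<in>weights j. val (mat_coeff j k s) v * val (mat_coeff j s m) w)"
  by (simp add: val_mat_coeff word_elt_append fps_const_sum)

lemma lpow_mat_coeff:
  assumes "k \<in> weights j"
  shows "lpow (of_real a) (mat_coeff j k m) = (\<Sum>s\<in>weights j. wconst (pow_elt j a k s) * mat_coeff j s m)"
  by (rule wfun_eqI)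
    (simp add: pow_elt_def val_lact val_mat_coeff_append[OF assms] sum_distrib_left hsum_sum
      hsum_mult_right[symmetric] mult.assoc del: bin_series_nth)

lemma rpow_mat_coeff:
  assumes "k \<in> weights j"
  shows "rpow (of_real a) (mat_coeff j k m) = (\<Sum>s\<in>weights j. wconst (pow_elt j a s m) * mat_coeff j k s)"
proof (rule wfun_eqI)
  fix w
  have "val (rpow (of_real a) (mat_coeff j k m)) w
      = (\<Sum>s\<in>weights j. pow_elt j a s m * val (mat_coeff j k s) w)"
    unfolding val_ract val_mat_coeff_append[OF assms] pow_elt_rpow sum_distrib_left hsum_sum
    by (simp only: hsum_mult_right[symmetric] append_Nil) (simp only: mult_ac)
  then show "val (rpow (of_real a) (mat_coeff j k m)) w
      = val (\<Sum>s\<in>weights j. wconst (pow_elt j a s m) * mat_coeff j k s) w"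
    by simp
qed

lemma pow_elt_nth_0: "fps_nth (pow_elt j a k s) 0 = (if k = s then 1 else 0)"
  by (simp add: pow_elt_def val_lact hsum_nth val_mat_coeff)

lemma twist_elt_pow_elt:
  assumes "spin j" "m1 \<in> weights j" "m2 \<in> weights j" "s1 \<in> weights j" "s2 \<in> weights j"
  shows "twist_elt j j s1 s2 m1 m2 = (if m1 = s1 then pow_elt j m1 m2 s2 else 0)"
    "twist_inv_elt j j s1 s2 m1 m2 = (if m1 = s1 then pow_elt j (- s1) m2 s2 else 0)"
proof -
  note w1 = weight_vec_mat_coeff[OF assms(1,2,4)]
  have re: "respects_sl2 (mat_coeff j m1 s1)" "respects_sl2 (mat_coeff j m2 s2)"
    using assms by (auto intro: respects_sl2_mat_coeff)
  have wt: "has_weights (of_real m1) (of_real s1) (mat_coeff j m1 s1)" using w1 by (simp add: weight_vec_def)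
  have "twist_elt j j s1 s2 m1 m2 = fnl2 (mat_coeff j m1 s1) (mat_coeff j m2 s2) (twist * 1)"
    by (simp add: twist_elt_def spin_elt_fnl tens_fun_fnl re)
  also have "\<dots> = val (mat_coeff j m1 s1) [] * pow_elt j m1 m2 s2"
    unfolding fnl2_twist(1)[OF re wt] pow_elt_def
    by (rule fnl2_one) (simp_all add: re respects_sl2_lact)
  finally show "twist_elt j j s1 s2 m1 m2 = (if m1 = s1 then pow_elt j m1 m2 s2 else 0)"
    by (simp add: val_mat_coeff)
  have "twist_inv_elt j j s1 s2 m1 m2 = fnl2 (mat_coeff j m1 s1) (mat_coeff j m2 s2) (1 * twist_inv)"
    by (simp add: twist_inv_elt_def spin_elt_fnl tens_fun_fnl re)
  also have "\<dots> = val (mat_coeff j m1 s1) [] * pow_elt j (- s1) m2 s2"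
    unfolding fnl2_twist_inv[OF re wt] pow_elt_rpow of_real_minus
    by (rule fnl2_one) (simp_all add: re respects_sl2_ract)
  finally show "twist_inv_elt j j s1 s2 m1 m2 = (if m1 = s1 then pow_elt j (- s1) m2 s2 else 0)"
    by (simp add: val_mat_coeff)
qed

lemma star_mat_coeff:
  assumes "spin j" "k1 \<in> weights j" "m1 \<in> weights j" "k2 \<in> weights j"
  shows "star (mat_coeff j k1 m1) (mat_coeff j k2 m2)
    = mat_coeff j k1 m1 * lpow (of_real k1) (rpow (- of_real m1) (mat_coeff j k2 m2))"
  using weight_vec_mat_coeff[OF assms(1-3)] assms
  by (intro star_weights respects_sl2_mat_coeff) (auto simp: weight_vec_def)

text \<open>
  The power of \<open>1 - 2 h J_+\<close> in the twist matrix cancels one of the two powers in the twisted product;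
  the other one is moved past the invariant form, where it becomes the right-hand side.
\<close>

lemma orthogonality_right:
  assumes "spin j" "k1 \<in> weights j" "k2 \<in> weights j"
  shows "(\<Sum>m1\<in>weights j. \<Sum>m2\<in>weights j. wconst (fps_const (sign_pow (k1 - m1)) * pow_elt j m1 m2 (- m1))
      * star (mat_coeff j k1 m1) (mat_coeff j k2 m2)) = wconst (pow_elt j k1 k2 (- k1))"
proof -
  note um = weights_uminus[OF assms(1)]
  have inner: "(\<Sum>m2\<in>weights j. wconst (fps_const (sign_pow (k1 - m1)) * pow_elt j m1 m2 (- m1))
      * star (mat_coeff j k1 m1) (mat_coeff j k2 m2))
    = (\<Sum>s\<in>weights j. wconst (pow_elt j k1 k2 s) * (sconst (k1 - m1) * (mat_coeff j k1 m1 * mat_coeff j s (- m1))))"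
    if m1: "m1 \<in> weights j" for m1
  proof -
    have "(\<Sum>m2\<in>weights j. wconst (fps_const (sign_pow (k1 - m1)) * pow_elt j m1 m2 (- m1))
        * star (mat_coeff j k1 m1) (mat_coeff j k2 m2))
      = sconst (k1 - m1) * (mat_coeff j k1 m1 * lpow (of_real k1) (rpow (- of_real m1)
          (\<Sum>m2\<in>weights j. wconst (pow_elt j m1 m2 (- m1)) * mat_coeff j k2 m2)))"
      by (simp only: star_mat_coeff[OF assms(1,2) m1 assms(3)] lact_sum ract_sum lact_linear(4) ract_linear(4)
          sum_distrib_left wconst_hom(4)) (simp only: mult_ac)
    also have "(\<Sum>m2\<in>weights j. wconst (pow_elt j m1 m2 (- m1)) * mat_coeff j k2 m2)
        = rpow (of_real m1) (mat_coeff j k2 (- m1))"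
      by (rule rpow_mat_coeff[OF assms(3), symmetric])
    also have "lpow (of_real k1) (rpow (- of_real m1) (rpow (of_real m1) (mat_coeff j k2 (- m1))))
        = (\<Sum>s\<in>weights j. wconst (pow_elt j k1 k2 s) * mat_coeff j s (- m1))"
      by (simp add: rpow_add lpow_mat_coeff[OF assms(3)])
    finally show ?thesis
      by (simp only: sum_distrib_left) (simp only: mult_ac)
  qed
  have "(\<Sum>m1\<in>weights j. \<Sum>m2\<in>weights j. wconst (fps_const (sign_pow (k1 - m1)) * pow_elt j m1 m2 (- m1))
      * star (mat_coeff j k1 m1) (mat_coeff j k2 m2))
    = (\<Sum>m1\<in>weights j. \<Sum>s\<in>weights j. wconst (pow_elt j k1 k2 s)
        * (sconst (k1 - m1) * (mat_coeff j k1 m1 * mat_coeff j s (- m1))))"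
    by (intro sum.cong refl inner)
  also have "\<dots> = (\<Sum>s\<in>weights j. wconst (pow_elt j k1 k2 s)
      * (\<Sum>m1\<in>weights j. sconst (k1 - m1) * (mat_coeff j k1 m1 * mat_coeff j s (- m1))))"
    by (subst sum.swap) (simp only: sum_distrib_left)
  also have "\<dots> = (\<Sum>s\<in>weights j. if s = - k1 then wconst (pow_elt j k1 k2 (- k1)) else 0)"
    by (intro sum.cong refl) (auto simp: classical_orthogonality_right[OF assms(1,2)])
  also have "\<dots> = wconst (pow_elt j k1 k2 (- k1))"
    using um[OF assms(2)] by (simp add: sum.delta)
  finally show ?thesis .
qed

lemma orthogonality_left:
  assumes "spin j" "m1 \<in> weights j" "m2 \<in> weights j"
  shows "(\<Sum>k1\<in>weights j. \<Sum>k2\<in>weights j. wconst (fps_const (sign_pow (m1 - k1)) * pow_elt j (- k1) (- k1) k2)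
      * star (mat_coeff j k1 m1) (mat_coeff j k2 m2)) = wconst (pow_elt j (- m1) (- m1) m2)"
proof -
  note um = weights_uminus[OF assms(1)]
  have inner: "(\<Sum>k2\<in>weights j. wconst (fps_const (sign_pow (m1 - k1)) * pow_elt j (- k1) (- k1) k2)
      * star (mat_coeff j k1 m1) (mat_coeff j k2 m2))
    = (\<Sum>s\<in>weights j. wconst (pow_elt j (- m1) s m2) * (sconst (m1 - k1) * (mat_coeff j k1 m1 * mat_coeff j (- k1) s)))"
    if k1: "k1 \<in> weights j" for k1
  proof -
    have "(\<Sum>k2\<in>weights j. wconst (fps_const (sign_pow (m1 - k1)) * pow_elt j (- k1) (- k1) k2)
        * star (mat_coeff j k1 m1) (mat_coeff j k2 m2))
      = (\<Sum>k2\<in>weights j. wconst (fps_const (sign_pow (m1 - k1)) * pow_elt j (- k1) (- k1) k2)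
        * (mat_coeff j k1 m1 * lpow (of_real k1) (rpow (- of_real m1) (mat_coeff j k2 m2))))"
      by (intro sum.cong refl) (simp only: star_mat_coeff[OF assms(1) k1 assms(2)])
    also have "\<dots> = sconst (m1 - k1) * (mat_coeff j k1 m1 * lpow (of_real k1) (rpow (- of_real m1)
          (\<Sum>k2\<in>weights j. wconst (pow_elt j (- k1) (- k1) k2) * mat_coeff j k2 m2)))"
      by (simp only: lact_sum ract_sum lact_linear(4) ract_linear(4)
          sum_distrib_left wconst_hom(4)) (simp only: mult_ac)
    also have "(\<Sum>k2\<in>weights j. wconst (pow_elt j (- k1) (- k1) k2) * mat_coeff j k2 m2)
        = lpow (of_real (- k1)) (mat_coeff j (- k1) m2)"
      by (rule lpow_mat_coeff[OF um[OF k1], symmetric])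
    also have "lpow (of_real k1) (rpow (- of_real m1) (lpow (of_real (- k1)) (mat_coeff j (- k1) m2)))
        = rpow (of_real (- m1)) (mat_coeff j (- k1) m2)"
      by (simp add: lact_ract_commute lpow_add)
    also have "\<dots> = (\<Sum>s\<in>weights j. wconst (pow_elt j (- m1) s m2) * mat_coeff j (- k1) s)"
      by (rule rpow_mat_coeff[OF um[OF k1]])
    finally show ?thesis
      by (simp only: sum_distrib_left) (simp only: mult_ac)
  qed
  have "(\<Sum>k1\<in>weights j. \<Sum>k2\<in>weights j. wconst (fps_const (sign_pow (m1 - k1)) * pow_elt j (- k1) (- k1) k2)
      * star (mat_coeff j k1 m1) (mat_coeff j k2 m2))
    = (\<Sum>k1\<in>weights j. \<Sum>s\<in>weights j. wconst (pow_elt j (- m1) s m2)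
        * (sconst (m1 - k1) * (mat_coeff j k1 m1 * mat_coeff j (- k1) s)))"
    by (intro sum.cong refl inner)
  also have "\<dots> = (\<Sum>s\<in>weights j. wconst (pow_elt j (- m1) s m2)
      * (\<Sum>k1\<in>weights j. sconst (m1 - k1) * (mat_coeff j k1 m1 * mat_coeff j (- k1) s)))"
    by (subst sum.swap) (simp only: sum_distrib_left)
  also have "\<dots> = (\<Sum>s\<in>weights j. if s = - m1 then wconst (pow_elt j (- m1) (- m1) m2) else 0)"
    by (intro sum.cong refl) (auto simp: classical_orthogonality_left[OF assms(1,2)])
  also have "\<dots> = wconst (pow_elt j (- m1) (- m1) m2)"
    using um[OF assms(2)] by (simp add: sum.delta)
  finally show ?thesis .
qed

lemma slh_fun_sum: "slh_fun (\<Sum>i\<in>I. a i) = (\<Sum>i\<in>I. slh_fun (a i))"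
  by (induction I rule: infinite_finite_induct) (simp_all add: slh_fun_hom)

lemma slh_fun_scal_mult: "slh_fun (slh_scal c * a) = wconst c * slh_fun a"
  by (simp add: slh_fun_hom star_wconst finite_type_respects[OF finite_type_slh_fun])

lemma at_h0_hom:
  "at_h0 (a + b) g = at_h0 a g + at_h0 b g" "at_h0 (a * b) g = at_h0 a g * at_h0 b g"
  "at_h0 (slh_scal c) g = fps_nth c 0" "at_h0 0 g = 0"
proof -
  show "at_h0 (a + b) g = at_h0 a g + at_h0 b g" by transfer (rule free_at_h0_add)
  show "at_h0 (a * b) g = at_h0 a g * at_h0 b g" by transfer (rule free_at_h0_mult)
  show "at_h0 (slh_scal c) g = fps_nth c 0" by (simp add: slh_scal_def at_h0.abs_eq free_at_h0_scal)
  show "at_h0 0 g = 0" by transfer (rule free_at_h0_zero)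
qed

lemma at_h0_sum: "at_h0 (\<Sum>i\<in>I. a i) g = (\<Sum>i\<in>I. at_h0 (a i) g)"
  by (induction I rule: infinite_finite_induct) (simp_all add: at_h0_hom)

theorem proposition3p6:
  fixes j :: real
  assumes "spin j"
  shows "(\<forall>k1\<in>weights j. \<forall>k2\<in>weights j.
           (\<Sum>m1\<in>weights j. \<Sum>m2\<in>weights j.
              slh_scal (fps_const (sign_pow (k1 - m1)) * twist_elt j j m1 (- m1) m1 m2)
                * (D_fun j k1 m1 * D_fun j k2 m2))
           = slh_scal (twist_elt j j k1 (- k1) k1 k2)) \<and>
         (\<forall>m1\<in>weights j. \<forall>m2\<in>weights j.
           (\<Sum>k1\<in>weights j. \<Sum>k2\<in>weights j.
              slh_scal (fps_const (sign_pow (m1 - k1)) * twist_inv_elt j j k1 k2 k1 (- k1))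
                * (D_fun j k1 m1 * D_fun j k2 m2))
           = slh_scal (twist_inv_elt j j m1 m2 m1 (- m1))) \<and>
         (\<forall>m'\<in>weights j. \<forall>m\<in>weights j. at_h0 (D_fun j m' m) = classical_D_fun j m' m) \<and>
         (\<forall>s1\<in>weights j. \<forall>s2\<in>weights j. \<forall>m1\<in>weights j. \<forall>m2\<in>weights j.
           fps_nth (twist_elt j j s1 s2 m1 m2) 0 = (if m1 = s1 \<and> m2 = s2 then 1 else 0) \<and>
           fps_nth (twist_inv_elt j j s1 s2 m1 m2) 0 = (if m1 = s1 \<and> m2 = s2 then 1 else 0)) \<and>
         (\<forall>k1\<in>weights j. \<forall>k2\<in>weights j. \<forall>g.
           (\<Sum>m\<in>weights j. sign_pow (k1 - m)
              * (classical_D_fun j k1 m g * classical_D_fun j k2 (- m) g))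
           = (if k2 = - k1 then 1 else 0)) \<and>
         (\<forall>m1\<in>weights j. \<forall>m2\<in>weights j. \<forall>g.
           (\<Sum>k\<in>weights j. sign_pow (m1 - k)
              * (classical_D_fun j k m1 g * classical_D_fun j (- k) m2 g))
           = (if m2 = - m1 then 1 else 0))"
proof -
  note um = weights_uminus[OF assms] and D = D_fun_properties[OF assms]
  have right: "(\<Sum>m1\<in>weights j. \<Sum>m2\<in>weights j.
        slh_scal (fps_const (sign_pow (k1 - m1)) * twist_elt j j m1 (- m1) m1 m2)
          * (D_fun j k1 m1 * D_fun j k2 m2))
      = slh_scal (twist_elt j j k1 (- k1) k1 k2)"
    if k: "k1 \<in> weights j" "k2 \<in> weights j" for k1 k2
  proof (rule slh_fun_inject)
    show "slh_fun (\<Sum>m1\<in>weights j. \<Sum>m2\<in>weights j.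
        slh_scal (fps_const (sign_pow (k1 - m1)) * twist_elt j j m1 (- m1) m1 m2)
          * (D_fun j k1 m1 * D_fun j k2 m2))
      = slh_fun (slh_scal (twist_elt j j k1 (- k1) k1 k2))"
      using orthogonality_right[OF assms k]
      by (simp only: slh_fun_sum slh_fun_scal_mult) (simp add: slh_fun_hom D k um assms twist_elt_pow_elt cong: sum.cong)
  qed
  have left: "(\<Sum>k1\<in>weights j. \<Sum>k2\<in>weights j.
        slh_scal (fps_const (sign_pow (m1 - k1)) * twist_inv_elt j j k1 k2 k1 (- k1))
          * (D_fun j k1 m1 * D_fun j k2 m2))
      = slh_scal (twist_inv_elt j j m1 m2 m1 (- m1))"
    if m: "m1 \<in> weights j" "m2 \<in> weights j" for m1 m2
  proof (rule slh_fun_inject)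
    show "slh_fun (\<Sum>k1\<in>weights j. \<Sum>k2\<in>weights j.
        slh_scal (fps_const (sign_pow (m1 - k1)) * twist_inv_elt j j k1 k2 k1 (- k1))
          * (D_fun j k1 m1 * D_fun j k2 m2))
      = slh_fun (slh_scal (twist_inv_elt j j m1 m2 m1 (- m1)))"
      using orthogonality_left[OF assms m]
      by (simp only: slh_fun_sum slh_fun_scal_mult) (simp add: slh_fun_hom D m um assms twist_elt_pow_elt cong: sum.cong)
  qed
  have F: "fps_nth (twist_elt j j s1 s2 m1 m2) 0 = (if m1 = s1 \<and> m2 = s2 then 1 else 0)"
    "fps_nth (twist_inv_elt j j s1 s2 m1 m2) 0 = (if m1 = s1 \<and> m2 = s2 then 1 else 0)"
    if "s1 \<in> weights j" "s2 \<in> weights j" "m1 \<in> weights j" "m2 \<in> weights j" for s1 s2 m1 m2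
    using that by (simp_all add: twist_elt_pow_elt assms pow_elt_nth_0)
  have classical_right: "(\<Sum>m\<in>weights j. sign_pow (k1 - m)
        * (classical_D_fun j k1 m g * classical_D_fun j k2 (- m) g)) = (if k2 = - k1 then 1 else 0)"
    if k: "k1 \<in> weights j" "k2 \<in> weights j" for k1 k2 g
  proof -
    have "(\<Sum>m\<in>weights j. sign_pow (k1 - m) * (classical_D_fun j k1 m g * classical_D_fun j k2 (- m) g))
        = (\<Sum>m1\<in>weights j. \<Sum>m2\<in>weights j. if m2 = - m1
            then sign_pow (k1 - m1) * (classical_D_fun j k1 m1 g * classical_D_fun j k2 (- m1) g) else 0)"
      by (intro sum.cong refl) (simp add: sum.delta um)
    also have "\<dots> = (\<Sum>m1\<in>weights j. \<Sum>m2\<in>weights j.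
        at_h0 (slh_scal (fps_const (sign_pow (k1 - m1)) * twist_elt j j m1 (- m1) m1 m2)
          * (D_fun j k1 m1 * D_fun j k2 m2)) g)"
      by (intro sum.cong refl) (auto simp: at_h0_hom F D k um)
    also have "\<dots> = at_h0 (slh_scal (twist_elt j j k1 (- k1) k1 k2)) g"
      by (simp only: at_h0_sum[symmetric] right[OF k])
    also have "\<dots> = (if k2 = - k1 then 1 else 0)"
      using k by (simp add: at_h0_hom F um)
    finally show ?thesis .
  qed
  have classical_left: "(\<Sum>k\<in>weights j. sign_pow (m1 - k)
        * (classical_D_fun j k m1 g * classical_D_fun j (- k) m2 g)) = (if m2 = - m1 then 1 else 0)"
    if m: "m1 \<in> weights j" "m2 \<in> weights j" for m1 m2 g
  proof -
    have "(\<Sum>k\<in>weights j. sign_pow (m1 - k) * (classical_D_fun j k m1 g * classical_D_fun j (- k) m2 g))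
        = (\<Sum>k1\<in>weights j. \<Sum>k2\<in>weights j. if k2 = - k1
            then sign_pow (m1 - k1) * (classical_D_fun j k1 m1 g * classical_D_fun j (- k1) m2 g) else 0)"
      by (intro sum.cong refl) (simp add: sum.delta um)
    also have "\<dots> = (\<Sum>k1\<in>weights j. \<Sum>k2\<in>weights j.
        at_h0 (slh_scal (fps_const (sign_pow (m1 - k1)) * twist_inv_elt j j k1 k2 k1 (- k1))
          * (D_fun j k1 m1 * D_fun j k2 m2)) g)"
      by (intro sum.cong refl) (auto simp: at_h0_hom F D m um)
    also have "\<dots> = at_h0 (slh_scal (twist_inv_elt j j m1 m2 m1 (- m1))) g"
      by (simp only: at_h0_sum[symmetric] left[OF m])
    also have "\<dots> = (if m2 = - m1 then 1 else 0)"
      using m by (auto simp: at_h0_hom F um)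
    finally show ?thesis .
  qed
  show ?thesis
    by (intro conjI ballI allI right left F classical_right classical_left D(2))
qed

end
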